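(* Consider the analytic system $\dot x=f(x,u)$, $y=h(x)$ and an open set $\mathcal X\subset\mathbb R^n$. Suppose that (A1) the null input $u=0$ makes the system observable over $\mathcal X$ in some time; (A2) for all $x\in\mathcal X$ there exists $k_x\in\mathbb N$ such that $\frac{\partial\mathcal H_{k_x}(\cdot,0,0)}{\partial x}(x)$ is injective. Let $\mathcal K$ be a compact subset of $\mathcal X$. Let $\bar T>0$ and let $\mathcal U_{\mathcal K}$ be the set of inputs $v\in C^\infty([0,\bar T],\mathbb R^p)$ (endowed with the compact-open topology) for which there exist $T\in(0,\bar T]$ and an integer $q$ such that the map $x\mapsto\mathcal H_q(x,t,\mu\mathsf Rv)$ is an injective immersion over $\mathcal K$ for all $t\in[0,T]$, all $\mu\in[0,1]$ and all $\mathsf R\in\mathrm O(p)$. Then: (i) $\mathcal U_{\mathcal K}$ contains a countable intersection of open and dense subsets of $C^\infty([0,\bar T],\mathbb R^p)$; (ii) the restriction of $\mathcal U_{\mathcal K}$ to analytic inputs, $\mathcal U_{\mathcal K}\cap C^\omega([0,\bar T],\mathbb R^p)$, is dense in $C^\infty([0,\bar T],\mathbb R^p)$.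
   Context: System: $f:\mathbb R^n\times\mathbb R^p\to\mathbb R^n$ and $h:\mathbb R^n\to\mathbb R^m$ are real analytic; $X(x_0,t,u)$ is the maximal solution of $\dot x=f(x,u(t))$, $x(0)=x_0$. $\mathrm O(p)$ is the orthogonal group of $\mathbb R^p$. Jets of the output: $H_0=h$ and $$H_{k+1}(x,\sigma_0,\dots,\sigma_k)=\frac{\partial H_k}{\partial x}(x,\sigma_0,\dots,\sigma_{k-1})f(x,\sigma_0)+\sum_{i=0}^{k-1}\frac{\partial H_k}{\partial\sigma_i}(x,\sigma_0,\dots,\sigma_{k-1})\sigma_{i+1}.$$ $\mathcal H_k(x,t,u)\in\mathbb R^{m(k+1)}$ is the vector whose blocks are $H_j(x,u(t),u^{(1)}(t),\dots,u^{(j-1)}(t))$, $0\le j\le k$. A map is an immersion over a set if its differential is injective at every point of the set. Observability: the system is observable over a set $S\subset\mathbb R^n$ in time $\tau$ for the input $u$ if for all $x_0\ne\tilde x_0$ in $S$ there exists $t\in[0,\tau]$ such that $X(x_0,\cdot,u)$ and $X(\tilde x_0,\cdot,u)$ are well defined and lie in $S$ on $[0,t]$, and $h(X(x_0,t,u))\ne h(X(\tilde x_0,t,u))$. Topology: a fundamental system of neighborhoods of $u\in C^\infty([0,\bar T],\mathbb R^p)$ in the compact-open topology is given by the sets $\{v:\|v^{(j)}-u^{(j)}\|_\infty<\varepsilon_j,\ j=0,\dots,k\}$, $k\in\mathbb N$, $\varepsilon_0,\dots,\varepsilon_k>0$, where $\|\cdot\|_\infty$ is the uniform norm on $[0,\bar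 T]$. $C^\omega([0,\bar T],\mathbb R^p)$ denotes restrictions to $[0,\bar T]$ of analytic functions on a larger open interval. *)

theory Defs
  imports "HOL-Analysis.Analysis"
begin

text \<open>Real analyticity: local expansion in an unconditionally convergent power series; the
  multi-indices are the functions \<open>Basis \<rightarrow>\<^sub>E UNIV\<close>.\<close>

definition real_analytic_on ::
  "('a::euclidean_space \<Rightarrow> 'b::euclidean_space) \<Rightarrow> 'a set \<Rightarrow> bool"
  (infix "real'_analytic'_on" 50) where
  "g real_analytic_on S \<longleftrightarrow>
     (\<forall>x\<in>S. \<exists>r>0. \<exists>c :: ('a \<Rightarrow> nat) \<Rightarrow> 'b. \<forall>y\<in>ball x r.
        ((\<lambda>\<alpha>. (\<Prod>b\<in>Basis. ((y - x) \<bullet> b) ^ \<alpha> b) *\<^sub>R c \<alpha>) has_sum g y) (Basis \<rightarrow>\<^sub>E UNIV))"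

text \<open>Derivatives of inputs are taken within the domain \<open>I\<close> of the input, hence are one-sided
  at its endpoints.\<close>

definition nderiv :: "real set \<Rightarrow> nat \<Rightarrow> (real \<Rightarrow> 'b::real_normed_vector) \<Rightarrow> real \<Rightarrow> 'b" where
  "nderiv I j u = ((\<lambda>g t. vector_derivative g (at t within I)) ^^ j) u"

text \<open>Functions on \<open>{0..T}\<close> are represented as extensional functions on the reals.\<close>

definition Cinf :: "real \<Rightarrow> (real \<Rightarrow> 'b::real_normed_vector) set" where
  "Cinf T = {u \<in> extensional {0..T}.
     \<forall>j. \<forall>t\<in>{0..T}. nderiv {0..T} j u differentiable (at t within {0..T})}"

definition Comega :: "real \<Rightarrow> (real \<Rightarrow> 'b::euclidean_space) set" where
  "Comega T = {u \<in> extensional {0..T}.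
     \<exists>a b g. a < 0 \<and> T < b \<and> g real_analytic_on {a<..<b} \<and> (\<forall>t\<in>{0..T}. u t = g t)}"

definition Cinf_nhd ::
  "real \<Rightarrow> (real \<Rightarrow> 'b::real_normed_vector) \<Rightarrow> nat \<Rightarrow> (nat \<Rightarrow> real) \<Rightarrow> (real \<Rightarrow> 'b) set" where
  "Cinf_nhd T u k \<epsilon> = {v \<in> Cinf T.
     \<forall>j\<le>k. (SUP t\<in>{0..T}. norm (nderiv {0..T} j v t - nderiv {0..T} j u t)) < \<epsilon> j}"

definition Cinf_topology :: "real \<Rightarrow> (real \<Rightarrow> 'b::real_normed_vector) topology" where
  "Cinf_topology T = topology (\<lambda>U. U \<subseteq> Cinf T \<and>
     (\<forall>u\<in>U. \<exists>k \<epsilon>. (\<forall>j\<le>k. 0 < \<epsilon> j) \<and> Cinf_nhd T u k \<epsilon> \<subseteq> U))"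

lemma openin_Cinf_topology:
  "openin (Cinf_topology T) U \<longleftrightarrow>
     U \<subseteq> Cinf T \<and> (\<forall>u\<in>U. \<exists>k \<epsilon>. (\<forall>j\<le>k. 0 < \<epsilon> j) \<and> Cinf_nhd T u k \<epsilon> \<subseteq> U)"
proof -
  let ?P = "\<lambda>U. U \<subseteq> Cinf T \<and>
     (\<forall>u\<in>U. \<exists>k \<epsilon>. (\<forall>j\<le>k. 0 < \<epsilon> j) \<and> Cinf_nhd T u k \<epsilon> \<subseteq> U)"
  have "?P (A \<inter> B)" if A: "?P A" and B: "?P B" for A B
  proof (intro conjI ballI)
    show "A \<inter> B \<subseteq> Cinf T" using A by blast
    fix u assume u: "u \<in> A \<inter> B"
    obtain k \<epsilon> where 1: "\<forall>j\<le>k. 0 < \<epsilon> j" "Cinf_nhd T u k \<epsilon> \<subseteq> A" using A u by blast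
    obtain l \<delta> where 2: "\<forall>j\<le>l. 0 < \<delta> j" "Cinf_nhd T u l \<delta> \<subseteq> B" using B u by blast
    define \<eta> where "\<eta> j = (if j \<le> k then if j \<le> l then min (\<epsilon> j) (\<delta> j) else \<epsilon> j
      else if j \<le> l then \<delta> j else 1)" for j
    have "\<forall>j\<le>max k l. 0 < \<eta> j" using 1 2 by (auto simp: \<eta>_def)
    moreover have "Cinf_nhd T u (max k l) \<eta> \<subseteq> Cinf_nhd T u k \<epsilon>"
    proof -
      have "\<eta> j \<le> \<epsilon> j" if "j \<le> k" for j using that by (auto simp: \<eta>_def)
      then show ?thesis unfolding Cinf_nhd_def
        by (smt (verit, best) Collect_mono max.coboundedI1 mem_Collect_eq)
    qed
    moreover have "Cinf_nhd T u (max k l) \<eta> \<subseteq> Cinf_nhd T u l \<delta>"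
    proof -
      have "\<eta> j \<le> \<delta> j" if "j \<le> l" for j using that by (auto simp: \<eta>_def)
      then show ?thesis unfolding Cinf_nhd_def
        by (smt (verit, best) Collect_mono max.coboundedI2 mem_Collect_eq)
    qed
    ultimately show "\<exists>k \<epsilon>. (\<forall>j\<le>k. 0 < \<epsilon> j) \<and> Cinf_nhd T u k \<epsilon> \<subseteq> A \<inter> B"
      using 1 2 by (meson Int_greatest order_trans)
  qed
  moreover have "?P (\<Union>\<K>)" if "\<forall>K\<in>\<K>. ?P K" for \<K>
    using that by (meson Union_iff Union_least Union_upper order_trans)
  ultimately have "istopology ?P"
    unfolding istopology_def by blast
  then show ?thesis
    unfolding Cinf_topology_def by (subst topology_inverse') auto
qed

lemma topspace_Cinf_topology [simp]: "topspace (Cinf_topology T) = Cinf T"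
proof -
  have "openin (Cinf_topology T) (Cinf T)"
    unfolding openin_Cinf_topology Cinf_nhd_def by (auto intro!: exI[of _ "\<lambda>_. 1"])
  then show ?thesis
    by (metis openin_Cinf_topology openin_subset openin_topspace subset_antisym)
qed

lemma openin_Cinf_nhd:
  assumes "u \<in> Cinf T" "0 \<le> T"
  shows "openin (Cinf_topology T) (Cinf_nhd T u k \<epsilon>)"
proof -
  define N where "N j a b = (SUP t\<in>{0..T}. norm (nderiv {0..T} j a t - nderiv {0..T} j b t))"
    for j and a b :: "real \<Rightarrow> 'a"
  have cont: "continuous_on {0..T} (nderiv {0..T} j a)" if "a \<in> Cinf T" for j a
    using that unfolding Cinf_def
    by (simp add: differentiable_imp_continuous_on differentiable_on_def)
  have bdd: "bdd_above ((\<lambda>t. norm (nderiv {0..T} j a t - nderiv {0..T} j b t)) ` {0..T})"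
    if "a \<in> Cinf T" "b \<in> Cinf T" for j a b
    by (intro bounded_imp_bdd_above compact_imp_bounded compact_continuous_image
        continuous_intros cont that compact_Icc)
  have tri: "N j a c \<le> N j a b + N j b c"
    if "a \<in> Cinf T" "b \<in> Cinf T" "c \<in> Cinf T" for j a b c
    unfolding N_def
  proof (rule cSUP_least)
    show "{0..T} \<noteq> {}" using assms by simp
    fix t assume t: "t \<in> {0..T}"
    show "norm (nderiv {0..T} j a t - nderiv {0..T} j c t) \<le>
      (SUP t\<in>{0..T}. norm (nderiv {0..T} j a t - nderiv {0..T} j b t)) +
      (SUP t\<in>{0..T}. norm (nderiv {0..T} j b t - nderiv {0..T} j c t))"
      using cSUP_upper[OF t bdd[OF that(1,2), of j]] cSUP_upper[OF t bdd[OF that(2,3), of j]]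
        norm_triangle_ineq[of "nderiv {0..T} j a t - nderiv {0..T} j b t"
          "nderiv {0..T} j b t - nderiv {0..T} j c t"]
      by simp
  qed
  have "\<exists>l \<delta>. (\<forall>j\<le>l. 0 < \<delta> j) \<and> Cinf_nhd T v l \<delta> \<subseteq> Cinf_nhd T u k \<epsilon>"
    if v: "v \<in> Cinf_nhd T u k \<epsilon>" for v
  proof (intro exI conjI)
    show "\<forall>j\<le>k. 0 < \<epsilon> j - N j v u"
      using v by (simp add: Cinf_nhd_def N_def)
    show "Cinf_nhd T v k (\<lambda>j. \<epsilon> j - N j v u) \<subseteq> Cinf_nhd T u k \<epsilon>"
    proof
      fix w assume w: "w \<in> Cinf_nhd T v k (\<lambda>j. \<epsilon> j - N j v u)"
      have "N j w u < \<epsilon> j" if "j \<le> k" for j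
      proof -
        have "N j w v < \<epsilon> j - N j v u" using w that by (simp add: Cinf_nhd_def N_def)
        moreover have "N j w u \<le> N j w v + N j v u"
          using v w assms by (intro tri) (auto simp: Cinf_nhd_def)
        ultimately show ?thesis by simp
      qed
      then show "w \<in> Cinf_nhd T u k \<epsilon>" using w by (auto simp: Cinf_nhd_def N_def)
    qed
  qed
  then show ?thesis
    unfolding openin_Cinf_topology by (auto simp: Cinf_nhd_def)
qed

text \<open>\<open>J\<close> is a time interval starting at \<open>0\<close> in the domain \<open>I\<close> of the input; the values of \<open>\<phi>\<close>
  outside \<open>J\<close> are irrelevant.\<close>

definition is_solution ::
  "('a::real_normed_vector \<times> 'b \<Rightarrow> 'a) \<Rightarrow> real set \<Rightarrow> (real \<Rightarrow> 'b) \<Rightarrow> 'a \<Rightarrow> real set \<Rightarrow> (real \<Rightarrow> 'a)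
    \<Rightarrow> bool" where
  "is_solution f I u x0 J \<phi> \<longleftrightarrow>
     J \<subseteq> I \<inter> {0..} \<and> is_interval J \<and> 0 \<in> J \<and> \<phi> 0 = x0 \<and>
     (\<forall>t\<in>J. (\<phi> has_vector_derivative f (\<phi> t, u t)) (at t within J))"

definition is_maximal_solution ::
  "('a::real_normed_vector \<times> 'b \<Rightarrow> 'a) \<Rightarrow> real set \<Rightarrow> (real \<Rightarrow> 'b) \<Rightarrow> 'a \<Rightarrow> real set \<Rightarrow> (real \<Rightarrow> 'a)
    \<Rightarrow> bool" where
  "is_maximal_solution f I u x0 J \<phi> \<longleftrightarrow>
     is_solution f I u x0 J \<phi> \<and>
     (\<forall>J' \<phi>'. is_solution f I u x0 J' \<phi>' \<and> J \<subseteq> J' \<and> (\<forall>t\<in>J. \<phi>' t = \<phi> t) \<longrightarrow> J' = J)"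

text \<open>For continuous inputs and \<open>f\<close> continuously differentiable, the maximal solution exists and
  is unique on its interval, so quantifying it existentially is the same as naming it.\<close>

definition observable ::
  "('a::real_normed_vector \<times> 'b \<Rightarrow> 'a) \<Rightarrow> ('a \<Rightarrow> 'c) \<Rightarrow> real set \<Rightarrow> (real \<Rightarrow> 'b) \<Rightarrow> 'a set \<Rightarrow> real
    \<Rightarrow> bool" where
  "observable f h I u S \<tau> \<longleftrightarrow>
     (\<forall>x\<in>S. \<forall>x'\<in>S. x \<noteq> x' \<longrightarrow>
       (\<exists>t\<in>{0..\<tau>}. \<exists>J \<phi> J' \<phi>'.
          is_maximal_solution f I u x J \<phi> \<and> is_maximal_solution f I u x' J' \<phi>' \<and>
          {0..t} \<subseteq> J \<and> {0..t} \<subseteq> J' \<and> (\<forall>s\<in>{0..t}. \<phi> s \<in> S \<and> \<phi>' s \<in> S) \<and>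
          h (\<phi> t) \<noteq> h (\<phi>' t)))"

text \<open>The \<open>k\<close>-th jet is a function of \<open>x\<close> and of \<open>\<sigma> 0, \<dots>, \<sigma> (k - 1)\<close>; the remaining entries of
  the sequence \<open>\<sigma>\<close> are ignored, see \<open>output_jet_cong\<close>.\<close>

primrec output_jet ::
  "('a::real_normed_vector \<times> 'b::real_normed_vector \<Rightarrow> 'a) \<Rightarrow> ('a \<Rightarrow> 'c::real_normed_vector) \<Rightarrow>
    nat \<Rightarrow> 'a \<Rightarrow> (nat \<Rightarrow> 'b) \<Rightarrow> 'c" where
  "output_jet f h 0 = (\<lambda>x \<sigma>. h x)"
| "output_jet f h (Suc k) = (\<lambda>x \<sigma>.
     frechet_derivative (\<lambda>y. output_jet f h k y \<sigma>) (at x) (f (x, \<sigma> 0)) +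
     (\<Sum>i<k. frechet_derivative (\<lambda>s. output_jet f h k x (\<sigma>(i := s))) (at (\<sigma> i)) (\<sigma> (Suc i))))"

lemma output_jet_cong:
  assumes "\<And>i. i < k \<Longrightarrow> \<sigma> i = \<sigma>' i"
  shows "output_jet f h k x \<sigma> = output_jet f h k x \<sigma>'"
  using assms
proof (induction k arbitrary: x \<sigma> \<sigma>')
  case (Suc k)
  have 1: "(\<lambda>y. output_jet f h k y \<sigma>) = (\<lambda>y. output_jet f h k y \<sigma>')"
    by (rule ext, rule Suc.IH) (simp add: Suc.prems)
  have 2: "(\<lambda>s. output_jet f h k x (\<sigma>(i := s))) = (\<lambda>s. output_jet f h k x (\<sigma>'(i := s)))" for i
    by (rule ext, rule Suc.IH) (simp add: Suc.prems)
  show ?case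
    by (auto simp: 1 2 Suc.prems intro!: sum.cong)
qed simp

text \<open>Elements of \<open>\<real>\<^bsup>m(k+1)\<^esup>\<close> are represented by their \<open>k + 1\<close> blocks, as extensional functions
  on \<open>{..k}\<close>.\<close>

definition jet_vector ::
  "('a::real_normed_vector \<times> 'b::real_normed_vector \<Rightarrow> 'a) \<Rightarrow> ('a \<Rightarrow> 'c::real_normed_vector) \<Rightarrow>
    real set \<Rightarrow> nat \<Rightarrow> 'a \<Rightarrow> real \<Rightarrow> (real \<Rightarrow> 'b) \<Rightarrow> nat \<Rightarrow> 'c" where
  "jet_vector f h I k x t u = (\<lambda>j\<in>{..k}. output_jet f h j x (\<lambda>i. nderiv I i u t))"

text \<open>The differential of a map given by blocks \<open>0, \<dots>, k\<close> has as its blocks the differentials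
  of the blocks.\<close>

definition injective_differential ::
  "nat \<Rightarrow> ('a::real_normed_vector \<Rightarrow> nat \<Rightarrow> 'c::real_normed_vector) \<Rightarrow> 'a \<Rightarrow> bool" where
  "injective_differential k F x \<longleftrightarrow>
     (\<exists>D. (\<forall>j\<le>k. ((\<lambda>y. F y j) has_derivative D j) (at x)) \<and> inj (\<lambda>v. \<lambda>j\<in>{..k}. D j v))"

definition injective_immersion_over ::
  "nat \<Rightarrow> ('a::real_normed_vector \<Rightarrow> nat \<Rightarrow> 'c::real_normed_vector) \<Rightarrow> 'a set \<Rightarrow> bool" where
  "injective_immersion_over k F S \<longleftrightarrow> inj_on F S \<and> (\<forall>x\<in>S. injective_differential k F x)"

definition good_inputs ::
  "((real^'n) \<times> (real^'p) \<Rightarrow> real^'n) \<Rightarrow> (real^'n \<Rightarrow> real^'m) \<Rightarrow> real \<Rightarrow> (real^'n) set \<Rightarrow>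
    (real \<Rightarrow> real^'p) set" where
  "good_inputs f h Tbar K = {v \<in> Cinf Tbar. \<exists>T q. 0 < T \<and> T \<le> Tbar \<and>
     (\<forall>t\<in>{0..T}. \<forall>\<mu>\<in>{0..1}. \<forall>R :: real^'p^'p. orthogonal_matrix R \<longrightarrow>
        injective_immersion_over q
          (\<lambda>x. jet_vector f h {0..Tbar} q x t (\<lambda>s. \<mu> *\<^sub>R (R *v v s))) K)}"

end

theory Submission
  imports Defs "HOL-Computational_Algebra.Polynomial"
begin

text \<open>By (A1), (A2), analyticity and compactness, there is \<open>k\<close> such that the jets of order \<open>k\<close> of the
  output for the null input separate and immerse \<open>K\<close>; this persists for small jets of the input and
  on a neighbourhood of \<open>K\<close>. Given any jet \<open>\<sigma>\<close> of order \<open>m\<close>, the polynomial input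
  \<open>w t = (\<Sum>i\<le>m. \<sigma> i * t ^ i / i!) * (1 - (t / s) ^ (m + 1)) ^ (k + 1)\<close> has jet \<open>\<sigma>\<close> at \<open>0\<close> and vanishing
  jet of order \<open>k\<close> at \<open>s\<close>, and on \<open>{0..s}\<close> it is bounded independently of \<open>s\<close>. For small \<open>s\<close>, the flow
  up to time \<open>s\<close> of any input \<open>A w\<close> with \<open>A\<close> a contraction moves \<open>K\<close> only slightly, so the jets at time
  \<open>s\<close> are separating. Since outputs are analytic in time, the same holds at time \<open>0\<close>, where by compactness
  of the set of contractions finitely many derivatives suffice uniformly in \<open>A\<close>. Hence every
  jet of the input extends to one of higher order which is good, stably under perturbations. As jets at
  \<open>0\<close> of order greater than \<open>m\<close> can be prescribed by changes of the input whose first \<open>m\<close> derivatives are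
  uniformly small, the inputs with a good jet at \<open>0\<close> form an open set, and the polynomials in
  this set are dense among all inputs.\<close>

section \<open>Iterated directional derivatives and analyticity\<close>

text \<open>No solution is shown to be analytic in time. The time derivatives of the output are
  iterated Lie derivatives of an autonomous field with input and time as extra states; on compact
  sets they are bounded by \<open>C * Q ^ j * j!\<close>, and the identity theorem runs on this
  bound. Hence analyticity is handled by Cauchy estimates on iterated directional derivatives.
  Injectivity and immersion are carried back from \<open>s\<close> to \<open>0\<close> by the same
  argument, applied to the system and to the system coupled with its variational equation. The order
  of choices shapes \<open>w\<close>: \<open>s\<close> must be small relative to Lipschitz constants
  on a set containing the values of \<open>w\<close>, while \<open>w\<close> depends on
  \<open>s\<close>. So the bound on \<open>w\<close> must not involve \<open>s\<close>; its
  derivatives may blow up as \<open>s\<close> shrinks, but those that enter the jets of order at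
  most \<open>k\<close> at \<open>s\<close> vanish there. The contractions include every
  \<open>\<mu> *\<^sub>R R\<close>, form a compact set and preserve the bound on
  \<open>w\<close>.\<close>

primrec iter_deriv ::
  "('a::real_normed_vector \<Rightarrow> 'b::real_normed_vector) \<Rightarrow> 'a list \<Rightarrow> 'a \<Rightarrow> 'b" where
  "iter_deriv g [] = g"
| "iter_deriv g (v # vs) = (\<lambda>y. frechet_derivative (iter_deriv g vs) (at y) v)"

definition norm_prod :: "'a::real_normed_vector list \<Rightarrow> real" where
  "norm_prod vs = prod_list (map norm vs)"

lemma norm_prod_simps [simp]:
  "norm_prod [] = 1" "norm_prod (v # vs) = norm v * norm_prod vs"
  "norm_prod (us @ vs) = norm_prod us * norm_prod vs"
  by (simp_all add: norm_prod_def)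

lemma norm_prod_nonneg [simp]: "0 \<le> norm_prod vs"
  by (induction vs) auto

abbreviation derivs_at ::
  "('a::real_normed_vector list \<Rightarrow> 'a \<Rightarrow> 'b::real_normed_vector) \<Rightarrow> 'a list \<Rightarrow> 'a \<Rightarrow> bool" where
  "derivs_at D vs y \<equiv> (D vs has_derivative (\<lambda>v. D (v # vs) y)) (at y)"

abbreviation cauchy_bound :: "real \<Rightarrow> real \<Rightarrow> 'a::real_normed_vector list \<Rightarrow> real" where
  "cauchy_bound C B vs \<equiv> C * B ^ length vs * fact (length vs) * norm_prod vs"

definition deriv_bound ::
  "('a::real_normed_vector \<Rightarrow> 'b::real_normed_vector) \<Rightarrow> 'a \<Rightarrow> real \<Rightarrow> real \<Rightarrow> bool" where
  "deriv_bound g y C B \<longleftrightarrow> 0 \<le> C \<and> 0 \<le> B \<and>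
     (\<forall>vs. norm (iter_deriv g vs y) \<le> cauchy_bound C B vs)"

definition smooth_fun :: "('a::real_normed_vector \<Rightarrow> 'b::real_normed_vector) \<Rightarrow> bool" where
  "smooth_fun g \<longleftrightarrow> (\<forall>vs y. iter_deriv g vs differentiable (at y))"

text \<open>Real analyticity on the whole space in the form of Cauchy estimates that are uniform
  near each point. Unlike power series, these bounds pass easily through derivatives, products and
  Lie derivatives.\<close>

definition analytic_fun :: "('a::real_normed_vector \<Rightarrow> 'b::real_normed_vector) \<Rightarrow> bool" where
  "analytic_fun g \<longleftrightarrow> smooth_fun g \<and>
     (\<forall>x. \<exists>C B \<delta>. 0 < \<delta> \<and> (\<forall>y\<in>ball x \<delta>. deriv_bound g y C B))"

lemma smooth_fun_has_derivative:
  assumes "smooth_fun g"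
  shows "(iter_deriv g vs has_derivative (\<lambda>v. iter_deriv g (v # vs) y)) (at y)"
  using assms frechet_derivative_works unfolding smooth_fun_def by fastforce

lemma smooth_fun_has_derivative0:
  assumes "smooth_fun g"
  shows "(g has_derivative (\<lambda>v. iter_deriv g [v] y)) (at y)"
  using smooth_fun_has_derivative[OF assms, of "[]"] by simp

text \<open>A family indexed by lists that starts at \<open>g\<close> and gains a direction at the
  head with each derivative can only be the family of iterated derivatives. So derivatives are
  computed by guessing \<open>D\<close> and checking one step; the head of a list is the direction
  differentiated last.\<close>

lemma iter_deriv_unique:
  assumes S: "open S" and D0: "\<And>y. y \<in> S \<Longrightarrow> D [] y = g y"
    and D: "\<And>y vs. y \<in> S \<Longrightarrow> derivs_at D vs y"
    and y: "y \<in> S"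
  shows "iter_deriv g vs y = D vs y"
    and "(iter_deriv g vs has_derivative (\<lambda>v. D (v # vs) y)) (at y)"
proof -
  have "\<forall>y\<in>S. iter_deriv g vs y = D vs y \<and>
      (iter_deriv g vs has_derivative (\<lambda>v. D (v # vs) y)) (at y)" for vs
  proof (induction vs)
    case Nil
    then show ?case
      using D0 has_derivative_transform_within_open[OF D S] by fastforce
  next
    case (Cons u vs)
    have 1: "iter_deriv g (u # vs) y = D (u # vs) y" if "y \<in> S" for y
      using Cons that frechet_derivative_at by (metis iter_deriv.simps(2))
    then have "(iter_deriv g (u # vs) has_derivative (\<lambda>v. D (v # u # vs) y)) (at y)" if "y \<in> S" for y
      using has_derivative_transform_within_open[OF D S] that by metis
    with 1 show ?case by blast
  qed
  with y show "iter_deriv g vs y = D vs y"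
    "(iter_deriv g vs has_derivative (\<lambda>v. D (v # vs) y)) (at y)" by auto
qed

lemma iter_deriv_unique_UNIV:
  assumes "D [] = g" "\<And>y vs. derivs_at D vs y"
  shows "iter_deriv g vs = D vs" "smooth_fun g"
  using iter_deriv_unique[of UNIV D g] assms unfolding smooth_fun_def differentiable_def
  by (auto simp del: iter_deriv.simps) blast

lemma analytic_funI:
  assumes "\<And>x. \<exists>D C B \<delta>. 0 < \<delta> \<and> 0 \<le> C \<and> 0 \<le> B \<and> (\<forall>y\<in>ball x \<delta>. D [] y = g y \<and>
     (\<forall>vs. derivs_at D vs y \<and>
        norm (D vs y) \<le> cauchy_bound C B vs))"
  shows "analytic_fun g"
proof -
  have "(\<forall>vs. iter_deriv g vs differentiable (at x)) \<and>
    (\<exists>C B \<delta>. 0 < \<delta> \<and> (\<forall>y\<in>ball x \<delta>. deriv_bound g y C B))" for x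
  proof -
    obtain D C B \<delta> where *: "0 < \<delta>" "0 \<le> C" "0 \<le> B" "\<forall>y\<in>ball x \<delta>. D [] y = g y \<and>
     (\<forall>vs. derivs_at D vs y \<and>
        norm (D vs y) \<le> cauchy_bound C B vs)"
      using assms by blast
    have **: "iter_deriv g vs y = D vs y"
      "(iter_deriv g vs has_derivative (\<lambda>v. D (v # vs) y)) (at y)" if "y \<in> ball x \<delta>" for y vs
      using * that by (auto intro!: iter_deriv_unique[of "ball x \<delta>" D])
    have "deriv_bound g y C B" if "y \<in> ball x \<delta>" for y
      unfolding deriv_bound_def **(1)[OF that] using * that by auto
    then show ?thesis using **(2)[of x] * unfolding differentiable_def by (metis centre_in_ball)
  qed
  then show ?thesis unfolding analytic_fun_def smooth_fun_def by blast
qed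

lemma analytic_funI_UNIV:
  assumes "D [] = g" "\<And>y vs. derivs_at D vs y"
    and "\<And>x. \<exists>\<delta>>0. \<exists>C\<ge>0. \<exists>B\<ge>0. \<forall>y\<in>ball x \<delta>. \<forall>vs.
        norm (D vs y) \<le> cauchy_bound C B vs"
  shows "analytic_fun g"
  unfolding analytic_fun_def deriv_bound_def
  using assms(3) iter_deriv_unique_UNIV[OF assms(1,2)] by (metis (no_types, lifting))

lemma analytic_fun_smooth: "analytic_fun g \<Longrightarrow> smooth_fun g"
  by (simp add: analytic_fun_def)

lemma analytic_fun_locally:
  assumes "analytic_fun g"
  obtains C B \<delta> where "0 < \<delta>" "0 \<le> C" "0 \<le> B" "\<And>y. y \<in> ball x \<delta> \<Longrightarrow> deriv_bound g y C B"
  using assms unfolding analytic_fun_def deriv_bound_def by (metis centre_in_ball)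

lemma deriv_bound_mono:
  assumes "deriv_bound g y C B" "C \<le> C'" "B \<le> B'"
  shows "deriv_bound g y C' B'"
proof -
  have "cauchy_bound C B vs
      \<le> C' * B' ^ length vs * fact (length vs) * norm_prod vs" for vs :: "'a list"
    using assms by (intro mult_right_mono mult_mono power_mono) (auto simp: deriv_bound_def)
  then show ?thesis using assms unfolding deriv_bound_def
    by (meson order_trans)
qed

lemma deriv_boundD:
  fixes g :: "'a::real_normed_vector \<Rightarrow> 'b::real_normed_vector"
  assumes "deriv_bound g y C B"
  shows "norm (iter_deriv g vs y) \<le> cauchy_bound C B vs"
  using assms[unfolded deriv_bound_def, THEN conjunct2, THEN conjunct2, THEN spec, of vs] .

lemma iter_deriv_append:
  "iter_deriv (iter_deriv g ws) vs = iter_deriv g (vs @ ws)"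
proof (induction vs)
  case Nil show ?case by simp
next
  case (Cons v vs)
  show ?case unfolding append_Cons iter_deriv.simps(2) Cons ..
qed

lemma smooth_fun_iter_deriv: "smooth_fun g \<Longrightarrow> smooth_fun (iter_deriv g ws)"
  unfolding smooth_fun_def iter_deriv_append by blast

lemma fact_add_le: "fact (m + n) \<le> (2::real) ^ (m + n) * fact m * fact n"
proof -
  have "fact (m + n) = fact m * fact n * real ((m + n) choose m)"
    using binomial_fact_lemma[of m "m + n"] by (metis (no_types, lifting) add_diff_cancel_left'
        le_add1 of_nat_fact of_nat_mult)
  moreover have "real ((m + n) choose m) \<le> 2 ^ (m + n)"
    using binomial_le_pow2[of "m+n" m] by (metis of_nat_le_iff of_nat_numeral of_nat_power)
  ultimately show ?thesis
    by (simp add: mult.commute mult.left_commute mult_left_mono)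
qed

text \<open>The split \<open>(m + n)! \<le> 2 ^ (m + n) * m! * n!\<close> separates the fixed
  directions \<open>ws\<close> from the new ones: the factor for \<open>ws\<close> goes into
  \<open>C\<close>, and \<open>B\<close> doubles.\<close>

lemma analytic_fun_iter_deriv:
  assumes "analytic_fun g"
  shows "analytic_fun (iter_deriv g ws)"
proof -
  have "\<exists>C B \<delta>. 0 < \<delta> \<and> (\<forall>y\<in>ball x \<delta>. deriv_bound (iter_deriv g ws) y C B)" for x
  proof -
    obtain C B \<delta> where *: "0 < \<delta>" "0 \<le> C" "0 \<le> B" "\<And>y. y \<in> ball x \<delta> \<Longrightarrow> deriv_bound g y C B"
      using analytic_fun_locally[OF assms] by metis
    let ?n = "length ws"
    have "deriv_bound (iter_deriv g ws) y (C * (2*B) ^ ?n * fact ?n * norm_prod ws) (2 * B)"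
      if "y \<in> ball x \<delta>" for y
      unfolding deriv_bound_def iter_deriv_append
    proof (intro conjI allI)
      fix vs :: "'a list"
      let ?m = "length vs"
      have "norm (iter_deriv g (vs @ ws) y) \<le>
          C * B ^ (?m + ?n) * fact (?m + ?n) * (norm_prod vs * norm_prod ws)"
        using deriv_boundD[OF *(4)[OF that], of "vs @ ws"] by simp
      also have "\<dots> \<le> C * B ^ (?m + ?n) * (2 ^ (?m + ?n) * fact ?m * fact ?n) *
          (norm_prod vs * norm_prod ws)"
        using * by (intro mult_right_mono mult_left_mono fact_add_le) auto
      also have "\<dots> = C * (2*B) ^ ?n * fact ?n * norm_prod ws * (2*B) ^ ?m * fact ?m * norm_prod vs"
        by (simp add: power_add power_mult_distrib)
      finally show "norm (iter_deriv g (vs @ ws) y) \<le>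
        C * (2*B) ^ ?n * fact ?n * norm_prod ws * (2*B) ^ ?m * fact ?m * norm_prod vs" .
    qed (use * in auto)
    then show ?thesis using * by blast
  qed
  then show ?thesis
    using assms smooth_fun_iter_deriv unfolding analytic_fun_def by blast
qed

section \<open>Closure of the analytic functions under linear maps and sums\<close>

lemma analytic_fun_linear_compose:
  assumes g: "analytic_fun g" and L: "bounded_linear L"
  shows "analytic_fun (\<lambda>y. g (L y))"
proof (rule analytic_funI)
  interpret L: bounded_linear L by fact
  fix x
  obtain C B \<delta> where *: "0 < \<delta>" "0 \<le> C" "0 \<le> B" "\<And>y. y \<in> ball (L x) \<delta> \<Longrightarrow> deriv_bound g y C B"
    using analytic_fun_locally[OF g] by metis
  obtain K where K: "0 < K" "\<And>v. norm (L v) \<le> norm v * K" using L.pos_bounded by blast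
  have np: "norm_prod (map L vs) \<le> K ^ length vs * norm_prod vs" for vs
  proof (induction vs)
    case (Cons v vs)
    have "norm (L v) * norm_prod (map L vs) \<le> (norm v * K) * (K ^ length vs * norm_prod vs)"
      using K Cons by (intro mult_mono) auto
    then show ?case by (simp add: mult_ac)
  qed simp
  have op: "open (L -` ball (L x) \<delta>)"
    by (intro open_vimage open_ball L.continuous_on continuous_on_id)
  have "x \<in> L -` ball (L x) \<delta>" using *(1) by simp
  with op obtain \<delta>' where \<delta>': "\<delta>' > 0" "ball x \<delta>' \<subseteq> L -` ball (L x) \<delta>" by (rule openE)
  let ?D = "\<lambda>vs y. iter_deriv g (map L vs) (L y)"
  have dd: "derivs_at ?D vs y" for vs y
    using has_derivative_compose[OF L.has_derivative[OF has_derivative_ident]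
        smooth_fun_has_derivative[OF analytic_fun_smooth[OF g]]] by simp
  have nn: "norm (?D vs y) \<le> C * (B*K) ^ length vs * fact (length vs) * norm_prod vs"
    if "y \<in> ball x \<delta>'" for vs y
  proof -
    have "norm (?D vs y) \<le> C * B ^ length vs * fact (length vs) * norm_prod (map L vs)"
      using deriv_boundD[OF *(4), of "L y" "map L vs"] \<delta>' that by auto
    also have "\<dots> \<le> C * B ^ length vs * fact (length vs) * (K ^ length vs * norm_prod vs)"
      using * np by (intro mult_left_mono) auto
    finally show ?thesis by (simp add: power_mult_distrib mult_ac)
  qed
  show "\<exists>D C B \<delta>. 0 < \<delta> \<and> 0 \<le> C \<and> 0 \<le> B \<and> (\<forall>y\<in>ball x \<delta>. D [] y = g (L y) \<and>
     (\<forall>vs. derivs_at D vs y \<and>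
        norm (D vs y) \<le> cauchy_bound C B vs))"
    by (rule exI[of _ ?D], rule exI[of _ C], rule exI[of _ "B * K"], rule exI[of _ \<delta>'])
      (use * \<delta>' K dd nn in auto)
qed

lemma smooth_fun_linear_image:
  assumes g: "smooth_fun g" and L: "bounded_linear L"
  shows "iter_deriv (\<lambda>y. L (g y)) vs = (\<lambda>y. L (iter_deriv g vs y))" "smooth_fun (\<lambda>y. L (g y))"
  using bounded_linear.has_derivative[OF L smooth_fun_has_derivative[OF g]]
    iter_deriv_unique_UNIV[of "\<lambda>vs y. L (iter_deriv g vs y)"] by auto

lemma deriv_bound_linear_image:
  assumes g: "smooth_fun g" and L: "bounded_linear L" and K: "0 \<le> K" "\<And>v. norm (L v) \<le> K * norm v"
    and b: "deriv_bound g y C B"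
  shows "deriv_bound (\<lambda>y. L (g y)) y (K * C) B"
  unfolding deriv_bound_def smooth_fun_linear_image(1)[OF g L]
proof (intro conjI allI)
  fix vs
  have "norm (L (iter_deriv g vs y)) \<le> K * norm (iter_deriv g vs y)" by (rule K)
  also have "\<dots> \<le> K * cauchy_bound C B vs"
    using deriv_boundD[OF b] K by (intro mult_left_mono) auto
  finally show "norm (L (iter_deriv g vs y)) \<le> K * C * B ^ length vs * fact (length vs) * norm_prod vs"
    by (simp add: mult_ac)
qed (use K b in \<open>auto simp: deriv_bound_def\<close>)

lemma analytic_fun_linear_image:
  assumes g: "analytic_fun g" and L: "bounded_linear L"
  shows "analytic_fun (\<lambda>y. L (g y))"
proof -
  obtain K where K: "0 < K" "\<And>v. norm (L v) \<le> K * norm v"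
    using bounded_linear.pos_bounded[OF L] by (metis mult.commute)
  show ?thesis
    using g deriv_bound_linear_image[OF _ L less_imp_le[OF K(1)] K(2)] smooth_fun_linear_image[OF _ L]
    unfolding analytic_fun_def by metis
qed

lemma analytic_fun_const [simp, intro]: "analytic_fun (\<lambda>_. c)"
proof (rule analytic_funI_UNIV)
  let ?D = "\<lambda>vs y. if vs = [] then c else 0"
  show "derivs_at ?D vs y" for vs and y :: 'a by (cases vs) auto
  show "\<exists>\<delta>>0. \<exists>C\<ge>0. \<exists>B\<ge>0. \<forall>y\<in>ball x \<delta>. \<forall>vs.
        norm (?D vs y) \<le> cauchy_bound C B vs" for x :: 'a
    by (rule exI[of _ 1], simp, rule exI[of _ "norm c"], simp, rule exI[of _ 1], simp)
qed simp

lemma smooth_fun_add: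
  assumes f: "smooth_fun f" and g: "smooth_fun g"
  shows "iter_deriv (\<lambda>y. f y + g y) vs = (\<lambda>y. iter_deriv f vs y + iter_deriv g vs y)"
    "smooth_fun (\<lambda>y. f y + g y)"
  using has_derivative_add[OF smooth_fun_has_derivative[OF f] smooth_fun_has_derivative[OF g]]
    iter_deriv_unique_UNIV[of "\<lambda>vs y. iter_deriv f vs y + iter_deriv g vs y"] by auto

lemma deriv_bound_add:
  assumes f: "smooth_fun f" and g: "smooth_fun g"
    and b: "deriv_bound f y C B" "deriv_bound g y C' B"
  shows "deriv_bound (\<lambda>y. f y + g y) y (C + C') B"
  unfolding deriv_bound_def smooth_fun_add(1)[OF f g]
proof (intro conjI allI)
  fix vs
  show "norm (iter_deriv f vs y + iter_deriv g vs y) \<le> (C + C') * B ^ length vs * fact (length vs) * norm_prod vs"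
    using norm_triangle_mono[OF deriv_boundD[OF b(1), of vs] deriv_boundD[OF b(2), of vs]]
    by (simp add: algebra_simps)
qed (use b in \<open>auto simp: deriv_bound_def\<close>)

lemma analytic_fun_add:
  assumes f: "analytic_fun f" and g: "analytic_fun g"
  shows "analytic_fun (\<lambda>y. f y + g y)"
  unfolding analytic_fun_def
proof (intro conjI allI)
  note s = analytic_fun_smooth[OF f] analytic_fun_smooth[OF g]
  show "smooth_fun (\<lambda>y. f y + g y)" using smooth_fun_add s by blast
  fix x
  obtain C B \<delta> where 1: "0 < \<delta>" "0 \<le> C" "0 \<le> B" "\<And>y. y \<in> ball x \<delta> \<Longrightarrow> deriv_bound f y C B"
    using analytic_fun_locally[OF f] by metis
  obtain C' B' \<delta>' where 2: "0 < \<delta>'" "0 \<le> C'" "0 \<le> B'" "\<And>y. y \<in> ball x \<delta>' \<Longrightarrow> deriv_bound g y C' B'"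
    using analytic_fun_locally[OF g] by metis
  show "\<exists>C B \<delta>. 0 < \<delta> \<and> (\<forall>y\<in>ball x \<delta>. deriv_bound (\<lambda>y. f y + g y) y C B)"
    by (rule exI[of _ "C + C'"], rule exI[of _ "max B B'"], rule exI[of _ "min \<delta> \<delta>'"])
      (use 1 2 in \<open>auto intro!: deriv_bound_add s intro: deriv_bound_mono[OF _ order_refl max.cobounded1]
        deriv_bound_mono[OF _ order_refl max.cobounded2]\<close>)
qed

lemma analytic_fun_sum:
  assumes "\<And>i. i \<in> I \<Longrightarrow> analytic_fun (f i)"
  shows "analytic_fun (\<lambda>y. \<Sum>i\<in>I. f i y)"
  using assms by (induction I rule: infinite_finite_induct) (auto intro: analytic_fun_add)

lemma smooth_fun_sum:
  assumes "finite I" "\<And>i. i \<in> I \<Longrightarrow> smooth_fun (f i)"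
  shows "iter_deriv (\<lambda>y. \<Sum>i\<in>I. f i y) vs = (\<lambda>y. \<Sum>i\<in>I. iter_deriv (f i) vs y)"
proof -
  have "((\<lambda>y. \<Sum>i\<in>I. iter_deriv (f i) vs y) has_derivative (\<lambda>v. \<Sum>i\<in>I. iter_deriv (f i) (v # vs) y)) (at y)" for vs y
    by (rule has_derivative_sum) (use assms smooth_fun_has_derivative in blast)
  then show ?thesis
    by (intro iter_deriv_unique_UNIV(1)[of "\<lambda>vs y. \<Sum>i\<in>I. iter_deriv (f i) vs y"]) auto
qed

lemma analytic_fun_bounded_linear:
  assumes L: "bounded_linear L" shows "analytic_fun L"
proof -
  interpret L: bounded_linear L by fact
  obtain K where K: "0 < K" "\<And>v. norm (L v) \<le> norm v * K" using L.pos_bounded by blast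
  let ?D = "\<lambda>vs y. case vs of [] \<Rightarrow> L y | [v] \<Rightarrow> L v | _ \<Rightarrow> 0"
  have der: "derivs_at ?D vs y" for vs y
    by (cases vs rule: remdups_adj.cases) (auto intro!: L.has_derivative[OF has_derivative_ident])
  have "\<exists>\<delta>>0. \<exists>C\<ge>0. \<exists>B\<ge>0. \<forall>y\<in>ball x \<delta>. \<forall>vs.
        norm (?D vs y) \<le> cauchy_bound C B vs" for x
  proof -
    \<comment> \<open>Covers both orders that do not vanish: on the unit ball around
      \<open>x\<close> the value is at most \<open>K * (norm x + 1)\<close>, and the first
      derivative is at most \<open>K\<close> times the norm of its direction.\<close>
    define C where "C = K * (norm x + 1) + K"
  have b: "norm (?D vs y) \<le> C * 1 ^ length vs * fact (length vs) * norm_prod vs"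
    if "y \<in> ball x 1" for vs y
  proof -
    have "norm y \<le> norm x + 1" using that
      by (metis dist_commute dist_norm less_eq_real_def mem_ball norm_triangle_sub add_left_mono order_trans)
    then have "norm (L y) \<le> K * (norm x + 1)"
      using K by (metis mult.commute mult_left_mono less_eq_real_def order_trans)
    then have "norm (L y) \<le> C" using K(1) unfolding C_def by linarith
    moreover have "norm (L v) \<le> C * norm v" for v
    proof -
      have "K * norm v \<le> C * norm v" using K unfolding C_def by (intro mult_right_mono) auto
      then show ?thesis using K(2)[of v] by (simp add: mult.commute)
    qed
    moreover have C0: "0 \<le> C" using K by (simp add: C_def)
    ultimately show ?thesis
      by (simp split: list.split)
  qed
    show ?thesis
    proof (rule exI[of _ 1], rule conjI, simp, rule exI[of _ C], rule conjI)
      show "0 \<le> C" using K by (simp add: C_def)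
      show "\<exists>B\<ge>0. \<forall>y\<in>ball x 1. \<forall>vs.
          norm (?D vs y) \<le> cauchy_bound C B vs"
        using b by (intro exI[of _ 1]) auto
    qed
  qed
  with der show ?thesis by (intro analytic_funI_UNIV[of ?D]) auto
qed

section \<open>The Leibniz rule and products\<close>

primrec splits :: "'a list \<Rightarrow> ('a list \<times> 'a list) list" where
  "splits [] = [([], [])]"
| "splits (v # vs) =
     map (\<lambda>(us, ws). (v # us, ws)) (splits vs) @ map (\<lambda>(us, ws). (us, v # ws)) (splits vs)"

lemma splits_norm_prod: "(us, ws) \<in> set (splits vs) \<Longrightarrow> norm_prod us * norm_prod ws = norm_prod vs"
  by (induction vs arbitrary: us ws) auto

text \<open>For summands that see only the lengths, the \<open>2 ^ length vs\<close> ways to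
  distribute the directions over two factors collapse to a binomial sum; the induction step is
  Pascal's rule.\<close>

lemma sum_list_splits:
  fixes F :: "nat \<Rightarrow> nat \<Rightarrow> real"
  shows "(\<Sum>(us, ws)\<leftarrow>splits vs. F (length us) (length ws)) =
    (\<Sum>i\<le>length vs. real (length vs choose i) * F i (length vs - i))"
proof (induction vs arbitrary: F)
  case (Cons v vs)
  let ?m = "length vs"
  have "(\<Sum>(us, ws)\<leftarrow>splits (v # vs). F (length us) (length ws)) =
      (\<Sum>i\<le>?m. real (?m choose i) * F (Suc i) (?m - i)) + (\<Sum>i\<le>?m. real (?m choose i) * F i (Suc (?m - i)))"
    using Cons[of "\<lambda>i. F (Suc i)"] Cons[of "\<lambda>i j. F i (Suc j)"]
    by (simp add: o_def case_prod_unfold)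
  also have "(\<Sum>i\<le>?m. real (?m choose i) * F i (Suc (?m - i))) =
      (\<Sum>i\<le>Suc ?m. real (?m choose i) * F i (Suc ?m - i))"
    by (simp add: Suc_diff_le)
  also have "\<dots> = F 0 (Suc ?m) + (\<Sum>i\<le>?m. real (?m choose Suc i) * F (Suc i) (?m - i))"
    by (subst sum.atMost_Suc_shift) simp
  also have "(\<Sum>i\<le>?m. real (?m choose i) * F (Suc i) (?m - i)) + \<dots> =
      F 0 (Suc ?m) + (\<Sum>i\<le>?m. real (Suc ?m choose Suc i) * F (Suc i) (?m - i))"
    by (simp add: sum.distrib algebra_simps)
  also have "\<dots> = (\<Sum>i\<le>Suc ?m. real (Suc ?m choose i) * F i (Suc ?m - i))"
    by (simp only: sum.atMost_Suc_shift) simp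
  finally show ?case by simp
qed simp

lemma norm_sum_list_le: "norm (\<Sum>p\<leftarrow>ps. F p) \<le> (\<Sum>p\<leftarrow>ps. norm (F p))"
  by (induction ps) (auto intro: norm_triangle_le)

lemma has_derivative_sum_list:
  assumes "\<And>p. p \<in> set ps \<Longrightarrow> (F p has_derivative F' p) net"
  shows "((\<lambda>y. \<Sum>p\<leftarrow>ps. F p y) has_derivative (\<lambda>v. \<Sum>p\<leftarrow>ps. F' p v)) net"
  using assms by (induction ps) (auto intro: has_derivative_add)

text \<open>The recursion of \<open>splits\<close> is the product rule: a new direction falls on one
  factor or on the other.\<close>

lemma smooth_fun_scaleR:
  fixes \<phi> :: "'a::real_normed_vector \<Rightarrow> real"
  assumes \<phi>: "smooth_fun \<phi>" and g: "smooth_fun g"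
  shows "iter_deriv (\<lambda>y. \<phi> y *\<^sub>R g y) vs =
      (\<lambda>y. \<Sum>(us, ws)\<leftarrow>splits vs. iter_deriv \<phi> us y *\<^sub>R iter_deriv g ws y)" (is ?A)
    "smooth_fun (\<lambda>y. \<phi> y *\<^sub>R g y)" (is ?B)
proof -
  let ?D = "\<lambda>vs y. \<Sum>(us, ws)\<leftarrow>splits vs. iter_deriv \<phi> us y *\<^sub>R iter_deriv g ws y"
  have "derivs_at ?D vs y" for vs y
  proof -
    have "(?D vs has_derivative (\<lambda>v. \<Sum>p\<leftarrow>splits vs.
        iter_deriv \<phi> (fst p) y *\<^sub>R iter_deriv g (v # snd p) y +
        iter_deriv \<phi> (v # fst p) y *\<^sub>R iter_deriv g (snd p) y)) (at y)"
      unfolding case_prod_unfold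
      by (intro has_derivative_sum_list has_derivative_scaleR smooth_fun_has_derivative \<phi> g)
    moreover have "(\<Sum>p\<leftarrow>splits vs.
        iter_deriv \<phi> (fst p) y *\<^sub>R iter_deriv g (v # snd p) y +
        iter_deriv \<phi> (v # fst p) y *\<^sub>R iter_deriv g (snd p) y) = ?D (v # vs) y" for v
      unfolding splits.simps map_append sum_list_append map_map
      by (simp add: o_def case_prod_unfold sum_list_addf add.commute del: iter_deriv.simps)
    ultimately show ?thesis by simp
  qed
  then show ?A ?B by (intro iter_deriv_unique_UNIV[of ?D]; simp)+
qed

text \<open>The bounds \<open>a\<close> and \<open>b\<close> are arbitrary functions of the order
  because two kinds of growth occur: \<open>n!\<close> for plain products and the shifted
  \<open>(j + n)!\<close> for iterated Lie derivatives.\<close>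

lemma norm_iter_deriv_scaleR_le:
  fixes \<phi> :: "'a::real_normed_vector \<Rightarrow> real"
  assumes \<phi>: "smooth_fun \<phi>" and g: "smooth_fun g"
    and a: "\<And>us. norm (iter_deriv \<phi> us y) \<le> a (length us) * norm_prod us"
    and b: "\<And>us. norm (iter_deriv g us y) \<le> b (length us) * norm_prod us"
    and a0: "\<And>i. 0 \<le> a i"
  shows "norm (iter_deriv (\<lambda>y. \<phi> y *\<^sub>R g y) vs y) \<le>
    (\<Sum>i\<le>length vs. real (length vs choose i) * (a i * b (length vs - i))) * norm_prod vs"
proof -
  have "norm (iter_deriv (\<lambda>y. \<phi> y *\<^sub>R g y) vs y) \<le>
      (\<Sum>(us, ws)\<leftarrow>splits vs. norm (iter_deriv \<phi> us y) * norm (iter_deriv g ws y))"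
    unfolding smooth_fun_scaleR(1)[OF \<phi> g] case_prod_unfold
    using norm_sum_list_le[of "\<lambda>p. iter_deriv \<phi> (fst p) y *\<^sub>R iter_deriv g (snd p) y" "splits vs"]
    by simp
  also have "\<dots> \<le> (\<Sum>(us, ws)\<leftarrow>splits vs. (a (length us) * b (length ws)) * norm_prod vs)"
    unfolding case_prod_unfold
  proof (rule sum_list_mono)
    fix p assume "p \<in> set (splits vs)"
    then have e: "norm_prod (fst p) * norm_prod (snd p) = norm_prod vs"
      using splits_norm_prod[of "fst p" "snd p" vs] by simp
    have "norm (iter_deriv \<phi> (fst p) y) * norm (iter_deriv g (snd p) y) \<le>
       (a (length (fst p)) * norm_prod (fst p)) * (b (length (snd p)) * norm_prod (snd p))"
      by (intro mult_mono a b) (auto intro!: a0 mult_nonneg_nonneg)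
    then show "norm (iter_deriv \<phi> (fst p) y) * norm (iter_deriv g (snd p) y)
        \<le> a (length (fst p)) * b (length (snd p)) * norm_prod vs"
      unfolding e[symmetric] by (simp add: mult_ac)
  qed
  also have "\<dots> = (\<Sum>(us, ws)\<leftarrow>splits vs. a (length us) * b (length ws)) * norm_prod vs"
    by (simp add: case_prod_unfold sum_list_mult_const)
  finally show ?thesis using sum_list_splits[of "\<lambda>i j. a i * b j" vs] by simp
qed

lemma choose_mult_fact: "i \<le> m \<Longrightarrow> real (m choose i) * (fact i * fact (m - i)) = fact m"
  using binomial_fact_lemma[of i m] by (metis mult.commute of_nat_fact of_nat_mult)

lemma analytic_fun_scaleR:
  fixes \<phi> :: "'a::real_normed_vector \<Rightarrow> real"
  assumes \<phi>: "analytic_fun \<phi>" and g: "analytic_fun g"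
  shows "analytic_fun (\<lambda>y. \<phi> y *\<^sub>R g y)"
  unfolding analytic_fun_def
proof (intro conjI allI)
  note s = analytic_fun_smooth[OF \<phi>] analytic_fun_smooth[OF g]
  show "smooth_fun (\<lambda>y. \<phi> y *\<^sub>R g y)" using smooth_fun_scaleR s by blast
  fix x
  obtain C B1 \<delta> where 1: "0 < \<delta>" "0 \<le> C" "0 \<le> B1" "\<And>y. y \<in> ball x \<delta> \<Longrightarrow> deriv_bound \<phi> y C B1"
    using analytic_fun_locally[OF \<phi>] by metis
  obtain C' B2 \<delta>' where 2: "0 < \<delta>'" "0 \<le> C'" "0 \<le> B2" "\<And>y. y \<in> ball x \<delta>' \<Longrightarrow> deriv_bound g y C' B2"
    using analytic_fun_locally[OF g] by metis
  define B where "B = max B1 B2"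
  have bd: "deriv_bound (\<lambda>y. \<phi> y *\<^sub>R g y) y (C * C') (2 * B)" if y: "y \<in> ball x (min \<delta> \<delta>')" for y
    unfolding deriv_bound_def
  proof (intro conjI allI)
    fix vs :: "'a list"
    let ?m = "length vs"
    have b: "deriv_bound \<phi> y C B" "deriv_bound g y C' B"
      using 1(4)[of y] 2(4)[of y] y unfolding B_def by (auto elim: deriv_bound_mono)
    have "norm (iter_deriv (\<lambda>y. \<phi> y *\<^sub>R g y) vs y) \<le> (\<Sum>i\<le>?m. real (?m choose i) *
        ((C * B ^ i * fact i) * (C' * B ^ (?m - i) * fact (?m - i)))) * norm_prod vs"
      using deriv_boundD[OF b(1)] deriv_boundD[OF b(2)] b
      by (intro norm_iter_deriv_scaleR_le s) (auto simp: deriv_bound_def)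
    also have "(\<Sum>i\<le>?m. real (?m choose i) *
        ((C * B ^ i * fact i) * (C' * B ^ (?m - i) * fact (?m - i)))) = (\<Sum>i\<le>?m. C * C' * B ^ ?m * fact ?m)"
    proof (rule sum.cong)
      fix i assume i: "i \<in> {..?m}"
      have "real (?m choose i) * ((C * B ^ i * fact i) * (C' * B ^ (?m - i) * fact (?m - i))) =
        C * C' * (B ^ i * B ^ (?m - i)) * (real (?m choose i) * (fact i * fact (?m - i)))"
        by (simp only: mult_ac)
      also have "B ^ i * B ^ (?m - i) = B ^ ?m" using i by (simp flip: power_add)
      also have "real (?m choose i) * (fact i * fact (?m - i)) = fact ?m"
        using i by (intro choose_mult_fact) simp
      finally show "real (?m choose i) * ((C * B ^ i * fact i) * (C' * B ^ (?m - i) * fact (?m - i))) =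
        C * C' * B ^ ?m * fact ?m" .
    qed simp
    \<comment> \<open>All summands of the Leibniz sum are equal; their number \<open>Suc ?m\<close>
      is at most \<open>2 ^ ?m\<close>, which doubles \<open>B\<close>.\<close>
    also have "\<dots> = real (Suc ?m) * (C * C' * B ^ ?m * fact ?m)" by simp
    also have "\<dots> * norm_prod vs \<le> 2 ^ ?m * (C * C' * B ^ ?m * fact ?m) * norm_prod vs"
    proof (intro mult_right_mono)
      show "real (Suc ?m) \<le> 2 ^ ?m"
        using less_exp[of ?m] by (metis Suc_leI of_nat_le_iff of_nat_numeral of_nat_power)
    qed (use 1 2 B_def in auto)
    finally show "norm (iter_deriv (\<lambda>y. \<phi> y *\<^sub>R g y) vs y) \<le> C * C' * (2 * B) ^ ?m * fact ?m * norm_prod vs"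
      by (simp add: power_mult_distrib mult_ac)
  qed (use 1 2 B_def in auto)
  show "\<exists>C B \<delta>. 0 < \<delta> \<and> (\<forall>y\<in>ball x \<delta>. deriv_bound (\<lambda>y. \<phi> y *\<^sub>R g y) y C B)"
    by (rule exI[of _ "C * C'"], rule exI[of _ "2 * B"], rule exI[of _ "min \<delta> \<delta>'"])
      (use 1 2 bd in auto)
qed

lemma iter_deriv_linear:
  assumes "smooth_fun g" shows "bounded_linear (\<lambda>v. iter_deriv g [v] y)"
  using smooth_fun_has_derivative0[OF assms] has_derivative_bounded_linear by blast

section \<open>Iterated Lie derivatives and their factorial growth\<close>

definition lie :: "('a::real_normed_vector \<Rightarrow> 'a) \<Rightarrow> ('a \<Rightarrow> 'b::real_normed_vector) \<Rightarrow> 'a \<Rightarrow> 'b" where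
  "lie G g z = iter_deriv g [G z] z"

primrec lie_pow ::
  "('a::real_normed_vector \<Rightarrow> 'a) \<Rightarrow> ('a \<Rightarrow> 'b::real_normed_vector) \<Rightarrow> nat \<Rightarrow> 'a \<Rightarrow> 'b" where
  "lie_pow G g 0 = g"
| "lie_pow G g (Suc j) = lie G (lie_pow G g j)"

text \<open>The direction \<open>G z\<close> varies with the point; expansion in
  \<open>Basis\<close> turns the Lie derivative into a sum of products, to which the Leibniz
  estimates apply.\<close>

lemma lie_Basis:
  fixes G :: "'a::euclidean_space \<Rightarrow> 'a"
  assumes "smooth_fun g"
  shows "lie G g = (\<lambda>z. \<Sum>b\<in>Basis. (G z \<bullet> b) *\<^sub>R iter_deriv g [b] z)"
proof
  fix z
  interpret bounded_linear "\<lambda>v. iter_deriv g [v] z" by (rule iter_deriv_linear[OF assms])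
  have "iter_deriv g [(\<Sum>b\<in>Basis. (G z \<bullet> b) *\<^sub>R b)] z = (\<Sum>b\<in>Basis. (G z \<bullet> b) *\<^sub>R iter_deriv g [b] z)"
    by (simp only: sum scaleR)
  then show "lie G g z = (\<Sum>b\<in>Basis. (G z \<bullet> b) *\<^sub>R iter_deriv g [b] z)"
    unfolding lie_def euclidean_representation .
qed

lemma analytic_fun_inner_const: "analytic_fun G \<Longrightarrow> analytic_fun (\<lambda>z. G z \<bullet> b)"
  using analytic_fun_linear_image[OF _ bounded_linear_inner_left] .

lemma analytic_fun_lie:
  fixes G :: "'a::euclidean_space \<Rightarrow> 'a"
  assumes "analytic_fun G" "analytic_fun g"
  shows "analytic_fun (lie G g)"
  unfolding lie_Basis[OF analytic_fun_smooth[OF assms(2)]]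
  by (intro analytic_fun_sum analytic_fun_scaleR analytic_fun_inner_const analytic_fun_iter_deriv assms)

lemma analytic_fun_lie_pow:
  fixes G :: "'a::euclidean_space \<Rightarrow> 'a"
  assumes "analytic_fun G" "analytic_fun g"
  shows "analytic_fun (lie_pow G g j)"
  by (induction j) (auto intro: analytic_fun_lie assms)

text \<open>The closure lemmas would enlarge \<open>B\<close> at each Lie derivative and ruin the
  iterated bound. Here \<open>B\<close> stays fixed: the order \<open>j\<close> enters through the
  shifted factorial, and each step multiplies \<open>C\<close> by the constant
  \<open>2 * DIM('a) * M * B\<close>. The margin \<open>2 * B0 \<le> B\<close> dominates the Leibniz
  sum by a geometric series of ratio 1/2.\<close>

lemma norm_iter_deriv_lie_le:
  fixes G :: "'a::euclidean_space \<Rightarrow> 'a" and M B C :: real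
  assumes G: "analytic_fun G" and g: "analytic_fun g"
    and GB: "deriv_bound G y M B0" and B: "2 * B0 \<le> B" and C: "0 \<le> C"
    and gB: "\<And>vs. norm (iter_deriv g vs y) \<le> C * B ^ length vs * fact (j + length vs) * norm_prod vs"
  shows "norm (iter_deriv (lie G g) vs y) \<le>
    (2 * DIM('a) * M * B * C) * B ^ length vs * fact (Suc j + length vs) * norm_prod vs"
proof -
  let ?m = "length vs"
  note s = analytic_fun_smooth
  have M: "0 \<le> M" "0 \<le> B0" "0 \<le> B" using GB B by (auto simp: deriv_bound_def)
  have Gb: "norm (iter_deriv (\<lambda>z. G z \<bullet> b) us y) \<le> (M * B0 ^ length us * fact (length us)) * norm_prod us"
    if "b \<in> Basis" for b us
  proof -
    have "deriv_bound (\<lambda>z. G z \<bullet> b) y (1 * M) B0"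
      by (rule deriv_bound_linear_image[OF s[OF G] bounded_linear_inner_left _ _ GB])
        (use that Basis_le_norm in auto)
    from deriv_boundD[OF this] show ?thesis by simp
  qed
  have trm: "norm (iter_deriv (\<lambda>z. (G z \<bullet> b) *\<^sub>R iter_deriv g [b] z) vs y) \<le>
      (2 * M * B * C) * B ^ ?m * fact (Suc j + ?m) * norm_prod vs" if b: "b \<in> Basis" for b
  proof -
    have gb: "norm (iter_deriv (iter_deriv g [b]) us y) \<le> (C * B ^ Suc (length us) * fact (Suc j + length us)) * norm_prod us" for us
      using gB[of "us @ [b]"] b unfolding iter_deriv_append by simp
    have "norm (iter_deriv (\<lambda>z. (G z \<bullet> b) *\<^sub>R iter_deriv g [b] z) vs y) \<le>
        (\<Sum>i\<le>?m. real (?m choose i) *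
        ((M * B0 ^ i * fact i) * (C * B ^ Suc (?m - i) * fact (Suc j + (?m - i))))) * norm_prod vs"
      by (rule norm_iter_deriv_scaleR_le[OF _ _ Gb[OF b] gb])
        (use G g M in \<open>auto intro!: s analytic_fun_inner_const analytic_fun_iter_deriv simp del: iter_deriv.simps\<close>)
    also have "\<dots> \<le> (\<Sum>i\<le>?m. (M * B * C * B ^ ?m * fact (Suc j + ?m)) * (1/2) ^ i) * norm_prod vs"
    proof (intro mult_right_mono sum_mono)
      fix i assume "i \<in> {..?m}"
      then have i: "i \<le> ?m" by simp
      have 1: "B0 ^ i * B ^ Suc (?m - i) \<le> B ^ Suc ?m * (1/2) ^ i"
      proof -
        have "B0 ^ i \<le> (B / 2) ^ i" using B M by (intro power_mono) auto
        then have "B0 ^ i * B ^ Suc (?m - i) \<le> (B / 2) ^ i * B ^ Suc (?m - i)"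
          using M by (intro mult_right_mono) auto
        also have "\<dots> = (B ^ i * B ^ Suc (?m - i)) * (1/2) ^ i" by (simp add: power_divide)
        also have "B ^ i * B ^ Suc (?m - i) = B ^ Suc ?m" using i by (simp add: flip: power_add)
        finally show ?thesis .
      qed
      have 2: "real (?m choose i) * (fact i * fact (Suc j + (?m - i))) \<le> fact (Suc j + ?m)"
      proof -
        have "real (?m choose i) \<le> real ((Suc j + ?m) choose i)"
          by (simp add: binomial_right_mono)
        then have "real (?m choose i) * (fact i * fact (Suc j + ?m - i))
            \<le> real ((Suc j + ?m) choose i) * (fact i * fact (Suc j + ?m - i))"
          by (intro mult_right_mono) auto
        also have "\<dots> = fact (Suc j + ?m)" using i by (intro choose_mult_fact) auto
        finally show ?thesis unfolding Nat.add_diff_assoc[OF i] .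
      qed
      have "real (?m choose i) * ((M * B0 ^ i * fact i) * (C * B ^ Suc (?m - i) * fact (Suc j + (?m - i))))
        = M * C * (B0 ^ i * B ^ Suc (?m - i)) * (real (?m choose i) * (fact i * fact (Suc j + (?m - i))))"
        by (simp only: mult_ac)
      also have "\<dots> \<le> M * C * (B ^ Suc ?m * (1/2) ^ i) * fact (Suc j + ?m)"
        by (rule mult_mono[OF mult_left_mono[OF 1] 2]) (use M C in auto)
      finally show "real (?m choose i) * ((M * B0 ^ i * fact i) * (C * B ^ Suc (?m - i) * fact (Suc j + (?m - i))))
        \<le> M * B * C * B ^ ?m * fact (Suc j + ?m) * (1 / 2) ^ i" by (simp add: mult_ac)
    qed simp
    also have "(\<Sum>i\<le>?m. (M * B * C * B ^ ?m * fact (Suc j + ?m)) * (1/2) ^ i) \<le>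
        (M * B * C * B ^ ?m * fact (Suc j + ?m)) * 2"
    proof -
      have "(\<Sum>i\<le>?m. (1/2::real) ^ i) \<le> 2"
        using sum_gp[of "1/2::real" 0 ?m] by (simp add: atMost_atLeast0)
      then show ?thesis unfolding sum_distrib_left[symmetric]
        using M C by (intro mult_left_mono) auto
    qed
    finally show ?thesis by (simp add: mult_ac mult_right_mono)
  qed
  have "norm (iter_deriv (lie G g) vs y) \<le>
      (\<Sum>b\<in>Basis. norm (iter_deriv (\<lambda>z. (G z \<bullet> b) *\<^sub>R iter_deriv g [b] z) vs y))"
    unfolding lie_Basis[OF s[OF g]]
    by (subst smooth_fun_sum)
      (auto intro!: s analytic_fun_scaleR analytic_fun_inner_const analytic_fun_iter_deriv G g norm_sum
         simp del: iter_deriv.simps)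
  also have "\<dots> \<le> (\<Sum>b\<in>(Basis::'a set). (2 * M * B * C) * B ^ ?m * fact (Suc j + ?m) * norm_prod vs)"
    by (intro sum_mono trm)
  finally show ?thesis by (simp add: mult_ac)
qed

text \<open>Although only values are bounded in the end, the induction runs over all directional
  derivatives, since each Lie derivative consumes one; the empty list gives the claim.\<close>

lemma lie_pow_bound:
  fixes G :: "'a::euclidean_space \<Rightarrow> 'a"
  assumes G: "analytic_fun G" and g: "analytic_fun g"
  shows "\<exists>C\<ge>0. \<exists>Q\<ge>0. \<exists>\<delta>>0. \<forall>y\<in>ball x \<delta>. \<forall>j. norm (lie_pow G g j y) \<le> C * Q ^ j * fact j"
proof -
  obtain M B0 \<delta>1 where 1: "0 < \<delta>1" "0 \<le> M" "0 \<le> B0" "\<And>y. y \<in> ball x \<delta>1 \<Longrightarrow> deriv_bound G y M B0"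
    using analytic_fun_locally[OF G] by metis
  obtain C B2 \<delta>2 where 2: "0 < \<delta>2" "0 \<le> C" "0 \<le> B2" "\<And>y. y \<in> ball x \<delta>2 \<Longrightarrow> deriv_bound g y C B2"
    using analytic_fun_locally[OF g] by metis
  define B where "B = max B2 (2 * B0)"
  define Q where "Q = 2 * DIM('a) * M * B"
  have Q: "0 \<le> Q" "0 \<le> B" using 1 2 by (auto simp: Q_def B_def)
  have "norm (iter_deriv (lie_pow G g j) vs y) \<le> C * Q ^ j * B ^ length vs * fact (j + length vs) * norm_prod vs"
    if y: "y \<in> ball x (min \<delta>1 \<delta>2)" for j vs y
  proof (induction j arbitrary: vs)
    case 0
    have "deriv_bound g y C B" using 2(4)[of y] y by (auto elim: deriv_bound_mono simp: B_def)
    from deriv_boundD[OF this] show ?case by simp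
  next
    case (Suc j)
    have "norm (iter_deriv (lie G (lie_pow G g j)) vs y) \<le>
      (2 * DIM('a) * M * B * (C * Q ^ j)) * B ^ length vs * fact (Suc j + length vs) * norm_prod vs"
      by (rule norm_iter_deriv_lie_le[OF G analytic_fun_lie_pow[OF G g] 1(4)[of y] _ _ Suc])
        (use y 2 Q in \<open>auto simp: B_def\<close>)
    then show ?case by (simp add: Q_def mult_ac)
  qed
  from this[where vs = "[]"]
  have "\<forall>y\<in>ball x (min \<delta>1 \<delta>2). \<forall>j. norm (lie_pow G g j y) \<le> C * Q ^ j * fact j" by simp
  then show ?thesis using 1(1) 2(1,2) Q by (metis min_less_iff_conj)
qed

section \<open>Symmetry of second derivatives and power series\<close>

lemma iter_deriv_along_line:
  assumes "smooth_fun g"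
  shows "((\<lambda>s. iter_deriv g vs (p + s *\<^sub>R b)) has_vector_derivative iter_deriv g (b # vs) (p + s *\<^sub>R b)) (at s)"
proof -
  interpret bounded_linear "\<lambda>v. iter_deriv g (v # vs) (p + s *\<^sub>R b)"
    using smooth_fun_has_derivative[OF assms] has_derivative_bounded_linear by blast
  have "((\<lambda>s. p + s *\<^sub>R b) has_derivative (\<lambda>h. h *\<^sub>R b)) (at s)"
    by (auto intro!: derivative_eq_intros)
  from has_derivative_compose[OF this smooth_fun_has_derivative[OF assms, of vs]]
  show ?thesis unfolding has_vector_derivative_def scaleR .
qed

lemma isCont_iter_deriv: "smooth_fun g \<Longrightarrow> isCont (iter_deriv g vs) y"
  using smooth_fun_has_derivative has_derivative_continuous by blast

lemma second_difference:
  fixes g :: "'a::real_normed_vector \<Rightarrow> real"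
  assumes g: "smooth_fun g" and h: "0 < h"
  shows "\<exists>\<xi> \<eta>. \<bar>\<xi>\<bar> \<le> h \<and> \<bar>\<eta>\<bar> \<le> h \<and>
    g (y + h *\<^sub>R a + h *\<^sub>R b) - g (y + h *\<^sub>R b) - g (y + h *\<^sub>R a) + g y =
      h * h * iter_deriv g [a, b] (y + \<eta> *\<^sub>R a + \<xi> *\<^sub>R b)"
proof -
  define F where "F s = g (y + h *\<^sub>R a + s *\<^sub>R b) - g (y + s *\<^sub>R b)" for s
  have "(F has_real_derivative (iter_deriv g [b] (y + h *\<^sub>R a + s *\<^sub>R b) - iter_deriv g [b] (y + s *\<^sub>R b))) (at s)" for s
    unfolding F_def has_real_derivative_iff_has_vector_derivative
    using iter_deriv_along_line[OF g, of "[]"] by (intro has_vector_derivative_diff) auto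
  from MVT2[OF h this] obtain \<xi> where \<xi>: "0 < \<xi>" "\<xi> < h"
    "F h - F 0 = (h - 0) * (iter_deriv g [b] (y + h *\<^sub>R a + \<xi> *\<^sub>R b) - iter_deriv g [b] (y + \<xi> *\<^sub>R b))"
    by metis
  define E where "E t = iter_deriv g [b] ((y + \<xi> *\<^sub>R b) + t *\<^sub>R a)" for t
  have "(E has_real_derivative iter_deriv g [a, b] (y + \<xi> *\<^sub>R b + t *\<^sub>R a)) (at t)" for t
    unfolding E_def has_real_derivative_iff_has_vector_derivative
    using iter_deriv_along_line[OF g, of "[b]"] .
  from MVT2[OF h this] obtain \<eta> where \<eta>: "0 < \<eta>" "\<eta> < h"
    "E h - E 0 = (h - 0) * iter_deriv g [a, b] (y + \<xi> *\<^sub>R b + \<eta> *\<^sub>R a)"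
    by metis
  have "F h - F 0 = h * (E h - E 0)" using \<xi> by (simp add: E_def algebra_simps)
  then have "F h - F 0 = h * h * iter_deriv g [a, b] (y + \<eta> *\<^sub>R a + \<xi> *\<^sub>R b)"
    using \<eta>(3) by (simp add: add_ac del: iter_deriv.simps)
  then show ?thesis
    using \<xi> \<eta> by (intro exI[of _ \<xi>] exI[of _ \<eta>]) (auto simp: F_def simp del: iter_deriv.simps)
qed

text \<open>Both orders of differentiation are limits of the same second difference divided by
  \<open>h * h\<close>. The intermediate points of the two mean value arguments differ, but all tend
  to \<open>y\<close>.\<close>

lemma iter_deriv_swap_real:
  fixes g :: "'a::real_normed_vector \<Rightarrow> real"
  assumes g: "smooth_fun g"
  shows "iter_deriv g [a, b] y = iter_deriv g [b, a] y"
proof -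
  define h where "h n = inverse (real (Suc n))" for n
  have h: "0 < h n" for n by (simp add: h_def)
  have h0: "h \<longlonglongrightarrow> 0" unfolding h_def by (rule LIMSEQ_inverse_real_of_nat)
  have lim: "(\<lambda>n. iter_deriv g vs (y + \<eta> n *\<^sub>R a + \<xi> n *\<^sub>R b)) \<longlonglongrightarrow> iter_deriv g vs y"
    if "\<And>n. \<bar>\<xi> n\<bar> \<le> h n" "\<And>n. \<bar>\<eta> n\<bar> \<le> h n" for vs \<xi> \<eta>
  proof -
    have "\<xi> \<longlonglongrightarrow> 0" "\<eta> \<longlonglongrightarrow> 0"
      using that h0 by (auto intro: Lim_null_comparison[of _ h] always_eventually)
    then have "(\<lambda>n. y + \<eta> n *\<^sub>R a + \<xi> n *\<^sub>R b) \<longlonglongrightarrow> y + 0 *\<^sub>R a + 0 *\<^sub>R b"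
      by (intro tendsto_intros)
    then show ?thesis using isCont_tendsto_compose[OF isCont_iter_deriv[OF g]] by fastforce
  qed
  obtain \<xi> \<eta> where 1: "\<And>n. \<bar>\<xi> n\<bar> \<le> h n" "\<And>n. \<bar>\<eta> n\<bar> \<le> h n"
    "\<And>n. g (y + h n *\<^sub>R a + h n *\<^sub>R b) - g (y + h n *\<^sub>R b) - g (y + h n *\<^sub>R a) + g y =
      h n * h n * iter_deriv g [a, b] (y + \<eta> n *\<^sub>R a + \<xi> n *\<^sub>R b)"
    using second_difference[OF g h, where y = y and a = a and b = b] by metis
  obtain \<xi>' \<eta>' where 2: "\<And>n. \<bar>\<xi>' n\<bar> \<le> h n" "\<And>n. \<bar>\<eta>' n\<bar> \<le> h n"
    "\<And>n. g (y + h n *\<^sub>R b + h n *\<^sub>R a) - g (y + h n *\<^sub>R a) - g (y + h n *\<^sub>R b) + g y =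
      h n * h n * iter_deriv g [b, a] (y + \<eta>' n *\<^sub>R b + \<xi>' n *\<^sub>R a)"
    using second_difference[OF g h, where y = y and a = b and b = a] by metis
  have "iter_deriv g [a, b] (y + \<eta> n *\<^sub>R a + \<xi> n *\<^sub>R b) =
      iter_deriv g [b, a] (y + \<xi>' n *\<^sub>R a + \<eta>' n *\<^sub>R b)" for n
  proof -
    have "h n * h n * iter_deriv g [a, b] (y + \<eta> n *\<^sub>R a + \<xi> n *\<^sub>R b) =
      h n * h n * iter_deriv g [b, a] (y + \<eta>' n *\<^sub>R b + \<xi>' n *\<^sub>R a)"
      unfolding 1(3)[symmetric] 2(3)[symmetric] by (simp add: add_ac)
    then show ?thesis using h[of n] by (simp add: add_ac del: iter_deriv.simps)
  qed
  with lim[OF 1(1,2), of "[a, b]"] lim[OF 2(2,1), of "[b, a]"] show ?thesis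
    using LIMSEQ_unique by simp
qed

text \<open>Componentwise from the real case. This symmetry lets the differential in the state
  commute with the total time derivative of a jet.\<close>

lemma iter_deriv_swap:
  fixes g :: "'a::real_normed_vector \<Rightarrow> 'b::euclidean_space"
  assumes g: "smooth_fun g"
  shows "iter_deriv g [a, b] y = iter_deriv g [b, a] y"
proof (rule euclidean_eqI)
  fix c :: 'b assume "c \<in> Basis"
  note L = smooth_fun_linear_image[OF g bounded_linear_inner_left[of c]]
  show "iter_deriv g [a, b] y \<bullet> c = iter_deriv g [b, a] y \<bullet> c"
    using iter_deriv_swap_real[OF L(2), of a b y] unfolding L(1) .
qed

section \<open>Termwise differentiation of power series\<close>

definition deriv_power :: "nat \<Rightarrow> nat \<Rightarrow> real \<Rightarrow> real" where
  "deriv_power k n t = (if k \<le> n then fact n / fact (n - k) * t ^ (n - k) else 0)"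

lemma deriv_power_0 [simp]: "deriv_power 0 n t = t ^ n"
  by (simp add: deriv_power_def)

lemma has_real_derivative_deriv_power:
  "(deriv_power k n has_real_derivative deriv_power (Suc k) n t) (at t)"
proof (cases "k < n")
  case True
  then obtain d where n: "n = Suc (k + d)" using less_natE by blast
  have "((\<lambda>t. fact n / fact (Suc d) * t ^ Suc d) has_real_derivative fact n / fact (Suc d) * (real (Suc d) * t ^ d)) (at t)"
    using DERIV_pow[of "Suc d" t] by (intro DERIV_cmult) simp
  moreover have "fact n / fact (Suc d) * (real (Suc d) * t ^ d) = fact n / fact d * t ^ d"
    by (simp del: of_nat_Suc)
  moreover have "deriv_power k n = (\<lambda>t. fact n / fact (Suc d) * t ^ Suc d)"
    unfolding deriv_power_def n by (auto simp: Suc_diff_le)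
  moreover have "deriv_power (Suc k) n t = fact n / fact d * t ^ d"
    unfolding deriv_power_def n by auto
  ultimately show ?thesis by simp
next
  case False
  then have "deriv_power k n = (\<lambda>t. if k = n then fact n else 0)" "deriv_power (Suc k) n t = 0"
    by (auto simp: deriv_power_def)
  then show ?thesis by simp
qed

text \<open>The quotient \<open>n! / (n - k)!\<close> is \<open>k!\<close> times a binomial
  coefficient, hence at most \<open>k! * 2 ^ n\<close>; the factor \<open>2 ^ n\<close> is paid for
  by staying within half the radius.\<close>

lemma deriv_power_le:
  assumes t: "\<bar>t\<bar> \<le> \<rho> / 2" and \<rho>: "0 < \<rho>"
  shows "\<bar>deriv_power k n t\<bar> \<le> fact k * (2 / \<rho>) ^ k * \<rho> ^ n"
proof (cases "k \<le> n")
  case True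
  have "\<bar>deriv_power k n t\<bar> = fact k * real (n choose k) * \<bar>t\<bar> ^ (n - k)"
    using True choose_mult_fact[OF True] by (simp add: deriv_power_def abs_mult power_abs field_simps)
  also have "\<dots> \<le> fact k * 2 ^ n * (\<rho> / 2) ^ (n - k)"
  proof -
    have "real (n choose k) \<le> 2 ^ n"
      using binomial_le_pow2[of n k] by (metis of_nat_le_iff of_nat_numeral of_nat_power)
    then show ?thesis using t \<rho> by (intro mult_mono mult_left_mono power_mono) auto
  qed
  also have "\<dots> = fact k * (2 / \<rho>) ^ k * \<rho> ^ n"
  proof -
    obtain d where "n = k + d" using True le_Suc_ex by blast
    then show ?thesis using \<rho> by (simp add: power_add power_divide field_simps)
  qed
  finally show ?thesis .
next
  case False
  then show ?thesis using \<rho> by (simp add: deriv_power_def)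
qed

lemma prod_fact_le: "finite A \<Longrightarrow> (\<Prod>a\<in>A. fact (k a)) \<le> (fact (\<Sum>a\<in>A. k a) :: real)"
proof (induction A rule: finite_induct)
  case (insert a A)
  have "fact (k a) * fact (sum k A) \<le> (fact (k a + sum k A) :: nat)"
    by (intro dvd_imp_le fact_fact_dvd_fact) auto
  then have "real (fact (k a) * fact (sum k A)) \<le> real (fact (k a + sum k A))"
    by (simp only: of_nat_le_iff)
  then have "fact (k a) * fact (sum k A) \<le> (fact (k a + sum k A) :: real)"
    by (simp only: of_nat_mult of_nat_fact)
  moreover have "fact (k a) * (\<Prod>a\<in>A. fact (k a)) \<le> fact (k a) * (fact (sum k A) :: real)"
    using insert by (intro mult_left_mono) auto
  ultimately have "fact (k a) * (\<Prod>a\<in>A. fact (k a)) \<le> (fact (k a + sum k A) :: real)"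
    by linarith
  then show ?case using insert by simp
qed simp

text \<open>A partial derivative of a monomial along basis vectors depends only on how often each of
  them occurs in the list, hence the counts.\<close>

definition deriv_monomial :: "'a::euclidean_space list \<Rightarrow> ('a \<Rightarrow> nat) \<Rightarrow> 'a \<Rightarrow> real" where
  "deriv_monomial bs \<alpha> y = (\<Prod>b\<in>Basis. deriv_power (count_list bs b) (\<alpha> b) (y \<bullet> b))"

lemma deriv_monomial_le:
  assumes y: "norm y \<le> \<rho> / 2" and \<rho>: "0 < \<rho>" and bs: "set bs \<subseteq> Basis"
  shows "\<bar>deriv_monomial bs \<alpha> y\<bar> \<le> fact (length bs) * (2 / \<rho>) ^ length bs * (\<Prod>b\<in>Basis. \<rho> ^ \<alpha> b)"
proof -
  have "\<bar>deriv_monomial bs \<alpha> y\<bar> \<le>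
      (\<Prod>b\<in>Basis. fact (count_list bs b) * (2 / \<rho>) ^ count_list bs b * \<rho> ^ \<alpha> b)"
    unfolding deriv_monomial_def abs_prod
    using y \<rho> Basis_le_norm[of _ y] by (intro prod_mono) (force intro!: deriv_power_le)
  also have "\<dots> = (\<Prod>b\<in>Basis. fact (count_list bs b)) * (2 / \<rho>) ^ (\<Sum>b\<in>Basis. count_list bs b) * (\<Prod>b\<in>Basis. \<rho> ^ \<alpha> b)"
    by (simp add: prod.distrib power_sum)
  also have "\<dots> \<le> fact (\<Sum>b\<in>Basis. count_list bs b) * (2 / \<rho>) ^ (\<Sum>b\<in>Basis. count_list bs b) * (\<Prod>b\<in>Basis. \<rho> ^ \<alpha> b)"
    using \<rho> by (intro mult_right_mono prod_fact_le) (auto intro!: prod_nonneg)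
  finally show ?thesis using sum_count_set[OF bs] by simp
qed

lemma has_derivative_deriv_monomial:
  "(deriv_monomial bs \<alpha> has_derivative (\<lambda>v. \<Sum>b\<in>Basis. (v \<bullet> b) * deriv_monomial (b # bs) \<alpha> y)) (at y)"
proof -
  have 1: "((\<lambda>y. deriv_power (count_list bs b) (\<alpha> b) (y \<bullet> b)) has_derivative
      (\<lambda>v. (v \<bullet> b) * deriv_power (Suc (count_list bs b)) (\<alpha> b) (y \<bullet> b))) (at y)" for b
    using has_derivative_compose[OF bounded_linear.has_derivative[OF bounded_linear_inner_left has_derivative_ident]
      has_real_derivative_deriv_power[THEN has_field_derivative_imp_has_derivative]]
    by (simp add: mult.commute)
  have "(deriv_monomial bs \<alpha> has_derivative (\<lambda>v. \<Sum>b\<in>Basis.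
      ((v \<bullet> b) * deriv_power (Suc (count_list bs b)) (\<alpha> b) (y \<bullet> b)) *
        (\<Prod>c\<in>Basis - {b}. deriv_power (count_list bs c) (\<alpha> c) (y \<bullet> c)))) (at y)"
    unfolding deriv_monomial_def by (rule has_derivative_prod[OF 1])
  moreover have "deriv_power (Suc (count_list bs b)) (\<alpha> b) (y \<bullet> b) *
        (\<Prod>c\<in>Basis - {b}. deriv_power (count_list bs c) (\<alpha> c) (y \<bullet> c)) = deriv_monomial (b # bs) \<alpha> y"
    if "b \<in> Basis" for b
    unfolding deriv_monomial_def prod.remove[OF finite_Basis that]
    by (auto intro!: arg_cong2[of _ _ _ _ "(*)"] prod.cong split: if_split_asm)
  ultimately show ?thesis by (simp add: mult.assoc cong: sum.cong)
qed

text \<open>Multilinear expansion of derivatives along arbitrary directions \<open>vs\<close> from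
  those along basis vectors. Expanded directions are appended to \<open>bs\<close>, so that its head
  stays free for the direction of a further derivative.\<close>

primrec dir_series ::
  "('a::euclidean_space list \<Rightarrow> 'a \<Rightarrow> 'b::real_normed_vector) \<Rightarrow> 'a list \<Rightarrow> 'a list \<Rightarrow> 'a \<Rightarrow> 'b" where
  "dir_series D [] bs = D bs"
| "dir_series D (v # vs) bs = (\<lambda>y. \<Sum>b\<in>Basis. (v \<bullet> b) *\<^sub>R dir_series D vs (bs @ [b]) y)"

lemma has_derivative_dir_series:
  assumes D: "\<And>bs. set bs \<subseteq> Basis \<Longrightarrow>
    (D bs has_derivative (\<lambda>v. \<Sum>b\<in>Basis. (v \<bullet> b) *\<^sub>R D (b # bs) y)) (at y)"
    and bs: "set bs \<subseteq> Basis"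
  shows "(dir_series D vs bs has_derivative (\<lambda>v. \<Sum>b\<in>Basis. (v \<bullet> b) *\<^sub>R dir_series D vs (b # bs) y)) (at y)"
  using bs
proof (induction vs arbitrary: bs)
  case Nil then show ?case using D by simp
next
  case (Cons w vs)
  have "(dir_series D (w # vs) bs has_derivative (\<lambda>v. \<Sum>c\<in>Basis. (w \<bullet> c) *\<^sub>R
      (\<Sum>b\<in>Basis. (v \<bullet> b) *\<^sub>R dir_series D vs (b # bs @ [c]) y))) (at y)"
    unfolding dir_series.simps
    using Cons.prems Cons.IH by (intro has_derivative_sum has_derivative_scaleR_right) auto
  moreover have "(\<Sum>c\<in>Basis. (w \<bullet> c) *\<^sub>R (\<Sum>b\<in>Basis. (v \<bullet> b) *\<^sub>R dir_series D vs (b # bs @ [c]) y)) =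
      (\<Sum>b\<in>Basis. (v \<bullet> b) *\<^sub>R dir_series D (w # vs) (b # bs) y)" for v
    unfolding scaleR_sum_right by (subst sum.swap) (simp add: scaleR_sum_right mult.commute)
  ultimately show ?case by simp
qed

lemma norm_dir_series_le:
  fixes D :: "'a::euclidean_space list \<Rightarrow> 'a \<Rightarrow> 'b::real_normed_vector"
  assumes D: "\<And>bs. set bs \<subseteq> Basis \<Longrightarrow> norm (D bs y) \<le> C * B ^ length bs * fact (length bs)"
    and bs: "set bs \<subseteq> Basis"
  shows "norm (dir_series D vs bs y) \<le>
    C * B ^ (length bs + length vs) * fact (length bs + length vs) * DIM('a) ^ length vs * norm_prod vs"
  using bs
proof (induction vs arbitrary: bs)
  case Nil then show ?case using D by simp
next
  case (Cons w vs)
  define L where "L = C * B ^ (length bs + length (w # vs)) * fact (length bs + length (w # vs))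
     * DIM('a) ^ length vs * norm_prod vs"
  have "norm (dir_series D (w # vs) bs y) \<le> (\<Sum>b\<in>(Basis::'a set). norm w * L)"
    unfolding dir_series.simps
  proof (rule sum_norm_le)
    fix b :: 'a assume b: "b \<in> Basis"
    have "norm (dir_series D vs (bs @ [b]) y) \<le> L"
      using Cons.IH[of "bs @ [b]"] Cons.prems b by (simp add: L_def)
    then show "norm ((w \<bullet> b) *\<^sub>R dir_series D vs (bs @ [b]) y) \<le> norm w * L"
      using Basis_le_norm[OF b, of w] by (auto intro!: mult_mono)
  qed
  then show ?case by (simp add: L_def mult_ac)
qed

lemma summable_on_finite_sum:
  fixes F :: "'k \<Rightarrow> 'i \<Rightarrow> 'b::{topological_comm_monoid_add}"
  assumes "\<And>b. b \<in> B \<Longrightarrow> F b summable_on A"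
  shows "(\<lambda>i. \<Sum>b\<in>B. F b i) summable_on A"
  using assms by (induction B rule: infinite_finite_induct) (auto intro: summable_on_add)

text \<open>In finite dimension unconditional summability reduces to the real coordinates, where it
  is absolute.\<close>

lemma summable_on_imp_abs_summable_on:
  fixes f :: "'i \<Rightarrow> 'b::euclidean_space"
  assumes "f summable_on A"
  shows "(\<lambda>i. norm (f i)) summable_on A"
proof -
  have "(\<lambda>i. f i \<bullet> b) summable_on A" for b
    using summable_on_bounded_linear[OF bounded_linear_inner_left assms] by (simp add: o_def)
  then have "(\<lambda>i. \<bar>f i \<bullet> b\<bar>) summable_on A" for b
    using summable_on_iff_abs_summable_on_real[of "\<lambda>i. f i \<bullet> b" A] by simp
  then have "(\<lambda>i. \<Sum>b\<in>Basis. \<bar>f i \<bullet> b\<bar>) summable_on A" by (intro summable_on_finite_sum)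
  then have "(\<lambda>i. norm (\<Sum>b\<in>Basis. \<bar>f i \<bullet> b\<bar>)) summable_on A"
    by simp
  then show ?thesis
    by (rule Infinite_Sum.abs_summable_on_comparison_test) (use norm_le_l1 in \<open>auto simp: order_trans\<close>)
qed

text \<open>Together these give a bijection of the multi-indices with \<open>nat\<close>, so that
  the unordered expansion becomes an ordinary series that can be differentiated termwise.\<close>

lemma infinite_multi_indices: "infinite (Basis \<rightarrow>\<^sub>E (UNIV :: nat set) :: ('a::euclidean_space \<Rightarrow> nat) set)"
  and countable_multi_indices: "countable (Basis \<rightarrow>\<^sub>E (UNIV :: nat set) :: ('a::euclidean_space \<Rightarrow> nat) set)"
proof -
  obtain b0 :: 'a where b0: "b0 \<in> Basis" using nonempty_Basis by blast
  have "inj_on (\<lambda>n. \<lambda>b\<in>(Basis::'a set). n) (UNIV::nat set)"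
    by (rule inj_onI) (use b0 in \<open>metis restrict_apply'\<close>)
  then have "infinite ((\<lambda>n. \<lambda>b\<in>(Basis::'a set). n) ` (UNIV::nat set))"
    using finite_imageD infinite_UNIV_nat by blast
  then show "infinite (Basis \<rightarrow>\<^sub>E (UNIV :: nat set) :: ('a \<Rightarrow> nat) set)"
    by (rule infinite_super[rotated]) auto
  show "countable (Basis \<rightarrow>\<^sub>E (UNIV :: nat set) :: ('a \<Rightarrow> nat) set)"
    by (rule countable_PiE) auto
qed

text \<open>The series \<open>W\<close> of coefficients at polyradius \<open>\<rho>\<close>
  dominates every differentiated series on the ball of radius \<open>\<rho> / 2\<close>, up to a
  factor that depends only on the order. The Weierstrass test then gives the uniform convergence
  behind termwise differentiation, and the same majorant is the constant of the Cauchy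
  bound.\<close>

lemma power_series_derivs:
  fixes c :: "nat \<Rightarrow> 'b::euclidean_space" and e :: "nat \<Rightarrow> 'a::euclidean_space \<Rightarrow> nat"
    and x :: 'a
  assumes \<rho>: "0 < \<rho>" and W: "summable (\<lambda>n. (\<Prod>b\<in>Basis. \<rho> ^ e n b) * norm (c n))"
  defines "D \<equiv> \<lambda>bs y. \<Sum>n. deriv_monomial bs (e n) (y - x) *\<^sub>R c n"
  assumes y: "y \<in> ball x (\<rho> / 2)" and bs: "set bs \<subseteq> Basis"
  shows "(D bs has_derivative (\<lambda>v. \<Sum>b\<in>Basis. (v \<bullet> b) *\<^sub>R D (b # bs) y)) (at y)"
    and "norm (D bs y) \<le>
      (\<Sum>n. (\<Prod>b\<in>Basis. \<rho> ^ e n b) * norm (c n)) * (2 / \<rho>) ^ length bs * fact (length bs)"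
proof -
  let ?S = "ball x (\<rho> / 2)"
  let ?W = "\<lambda>n. (\<Prod>b\<in>Basis. \<rho> ^ e n b) * norm (c n)"
  let ?T = "\<lambda>bs n y. deriv_monomial bs (e n) (y - x) *\<^sub>R c n"
  let ?K = "\<lambda>bs::'a list. fact (length bs) * (2 / \<rho>) ^ length bs"
  have T: "norm (?T bs n y) \<le> ?K bs * ?W n" if "set bs \<subseteq> Basis" "y \<in> ?S" for bs n y
  proof -
    have "norm (y - x) \<le> \<rho> / 2" using that by (simp add: dist_norm norm_minus_commute)
    from mult_right_mono[OF deriv_monomial_le[OF this \<rho> that(1)], of "norm (c n)" "e n"]
    show ?thesis by (simp add: mult.assoc)
  qed
  have KW: "summable (\<lambda>n. ?K bs * ?W n)" for bs by (intro summable_mult W)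
  have summ: "summable (\<lambda>n. norm (?T bs n y))" if "set bs \<subseteq> Basis" "y \<in> ?S" for bs y
    by (rule summable_comparison_test'[OF KW[of bs], of 0]) (use T[OF that] in auto)
  have ul: "uniform_limit ?S (\<lambda>n y. \<Sum>i<n. ?T bs i y) (D bs) sequentially" if "set bs \<subseteq> Basis" for bs
    unfolding D_def using T[OF that] KW by (intro Weierstrass_m_test) auto
  have "norm (D bs y) \<le> (\<Sum>n. ?K bs * ?W n)"
    unfolding D_def by (rule norm_suminf_le[OF T[OF bs y] KW])
  also have "\<dots> = ?K bs * (\<Sum>n. ?W n)" by (rule suminf_mult[OF W])
  finally show "norm (D bs y) \<le> (\<Sum>n. ?W n) * (2 / \<rho>) ^ length bs * fact (length bs)"
    by (simp add: mult_ac)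
  have "\<exists>g. \<forall>y\<in>?S. (\<lambda>n. ?T bs n y) sums (g y) \<and>
      (g has_derivative (\<lambda>v. \<Sum>b\<in>Basis. (v \<bullet> b) *\<^sub>R D (b # bs) y)) (at y within ?S)"
  proof (rule has_derivative_series)
    show "convex ?S" by simp
    show "(?T bs n has_derivative (\<lambda>v. \<Sum>b\<in>Basis. (v \<bullet> b) *\<^sub>R ?T (b # bs) n y)) (at y within ?S)" for n y
    proof -
      have "((\<lambda>y. y - x) has_derivative (\<lambda>v. v)) (at y within ?S)"
        by (auto intro!: derivative_eq_intros)
      from has_derivative_scaleR_left[OF has_derivative_compose[OF this has_derivative_deriv_monomial], of bs "e n" "c n"]
      show ?thesis by (simp add: scaleR_sum_left)
    qed
    show "y \<in> ?S" by (rule y)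
    show "(\<lambda>n. ?T bs n y) sums (\<Sum>n. ?T bs n y)"
      by (rule summable_sums, rule summable_norm_cancel, rule summ[OF bs y])
    fix \<epsilon> :: real assume \<epsilon>: "0 < \<epsilon>"
    have "\<forall>\<^sub>F n in sequentially. \<forall>y\<in>?S. dist (\<Sum>i<n. ?T (b # bs) i y) (D (b # bs) y) < \<epsilon> / DIM('a)"
      if "b \<in> Basis" for b
      using ul[of "b # bs"] that bs \<epsilon> unfolding uniform_limit_iff by simp
    then have "\<forall>\<^sub>F n in sequentially. \<forall>b\<in>Basis. \<forall>y\<in>?S.
        dist (\<Sum>i<n. ?T (b # bs) i y) (D (b # bs) y) < \<epsilon> / DIM('a)"
      by (simp add: eventually_ball_finite)
    then show "\<forall>\<^sub>F n in sequentially. \<forall>y\<in>?S. \<forall>h.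
        norm ((\<Sum>i<n. \<Sum>b\<in>Basis. (h \<bullet> b) *\<^sub>R ?T (b # bs) i y) - (\<Sum>b\<in>Basis. (h \<bullet> b) *\<^sub>R D (b # bs) y)) \<le> \<epsilon> * norm h"
    proof (rule eventually_mono, intro ballI allI)
      fix n y and h :: 'a
      assume *: "\<forall>b\<in>Basis. \<forall>y\<in>?S. dist (\<Sum>i<n. ?T (b # bs) i y) (D (b # bs) y) < \<epsilon> / DIM('a)"
        and y: "y \<in> ?S"
      have "(\<Sum>i<n. \<Sum>b\<in>Basis. (h \<bullet> b) *\<^sub>R ?T (b # bs) i y) - (\<Sum>b\<in>Basis. (h \<bullet> b) *\<^sub>R D (b # bs) y)
          = (\<Sum>b\<in>Basis. (h \<bullet> b) *\<^sub>R ((\<Sum>i<n. ?T (b # bs) i y) - D (b # bs) y))"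
        by (subst sum.swap) (simp add: scaleR_right_diff_distrib scaleR_sum_right sum_subtractf)
      also have "norm \<dots> \<le> (\<Sum>b\<in>(Basis::'a set). norm h * (\<epsilon> / DIM('a)))"
      proof (rule sum_norm_le)
        fix b :: 'a assume b: "b \<in> Basis"
        have "norm ((\<Sum>i<n. ?T (b # bs) i y) - D (b # bs) y) \<le> \<epsilon> / DIM('a)"
          using * b y by (auto simp: dist_norm intro: less_imp_le)
        then have "\<bar>h \<bullet> b\<bar> * norm ((\<Sum>i<n. ?T (b # bs) i y) - D (b # bs) y) \<le> norm h * (\<epsilon> / DIM('a))"
          using Basis_le_norm[OF b, of h] by (intro mult_mono) auto
        then show "norm ((h \<bullet> b) *\<^sub>R ((\<Sum>i<n. ?T (b # bs) i y) - D (b # bs) y)) \<le> norm h * (\<epsilon> / DIM('a))"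
          by simp
      qed
      finally show "norm ((\<Sum>i<n. \<Sum>b\<in>Basis. (h \<bullet> b) *\<^sub>R ?T (b # bs) i y) - (\<Sum>b\<in>Basis. (h \<bullet> b) *\<^sub>R D (b # bs) y)) \<le> \<epsilon> * norm h"
        by (simp add: mult.commute)
    qed
  qed
  then obtain g where g: "\<And>y. y \<in> ?S \<Longrightarrow> (\<lambda>n. ?T bs n y) sums (g y)"
    "\<And>y. y \<in> ?S \<Longrightarrow> (g has_derivative (\<lambda>v. \<Sum>b\<in>Basis. (v \<bullet> b) *\<^sub>R D (b # bs) y)) (at y within ?S)"
    by blast
  have "(g has_derivative (\<lambda>v. \<Sum>b\<in>Basis. (v \<bullet> b) *\<^sub>R D (b # bs) y)) (at y)"
    using g(2)[OF y] unfolding at_within_open[OF y open_ball] .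
  then show "(D bs has_derivative (\<lambda>v. \<Sum>b\<in>Basis. (v \<bullet> b) *\<^sub>R D (b # bs) y)) (at y)"
    by (rule has_derivative_transform_within_open[OF _ open_ball y]) (metis D_def g(1) sums_unique)
qed

lemma real_analytic_imp_analytic_fun:
  fixes g :: "'a::euclidean_space \<Rightarrow> 'b::euclidean_space"
  assumes "g real_analytic_on UNIV"
  shows "analytic_fun g"
proof (rule analytic_funI)
  fix x
  let ?I = "Basis \<rightarrow>\<^sub>E UNIV :: ('a \<Rightarrow> nat) set"
  obtain r c where r: "0 < r" and c: "\<And>y. y \<in> ball x r \<Longrightarrow>
      ((\<lambda>\<alpha>. (\<Prod>b\<in>Basis. ((y - x) \<bullet> b) ^ \<alpha> b) *\<^sub>R c \<alpha>) has_sum g y) ?I"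
    using assms unfolding real_analytic_on_def by blast
  define \<rho> where "\<rho> = r / (2 * DIM('a))"
  have \<rho>: "0 < \<rho>" using r by (simp add: \<rho>_def)
  define e where "e = from_nat_into ?I"
  have e: "bij_betw e UNIV ?I"
    unfolding e_def by (rule bij_betw_from_nat_into[OF countable_multi_indices infinite_multi_indices])
  \<comment> \<open>At this corner point every monomial equals \<open>\<rho>\<close> to its total
    degree, so summability there yields the majorant. The choice of \<open>\<rho>\<close> puts the
    point in the ball: its distance from \<open>x\<close> is at most
    \<open>DIM('a) * \<rho> = r / 2\<close>.\<close>
  let ?p = "x + (\<Sum>b\<in>Basis. \<rho> *\<^sub>R b)"
  have "norm (\<Sum>b\<in>(Basis::'a set). \<rho> *\<^sub>R b) \<le> (\<Sum>b\<in>(Basis::'a set). \<rho>)"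
    by (rule sum_norm_le) (use \<rho> in auto)
  then have "?p \<in> ball x r" using r by (simp add: dist_norm \<rho>_def)
  from has_sum_imp_summable[OF c[OF this]]
  have "(\<lambda>\<alpha>. (\<Prod>b\<in>Basis. \<rho> ^ \<alpha> b) *\<^sub>R c \<alpha>) summable_on ?I"
    by (simp add: inner_sum_left_Basis cong: prod.cong)
  then have "(\<lambda>\<alpha>. norm ((\<Prod>b\<in>Basis. \<rho> ^ \<alpha> b) *\<^sub>R c \<alpha>)) summable_on ?I"
    by (rule summable_on_imp_abs_summable_on)
  then have "(\<lambda>n. norm ((\<Prod>b\<in>Basis. \<rho> ^ e n b) *\<^sub>R c (e n))) summable_on UNIV"
    using summable_on_reindex_bij_betw[OF e] by fast
  then have W: "summable (\<lambda>n. (\<Prod>b\<in>Basis. \<rho> ^ e n b) * norm (c (e n)))"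
    using \<rho> by (auto dest!: summable_on_imp_summable simp: abs_prod prod_nonneg)
  define D where "D bs y = (\<Sum>n. deriv_monomial bs (e n) (y - x) *\<^sub>R c (e n))" for bs y
  note ps = power_series_derivs[OF \<rho> W, where x = x, folded D_def]
  define C where "C = (\<Sum>n. (\<Prod>b\<in>Basis. \<rho> ^ e n b) * norm (c (e n)))"
  have C: "0 \<le> C" unfolding C_def using \<rho> W by (intro suminf_nonneg) (auto intro!: mult_nonneg_nonneg prod_nonneg)
  define \<delta> where "\<delta> = min r (\<rho> / 2)"
  \<comment> \<open>The dimension enters through the expansion of each direction in
    \<open>Basis\<close>.\<close>
  define B where "B = 2 / \<rho> * DIM('a)"
  let ?D = "\<lambda>vs. dir_series D vs []"
  have "?D [] y = g y" if "y \<in> ball x \<delta>" for y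
  proof -
    have "((\<lambda>n. (\<Prod>b\<in>Basis. ((y - x) \<bullet> b) ^ e n b) *\<^sub>R c (e n)) has_sum g y) UNIV"
      using c[of y] that unfolding \<delta>_def by (subst has_sum_reindex_bij_betw[OF e]) auto
    then have "(\<lambda>n. (\<Prod>b\<in>Basis. ((y - x) \<bullet> b) ^ e n b) *\<^sub>R c (e n)) sums g y"
      by (rule has_sum_imp_sums)
    then show ?thesis by (simp add: D_def deriv_monomial_def sums_iff)
  qed
  moreover have "derivs_at ?D vs y" if "y \<in> ball x \<delta>" for y vs
    using has_derivative_dir_series[of D y "[]" vs] ps(1)[of y] that by (simp add: \<delta>_def)
  moreover have "B ^ n = (2 / \<rho>) ^ n * DIM('a) ^ n" for n
    unfolding B_def by (simp only: power_mult_distrib of_nat_power)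
  then have "norm (?D vs y) \<le> cauchy_bound C B vs"
    if "y \<in> ball x \<delta>" for y vs
    using norm_dir_series_le[of D y C "2 / \<rho>" "[]" vs] ps(2)[of y] that
    by (simp add: \<delta>_def C_def mult_ac)
  moreover have "0 < \<delta>" "0 \<le> B" using r \<rho> by (auto simp: \<delta>_def B_def)
  ultimately have fin: "0 < \<delta> \<and> 0 \<le> C \<and> 0 \<le> B \<and> (\<forall>y\<in>ball x \<delta>. ?D [] y = g y \<and>
     (\<forall>vs. derivs_at ?D vs y \<and>
        norm (?D vs y) \<le> cauchy_bound C B vs))"
    using C by blast
  show "\<exists>D C B \<delta>. 0 < \<delta> \<and> 0 \<le> C \<and> 0 \<le> B \<and> (\<forall>y\<in>ball x \<delta>. D [] y = g y \<and>
     (\<forall>vs. derivs_at D vs y \<and>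
        norm (D vs y) \<le> cauchy_bound C B vs))"
    by (rule exI[of _ ?D], rule exI[of _ C], rule exI[of _ B], rule exI[of _ \<delta>], rule fin)
qed

section \<open>The identity theorem along solutions\<close>

text \<open>Taylor's remainder estimate at a point where all derivatives vanish, by successive mean
  value inequalities, one for each order.\<close>

lemma vanishing_derivs_bound:
  fixes Y :: "nat \<Rightarrow> real \<Rightarrow> 'b::real_normed_vector"
  assumes der: "\<And>j t. t \<in> {0..s} \<Longrightarrow> (Y j has_vector_derivative Y (Suc j) t) (at t within {0..s})"
    and t1: "0 \<le> t1" "\<And>j. Y j t1 = 0" and t: "t1 \<le> t" "t \<le> s"
    and M: "\<And>u. t1 \<le> u \<Longrightarrow> u \<le> t \<Longrightarrow> norm (Y (i + n) u) \<le> M"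
  shows "norm (Y i t) \<le> M * (t - t1) ^ n / fact n"
  using M t
proof (induction n arbitrary: i t)
  case 0
  then show ?case by simp
next
  case (Suc n)
  show ?case
  proof (cases "t1 = t")
    case True
    then show ?thesis using t1 by simp
  next
    case False
    then have lt: "t1 < t" using Suc.prems by simp
    let ?\<phi> = "\<lambda>u. M * (u - t1) ^ Suc n / fact (Suc n)"
    have sub: "{t1..t} \<subseteq> {0..s}" using t1 Suc.prems by auto
    have "norm (Y i t - Y i t1) \<le> ?\<phi> t - ?\<phi> t1"
    proof (rule differentiable_bound_general[OF lt])
      show "continuous_on {t1..t} (Y i)"
        using der sub by (meson continuous_on_subset continuous_on_vector_derivative)
      show "continuous_on {t1..t} ?\<phi>" by (intro continuous_intros) auto
      show "(Y i has_vector_derivative Y (Suc i) u) (at u)" if "t1 < u" "u < t" for u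
      proof -
        have "at u within {0..s} = at u" using that t1 Suc.prems by (intro at_within_Icc_at) auto
        then show ?thesis using der[of u i] that t1 Suc.prems by auto
      qed
      show "(?\<phi> has_vector_derivative M * (u - t1) ^ n / fact n) (at u)" for u
      proof -
        have "((\<lambda>u. (u - t1) ^ Suc n) has_real_derivative real (Suc n) * (u - t1) ^ n) (at u)"
          by (auto intro!: derivative_eq_intros simp del: power_Suc)
        from DERIV_cmult[OF this, of "M / fact (Suc n)"]
        have "(?\<phi> has_real_derivative M / fact (Suc n) * (real (Suc n) * (u - t1) ^ n)) (at u)"
          by (simp del: power_Suc fact_Suc)
        moreover have "M / fact (Suc n) * (real (Suc n) * (u - t1) ^ n) = M * (u - t1) ^ n / fact n"
          by (simp del: of_nat_Suc)
        ultimately show ?thesis by (simp add: has_real_derivative_iff_has_vector_derivative)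
      qed
      show "norm (Y (Suc i) u) \<le> M * (u - t1) ^ n / fact n" if "t1 < u" "u < t" for u
        using that Suc.prems by (intro Suc.IH) auto
    qed
    then show ?thesis using t1 by simp
  qed
qed

text \<open>All derivatives vanish on steps of a length which depends only on \<open>Q\<close>.\<close>

lemma analytic_curve_vanishes:
  fixes Y :: "nat \<Rightarrow> real \<Rightarrow> 'b::real_normed_vector"
  assumes der: "\<And>j t. t \<in> {0..s} \<Longrightarrow> (Y j has_vector_derivative Y (Suc j) t) (at t within {0..s})"
    and bnd: "\<And>j t. t \<in> {0..s} \<Longrightarrow> norm (Y j t) \<le> C * Q ^ j * fact j" and CQ: "0 \<le> C" "0 < Q"
    and 0: "\<And>j. Y j 0 = 0" and t: "t \<in> {0..s}"
  shows "Y j t = 0"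
proof -
  \<comment> \<open>After \<open>(i + n)! \<le> 2 ^ (i + n) * i! * n!\<close>, the remainder of
    order \<open>n\<close> carries the factor \<open>(2 * Q * h) ^ n\<close>; this step length makes
    it \<open>(1/2) ^ n\<close>.\<close>
  define h where "h = 1 / (4 * Q)"
  have h: "0 < h" using CQ by (simp add: h_def)
  have step: "Y i t = 0" if t1: "0 \<le> t1" "\<And>j. Y j t1 = 0" and t: "t1 \<le> t" "t \<le> s" "t \<le> t1 + h" for i t t1
  proof -
    have "norm (Y i t) \<le> (C * (2 * Q) ^ i * fact i) * (1/2) ^ n" for n
    proof -
      have "norm (Y i t) \<le> (C * Q ^ (i + n) * fact (i + n)) * (t - t1) ^ n / fact n"
        using t1 t by (intro vanishing_derivs_bound[where Y = Y and s = s] der) (auto intro: bnd)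
      also have "\<dots> \<le> (C * Q ^ (i + n) * (2 ^ (i + n) * fact i * fact n)) * h ^ n / fact n"
        using CQ t by (intro divide_right_mono mult_mono mult_left_mono fact_add_le power_mono) auto
      also have "\<dots> = (C * (2 * Q) ^ i * fact i) * (2 * Q * h) ^ n"
        by (simp add: power_add power_mult_distrib)
      also have "2 * Q * h = 1 / 2" using CQ by (simp add: h_def)
      finally show ?thesis .
    qed
    moreover have "(\<lambda>n. (C * (2 * Q) ^ i * fact i) * (1/2) ^ n) \<longlonglongrightarrow> (C * (2 * Q) ^ i * fact i) * 0"
      by (intro tendsto_mult_left LIMSEQ_power_zero) simp
    ultimately have "norm (Y i t) \<le> (C * (2 * Q) ^ i * fact i) * 0"
      by (intro LIMSEQ_le_const) auto
    then show ?thesis by simp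
  qed
  have "\<forall>t i. 0 \<le> t \<longrightarrow> t \<le> s \<longrightarrow> t \<le> real m * h \<longrightarrow> Y i t = 0" for m
  proof (induction m)
    case 0
    then show ?case using assms(5) by auto
  next
    case (Suc m)
    show ?case
    proof (intro allI impI)
      fix t i assume t: "0 \<le> t" "t \<le> s" "t \<le> real (Suc m) * h"
      show "Y i t = 0"
      proof (cases "t \<le> real m * h")
        case True
        then show ?thesis using Suc t by blast
      next
        case False
        show ?thesis
          by (rule step[of "real m * h"]) (use Suc False t h in \<open>auto simp: algebra_simps\<close>)
      qed
    qed
  qed
  moreover obtain m where "t / h \<le> real m" using real_arch_simple by blast
  then have "t \<le> real m * h" using h by (simp add: field_simps)
  ultimately show ?thesis using t by auto
qed

lemma lie_pow_bound_compact:
  fixes G :: "'a::euclidean_space \<Rightarrow> 'a"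
  assumes G: "analytic_fun G" and g: "analytic_fun g" and S: "compact S"
  shows "\<exists>C\<ge>0. \<exists>Q\<ge>0. \<forall>y\<in>S. \<forall>j. norm (lie_pow G g j y) \<le> C * Q ^ j * fact j"
proof -
  obtain C Q \<delta> where *: "\<And>x. 0 \<le> C x" "\<And>x. 0 \<le> Q x" "\<And>x. 0 < \<delta> x"
    "\<And>x y j. y \<in> ball x (\<delta> x) \<Longrightarrow> norm (lie_pow G g j y) \<le> C x * Q x ^ j * fact j"
    using lie_pow_bound[OF G g] by metis
  have "S \<subseteq> (\<Union>x\<in>S. ball x (\<delta> x))" using *(3) by force
  then obtain D where D: "D \<subseteq> S" "finite D" "S \<subseteq> (\<Union>x\<in>D. ball x (\<delta> x))"
    using compactE_image[OF S, of S "\<lambda>x. ball x (\<delta> x)"] by auto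
  have "norm (lie_pow G g j y) \<le> sum C D * sum Q D ^ j * fact j" if y: "y \<in> S" for y j
  proof -
    obtain x where x: "x \<in> D" "y \<in> ball x (\<delta> x)" using D y by blast
    have "C x \<le> sum C D" "Q x \<le> sum Q D" using D x * by (auto intro: member_le_sum)
    then have "C x * Q x ^ j * fact j \<le> sum C D * sum Q D ^ j * fact j"
      using * by (intro mult_right_mono mult_mono power_mono sum_nonneg) auto
    then show ?thesis using *(4)[OF x(2), of j] by linarith
  qed
  then show ?thesis using * by (intro exI[of _ "sum C D"] conjI exI[of _ "sum Q D"]) (auto intro: sum_nonneg)
qed

lemma lie_pow_along_solution:
  fixes G :: "'a::euclidean_space \<Rightarrow> 'a"
  assumes G: "analytic_fun G" and g: "analytic_fun g"
    and z: "(z has_vector_derivative G (z t)) (at t within I)"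
  shows "((\<lambda>t. lie_pow G g j (z t)) has_vector_derivative lie_pow G g (Suc j) (z t)) (at t within I)"
proof -
  note s = analytic_fun_smooth[OF analytic_fun_lie_pow[OF G g]]
  interpret bounded_linear "\<lambda>v. iter_deriv (lie_pow G g j) [v] (z t)"
    by (rule iter_deriv_linear[OF s])
  show ?thesis
    using has_derivative_compose[OF z[unfolded has_vector_derivative_def] smooth_fun_has_derivative0[OF s[of j]]]
    unfolding has_vector_derivative_def scaleR lie_pow.simps lie_def .
qed

lemma at_within_Icc_not_bot: "0 < s \<Longrightarrow> t \<in> {0..s::real} \<Longrightarrow> at t within {0..s} \<noteq> bot"
  by (simp add: trivial_limit_within islimpt_Icc)

text \<open>Derivatives are unique, so any tower of time derivatives over \<open>g \<circ> z\<close>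
  consists of Lie derivatives, however it was computed. The recursively defined output jets thereby
  inherit the factorial bound.\<close>

lemma jets_along_solution:
  fixes G :: "'a::euclidean_space \<Rightarrow> 'a"
  assumes G: "analytic_fun G" and g: "analytic_fun g" and s: "0 < s"
    and z: "\<And>t. t \<in> {0..s} \<Longrightarrow> (z has_vector_derivative G (z t)) (at t within {0..s})"
    and W0: "\<And>t. t \<in> {0..s} \<Longrightarrow> W 0 t = g (z t)"
    and W: "\<And>j t. t \<in> {0..s} \<Longrightarrow> (W j has_vector_derivative W (Suc j) t) (at t within {0..s})"
    and t: "t \<in> {0..s}"
  shows "W j t = lie_pow G g j (z t)"
  using t
proof (induction j arbitrary: t)
  case 0
  then show ?case using W0 by simp
next
  case (Suc j)
  have "(W j has_vector_derivative lie_pow G g (Suc j) (z t)) (at t within {0..s})"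
    by (rule has_vector_derivative_transform[OF Suc.prems Suc.IH lie_pow_along_solution[OF G g z[OF Suc.prems]]])
  then show ?case
    using vector_derivative_unique_within[OF at_within_Icc_not_bot[OF s Suc.prems] W[OF Suc.prems]] by blast
qed

text \<open>The two trajectories sweep out a compact set, on which one factorial bound holds for
  both towers. It passes to their difference, all of whose derivatives vanish at
  \<open>0\<close>.\<close>

lemma jets_identity:
  fixes G :: "'a::euclidean_space \<Rightarrow> 'a"
  assumes G: "analytic_fun G" and g: "analytic_fun g" and s: "0 < s"
    and z: "\<And>t. t \<in> {0..s} \<Longrightarrow> (z has_vector_derivative G (z t)) (at t within {0..s})"
    and W0: "\<And>t. t \<in> {0..s} \<Longrightarrow> W 0 t = g (z t)"
    and W: "\<And>j t. t \<in> {0..s} \<Longrightarrow> (W j has_vector_derivative W (Suc j) t) (at t within {0..s})"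
    and z': "\<And>t. t \<in> {0..s} \<Longrightarrow> (z' has_vector_derivative G (z' t)) (at t within {0..s})"
    and W0': "\<And>t. t \<in> {0..s} \<Longrightarrow> W' 0 t = g (z' t)"
    and W': "\<And>j t. t \<in> {0..s} \<Longrightarrow> (W' j has_vector_derivative W' (Suc j) t) (at t within {0..s})"
    and eq: "\<And>j. W j 0 = W' j 0"
    and t: "t \<in> {0..s}"
  shows "W j t = W' j t"
proof -
  have "continuous_on {0..s} z" "continuous_on {0..s} z'"
    using z z' by (meson continuous_on_vector_derivative)+
  then have "compact (z ` {0..s} \<union> z' ` {0..s})"
    by (intro compact_Un compact_continuous_image) auto
  from lie_pow_bound_compact[OF G g this] obtain C Q where CQ: "0 \<le> C" "0 \<le> Q"
    "\<And>y j. y \<in> z ` {0..s} \<union> z' ` {0..s} \<Longrightarrow> norm (lie_pow G g j y) \<le> C * Q ^ j * fact j" by blast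
  define Y where "Y j t = W j t - W' j t" for j t
  have "Y j t = 0"
  proof (rule analytic_curve_vanishes[OF _ _ _ _ _ t])
    show "(Y j has_vector_derivative Y (Suc j) t) (at t within {0..s})" if "t \<in> {0..s}" for j t
      unfolding Y_def using that by (intro has_vector_derivative_diff W W')
    \<comment> \<open>\<open>Q + 1\<close> because \<open>Q\<close> may be zero, whereas a positive
      rate is required.\<close>
    show "norm (Y j t) \<le> (2 * C) * (Q + 1) ^ j * fact j" if t: "t \<in> {0..s}" for j t
    proof -
      have "norm (W j t) \<le> C * Q ^ j * fact j"
        using jets_along_solution[where W = W, OF G g s z W0 W t] CQ(3)[of "z t"] t by auto
      moreover have "norm (W' j t) \<le> C * Q ^ j * fact j"
        using jets_along_solution[where W = W', OF G g s z' W0' W' t] CQ(3)[of "z' t"] t by auto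
      moreover have "C * Q ^ j * fact j \<le> C * (Q + 1) ^ j * fact j"
        using CQ by (intro mult_right_mono mult_left_mono power_mono) auto
      moreover have "norm (Y j t) \<le> norm (W j t) + norm (W' j t)"
        unfolding Y_def by (rule norm_triangle_ineq4)
      ultimately show ?thesis by simp
    qed
  qed (use CQ eq in \<open>auto simp: Y_def\<close>)
  then show ?thesis by (simp add: Y_def)
qed

section \<open>Jets of the output\<close>

lemma iter_deriv_Basis:
  assumes g: "smooth_fun g"
  shows "iter_deriv g [w] p = (\<Sum>b\<in>Basis. (w \<bullet> b) *\<^sub>R iter_deriv g [b] p)"
  using fun_cong[OF lie_Basis[OF g, of "\<lambda>_. w"]] by (simp add: lie_def)

lemma analytic_fun_deriv_direction:
  fixes g :: "'z::euclidean_space \<Rightarrow> 'c::euclidean_space"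
  assumes g: "analytic_fun g" and L: "bounded_linear L" "bounded_linear P"
  shows "analytic_fun (\<lambda>z. iter_deriv g [L z] (P z))"
proof -
  have e: "(\<lambda>z. iter_deriv g [L z] (P z)) = (\<lambda>z. \<Sum>b\<in>Basis. (L z \<bullet> b) *\<^sub>R iter_deriv g [b] (P z))"
    by (rule ext) (rule iter_deriv_Basis[OF analytic_fun_smooth[OF g]])
  show ?thesis
    unfolding e by (intro analytic_fun_sum analytic_fun_scaleR analytic_fun_inner_const
        analytic_fun_linear_compose[OF _ L(2)] analytic_fun_bounded_linear[OF L(1)] analytic_fun_iter_deriv g)
qed

text \<open>Product rule for a derivative whose direction and base point both vary; the mixed term
  is brought into the order \<open>[A x, P' v]\<close> by symmetry.\<close>

lemma has_derivative_iter_deriv_direction: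
  fixes g :: "'z::euclidean_space \<Rightarrow> 'c::euclidean_space"
  assumes g: "smooth_fun g" and A: "(A has_derivative A') (at x)" and P: "(P has_derivative P') (at x)"
  shows "((\<lambda>y. iter_deriv g [A y] (P y)) has_derivative
    (\<lambda>v. iter_deriv g [A' v] (P x) + iter_deriv g [A x, P' v] (P x))) (at x)"
proof -
  note rep = iter_deriv_Basis[OF g]
  have rep2: "iter_deriv g [w, u] p = (\<Sum>b\<in>Basis. (w \<bullet> b) *\<^sub>R iter_deriv g [u, b] p)" for w u p
  proof -
    have "iter_deriv g [w, u] p = (\<Sum>b\<in>Basis. (w \<bullet> b) *\<^sub>R iter_deriv g [b, u] p)"
      using fun_cong[OF lie_Basis[OF smooth_fun_iter_deriv[OF g, of "[u]"], of "\<lambda>_. w"]]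
      unfolding lie_def iter_deriv_append by simp
    then show ?thesis using iter_deriv_swap[OF g, of _ u] by simp
  qed
  have "((\<lambda>y. iter_deriv g [b] (P y)) has_derivative (\<lambda>v. iter_deriv g [P' v, b] (P x))) (at x)" for b
    by (rule has_derivative_compose[OF P smooth_fun_has_derivative[OF g]])
  then have "((\<lambda>y. \<Sum>b\<in>Basis. (A y \<bullet> b) *\<^sub>R iter_deriv g [b] (P y)) has_derivative
      (\<lambda>v. \<Sum>b\<in>Basis. (A x \<bullet> b) *\<^sub>R iter_deriv g [P' v, b] (P x) + (A' v \<bullet> b) *\<^sub>R iter_deriv g [b] (P x))) (at x)"
    using bounded_linear.has_derivative[OF bounded_linear_inner_left A]
    by (intro has_derivative_sum has_derivative_scaleR)
  moreover have "(\<lambda>y. \<Sum>b\<in>Basis. (A y \<bullet> b) *\<^sub>R iter_deriv g [b] (P y)) = (\<lambda>y. iter_deriv g [A y] (P y))"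
    by (rule ext) (rule rep[symmetric])
  moreover have "(\<Sum>b\<in>Basis. (A x \<bullet> b) *\<^sub>R iter_deriv g [P' v, b] (P x) + (A' v \<bullet> b) *\<^sub>R iter_deriv g [b] (P x)) =
      iter_deriv g [A' v] (P x) + iter_deriv g [A x, P' v] (P x)" for v
    unfolding sum.distrib rep[symmetric] rep2[symmetric] by (rule add.commute)
  ultimately show ?thesis by (simp only:)
qed

text \<open>Polynomials in the jet \<open>\<sigma>\<close> of the input with coefficients analytic in \<open>(x, \<sigma> 0)\<close>, together
  with their total differential.\<close>

inductive jet_diff ::
  "('a::euclidean_space \<Rightarrow> (nat \<Rightarrow> 'p::euclidean_space) \<Rightarrow> 'c::euclidean_space) \<Rightarrow>
   ('a \<Rightarrow> (nat \<Rightarrow> 'p) \<Rightarrow> 'a \<Rightarrow> (nat \<Rightarrow> 'p) \<Rightarrow> 'c) \<Rightarrow> bool" where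
  base: "analytic_fun g \<Longrightarrow> jet_diff (\<lambda>x \<sigma>. g (x, \<sigma> 0)) (\<lambda>x \<sigma> x' \<sigma>'. iter_deriv g [(x', \<sigma>' 0)] (x, \<sigma> 0))"
| mult: "jet_diff G G' \<Longrightarrow> jet_diff (\<lambda>x \<sigma>. (\<sigma> i \<bullet> b) *\<^sub>R G x \<sigma>)
    (\<lambda>x \<sigma> x' \<sigma>'. (\<sigma> i \<bullet> b) *\<^sub>R G' x \<sigma> x' \<sigma>' + (\<sigma>' i \<bullet> b) *\<^sub>R G x \<sigma>)"
| add: "jet_diff G G' \<Longrightarrow> jet_diff K K' \<Longrightarrow> jet_diff (\<lambda>x \<sigma>. G x \<sigma> + K x \<sigma>)
    (\<lambda>x \<sigma> x' \<sigma>'. G' x \<sigma> x' \<sigma>' + K' x \<sigma> x' \<sigma>')"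

text \<open>A sequence of jet entries carries no norm here, so the formal differential
  \<open>G'\<close> gets its meaning from this chain rule: it is tested on maps whose components
  \<open>S i\<close> are differentiable one by one.\<close>

lemma jet_diff_has_derivative:
  assumes "jet_diff G G'" and X: "(X has_derivative X') (at z within I)"
    and S: "\<And>i. (S i has_derivative S' i) (at z within I)"
  shows "((\<lambda>z. G (X z) (\<lambda>i. S i z)) has_derivative (\<lambda>h. G' (X z) (\<lambda>i. S i z) (X' h) (\<lambda>i. S' i h))) (at z within I)"
  using assms(1)
proof induction
  case (base g)
  show ?case
    by (rule has_derivative_compose[OF has_derivative_Pair[OF X S] smooth_fun_has_derivative0[OF analytic_fun_smooth[OF base]]])
next
  case (mult G G' i b)
  show ?case
    by (rule has_derivative_scaleR[OF bounded_linear.has_derivative[OF bounded_linear_inner_left S] mult.IH])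
next
  case (add G G' K K')
  then show ?case by (intro has_derivative_add)
qed

lemma jet_diff_tendsto:
  assumes "jet_diff G G'" and X: "(X \<longlongrightarrow> x) F" and S: "\<And>i. ((\<lambda>n. S n i) \<longlongrightarrow> \<sigma> i) F"
  shows "((\<lambda>n. G (X n) (S n)) \<longlongrightarrow> G x \<sigma>) F"
  using assms(1)
proof induction
  case (base g)
  have "isCont g (x, \<sigma> 0)" using isCont_iter_deriv[OF analytic_fun_smooth[OF base], where vs = "[]"] by simp
  then show ?case by (rule isCont_tendsto_compose) (intro tendsto_Pair X S)
qed (intro tendsto_intros S; assumption)+

lemma jet_diff_plus:
  assumes "jet_diff G G'"
  shows "G' x \<sigma> (x' + y') (\<lambda>i. \<sigma>' i + \<tau>' i) = G' x \<sigma> x' \<sigma>' + G' x \<sigma> y' \<tau>'"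
  using assms
proof induction
  case (base g)
  interpret bounded_linear "\<lambda>v. iter_deriv g [v] (x, \<sigma> 0)"
    by (rule iter_deriv_linear[OF analytic_fun_smooth[OF base]])
  show ?case using add[of "(x', \<sigma>' 0)" "(y', \<tau>' 0)"] by (simp del: iter_deriv.simps)
qed (auto simp: algebra_simps inner_add_left)

lemma jet_diff_scale:
  assumes "jet_diff G G'"
  shows "G' x \<sigma> (r *\<^sub>R x') (\<lambda>i. r *\<^sub>R \<sigma>' i) = r *\<^sub>R G' x \<sigma> x' \<sigma>'"
  using assms
proof induction
  case (base g)
  interpret bounded_linear "\<lambda>v. iter_deriv g [v] (x, \<sigma> 0)"
    by (rule iter_deriv_linear[OF analytic_fun_smooth[OF base]])
  show ?case using scaleR[of r "(x', \<sigma>' 0)"] by (simp del: iter_deriv.simps)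
qed (auto simp: algebra_simps)

text \<open>The formal differential splits into partial ones over the finitely many relevant
  entries. The entries from \<open>k\<close> on may be set to zero because the curves with and
  without them have the same image under \<open>G\<close>, and derivatives are unique.\<close>

lemma jet_diff_expand:
  assumes G: "jet_diff G G'" and k: "\<And>x \<sigma> \<sigma>'. (\<And>i. i < k \<Longrightarrow> \<sigma> i = \<sigma>' i) \<Longrightarrow> G x \<sigma> = G x \<sigma>'"
  shows "G' x \<sigma> x' \<sigma>' = G' x \<sigma> x' (\<lambda>_. 0) + (\<Sum>i<k. G' x \<sigma> 0 ((\<lambda>_. 0)(i := \<sigma>' i)))"
proof -
  have der: "((\<lambda>s. G (x + s *\<^sub>R x') (\<lambda>i. \<sigma> i + s *\<^sub>R \<tau> i)) has_derivative (\<lambda>s. s *\<^sub>R G' x \<sigma> x' \<tau>)) (at 0)" for \<tau>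
  proof -
    have "((\<lambda>s. x + s *\<^sub>R x') has_derivative (\<lambda>s. s *\<^sub>R x')) (at 0)"
      and "((\<lambda>s. \<sigma> i + s *\<^sub>R \<tau> i) has_derivative (\<lambda>s. s *\<^sub>R \<tau> i)) (at 0)" for i
      by (auto intro!: derivative_eq_intros)
    from jet_diff_has_derivative[OF G this] show ?thesis by (simp add: jet_diff_scale[OF G])
  qed
  let ?\<tau> = "\<lambda>i. if i < k then \<sigma>' i else 0"
  have e: "(\<lambda>s. G (x + s *\<^sub>R x') (\<lambda>i. \<sigma> i + s *\<^sub>R \<sigma>' i)) = (\<lambda>s. G (x + s *\<^sub>R x') (\<lambda>i. \<sigma> i + s *\<^sub>R ?\<tau> i))"
    by (intro ext k) simp
  have "(\<lambda>s. s *\<^sub>R G' x \<sigma> x' \<sigma>') = (\<lambda>s. s *\<^sub>R G' x \<sigma> x' ?\<tau>)"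
    by (rule has_derivative_unique[OF der[of \<sigma>']]) (unfold e, rule der)
  from fun_cong[OF this, of 1] have "G' x \<sigma> x' \<sigma>' = G' x \<sigma> x' ?\<tau>" by simp
  also have "\<dots> = G' x \<sigma> x' (\<lambda>_. 0) + (\<Sum>i<k. G' x \<sigma> 0 ((\<lambda>_. 0)(i := \<sigma>' i)))"
  proof (induction k)
    case (Suc N)
    have e: "(\<lambda>i. if i < Suc N then \<sigma>' i else 0) =
        (\<lambda>i. (if i < N then \<sigma>' i else 0) + ((\<lambda>_. 0)(N := \<sigma>' N)) i)"
      by (auto simp: fun_eq_iff less_Suc_eq)
    show ?case
      unfolding e using jet_diff_plus[OF G, of x \<sigma> x' 0 "\<lambda>i. if i < N then \<sigma>' i else 0" "(\<lambda>_. 0)(N := \<sigma>' N)"] Suc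
      by (simp add: add.assoc fun_upd_def)
  qed simp
  finally show ?thesis .
qed

lemma jet_diff_sum:
  assumes "\<And>b. b \<in> B \<Longrightarrow> \<exists>K'. jet_diff (K b) K'"
  shows "\<exists>K'. jet_diff (\<lambda>x \<sigma>. \<Sum>b\<in>B. K b x \<sigma>) K'"
  using assms
proof (induction B rule: infinite_finite_induct)
  case (insert b B)
  then show ?case using jet_diff.add[of "K b" _ "\<lambda>x \<sigma>. \<Sum>b\<in>B. K b x \<sigma>"] by fastforce
qed (use jet_diff.base[OF analytic_fun_const[of 0]] in auto)

section \<open>The total derivative along the system\<close>

definition shift :: "(nat \<Rightarrow> 'p) \<Rightarrow> nat \<Rightarrow> 'p" where "shift \<sigma> i = \<sigma> (Suc i)"

lemma analytic_fun_Pair0: "analytic_fun f \<Longrightarrow> analytic_fun (\<lambda>z. (f z, 0))"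
  by (rule analytic_fun_linear_image[where L = "\<lambda>a. (a, 0)"])
    (auto intro!: bounded_linear_Pair bounded_linear_ident bounded_linear_zero)

text \<open>The class is closed under the total derivative because each new jet entry appears only
  as a linear factor; this is why polynomials in the higher entries suffice.\<close>

lemma jet_diff_total:
  fixes f :: "'a::euclidean_space \<times> 'p::euclidean_space \<Rightarrow> 'a"
  assumes f: "analytic_fun f" and "jet_diff G G'"
  shows "\<exists>K'. jet_diff (\<lambda>x \<sigma>. G' x \<sigma> (f (x, \<sigma> 0)) (shift \<sigma>)) K'"
  using assms(2)
proof induction
  case (base g)
  interpret bl: bounded_linear "\<lambda>v. iter_deriv g [v] p" for p
    by (rule iter_deriv_linear[OF analytic_fun_smooth[OF base]])
  have e: "iter_deriv g [(f (x, \<sigma> 0), shift \<sigma> 0)] (x, \<sigma> 0) = lie (\<lambda>z. (f z, 0)) g (x, \<sigma> 0) +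
      (\<Sum>b\<in>Basis. (\<sigma> 1 \<bullet> b) *\<^sub>R iter_deriv g [(0, b)] (x, \<sigma> 0))" for x and \<sigma> :: "nat \<Rightarrow> 'p"
  proof -
    have "(f (x, \<sigma> 0), shift \<sigma> 0) = (f (x, \<sigma> 0), 0) + (\<Sum>b\<in>Basis. (\<sigma> 1 \<bullet> b) *\<^sub>R (0, b))"
      by (simp add: shift_def sum_prod euclidean_representation)
    then show ?thesis unfolding lie_def by (simp only: bl.add bl.sum bl.scaleR)
  qed
  have 1: "jet_diff (\<lambda>x \<sigma>. lie (\<lambda>z. (f z, 0)) g (x, \<sigma> 0)) (\<lambda>x \<sigma> x' \<sigma>'. iter_deriv (lie (\<lambda>z. (f z, 0)) g) [(x', \<sigma>' 0)] (x, \<sigma> 0))"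
    by (intro jet_diff.base analytic_fun_lie base analytic_fun_Pair0 f)
  have "\<exists>K'. jet_diff (\<lambda>x \<sigma>. \<Sum>b\<in>Basis. (\<sigma> 1 \<bullet> b) *\<^sub>R iter_deriv g [(0, b)] (x, \<sigma> 0)) K'"
    using jet_diff.mult[OF jet_diff.base[OF analytic_fun_iter_deriv[OF base]]] by (intro jet_diff_sum) blast
  then show ?case using jet_diff.add[OF 1] unfolding e by blast
next
  case (mult G G' i b)
  then obtain K' where K': "jet_diff (\<lambda>x \<sigma>. G' x \<sigma> (f (x, \<sigma> 0)) (shift \<sigma>)) K'" by blast
  show ?case
    using jet_diff.add[OF jet_diff.mult[OF K', of i b] jet_diff.mult[OF mult.hyps, of "Suc i" b]]
    unfolding shift_def by blast
next
  case (add G G' K K')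
  then show ?case using jet_diff.add by blast
qed

text \<open>The recursion sums partial derivatives over \<open>i < k\<close>. This is already the
  total differential in the direction \<open>(f (x, \<sigma> 0), shift \<sigma>)\<close>, since the
  jet of order \<open>k\<close> depends on no further entries.\<close>

lemma output_jet_Suc:
  assumes "jet_diff (output_jet f h k) G'"
  shows "output_jet f h (Suc k) x \<sigma> = G' x \<sigma> (f (x, \<sigma> 0)) (shift \<sigma>)"
proof -
  have "((\<lambda>y. output_jet f h k y \<sigma>) has_derivative (\<lambda>v. G' x \<sigma> v (\<lambda>_. 0))) (at x)"
    by (rule jet_diff_has_derivative[OF assms has_derivative_ident has_derivative_const])
  then have 1: "frechet_derivative (\<lambda>y. output_jet f h k y \<sigma>) (at x) = (\<lambda>v. G' x \<sigma> v (\<lambda>_. 0))"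
    using frechet_derivative_at by metis
  have d: "((\<lambda>s. output_jet f h k x (\<sigma>(i := s))) has_derivative (\<lambda>w. G' x \<sigma> 0 ((\<lambda>_. 0)(i := w)))) (at (\<sigma> i))" for i
  proof -
    have "((\<lambda>s. (\<sigma>(i := s)) j) has_derivative (\<lambda>w. ((\<lambda>_. 0)(i := w)) j)) (at (\<sigma> i))" for j
      by (cases "j = i") auto
    from jet_diff_has_derivative[OF assms has_derivative_const[of x], where S = "\<lambda>j s. (\<sigma>(i := s)) j", OF this]
    show ?thesis by (simp only: fun_upd_triv)
  qed
  then have 2: "frechet_derivative (\<lambda>s. output_jet f h k x (\<sigma>(i := s))) (at (\<sigma> i)) = (\<lambda>w. G' x \<sigma> 0 ((\<lambda>_. 0)(i := w)))" for i
    using frechet_derivative_at by metis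
  have "G' x \<sigma> (f (x, \<sigma> 0)) (shift \<sigma>) =
      G' x \<sigma> (f (x, \<sigma> 0)) (\<lambda>_. 0) + (\<Sum>i<k. G' x \<sigma> 0 ((\<lambda>_. 0)(i := shift \<sigma> i)))"
    by (rule jet_diff_expand[OF assms]) (rule output_jet_cong)
  then show ?thesis
    unfolding output_jet.simps 1 2 shift_def by simp
qed

lemma jet_diff_output_jet:
  assumes f: "analytic_fun f" and h: "analytic_fun h"
  shows "\<exists>G'. jet_diff (output_jet f h k) G'"
proof (induction k)
  case 0
  have "analytic_fun (\<lambda>z. h (fst z))"
    by (rule analytic_fun_linear_compose[OF h bounded_linear_fst])
  from jet_diff.base[OF this] show ?case by auto
next
  case (Suc k)
  then obtain G' where G': "jet_diff (output_jet f h k) G'" by blast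
  have "output_jet f h (Suc k) = (\<lambda>x \<sigma>. G' x \<sigma> (f (x, \<sigma> 0)) (shift \<sigma>))"
    using output_jet_Suc[OF G'] by blast
  then show ?case using jet_diff_total[OF f G'] by metis
qed

section \<open>Commutation of the state differential with the total derivative\<close>

abbreviation tangent_jet ::
  "('a \<Rightarrow> (nat \<Rightarrow> 'p) \<Rightarrow> 'a \<Rightarrow> (nat \<Rightarrow> 'p) \<Rightarrow> 'c) \<Rightarrow> 'a \<times> 'a \<Rightarrow> (nat \<Rightarrow> 'p::zero) \<Rightarrow> 'c" where
  "tangent_jet G' \<equiv> \<lambda>p \<sigma>. G' (fst p) \<sigma> (snd p) (\<lambda>_. 0)"

abbreviation tangent_total where
  "tangent_total f G' Gt' x \<sigma> \<equiv> ((\<lambda>y. G' y \<sigma> (f (y, \<sigma> 0)) (shift \<sigma>)) has_derivative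
     (\<lambda>\<xi>. Gt' (x, \<xi>) \<sigma> (f (x, \<sigma> 0), iter_deriv f [(\<xi>, 0)] (x, \<sigma> 0)) (shift \<sigma>))) (at x)"

text \<open>Differentiating the total derivative of \<open>G\<close> in \<open>x\<close> gives the
  total derivative of the tangent jet along the system coupled with its linearization. In the base
  case this is the symmetry of second derivatives; products and sums inherit it.\<close>

lemma jet_diff_tangent:
  fixes f :: "'a::euclidean_space \<times> 'p::euclidean_space \<Rightarrow> 'a"
  assumes f: "analytic_fun f" and "jet_diff G G'"
  shows "\<exists>Gt'. jet_diff (tangent_jet G') Gt' \<and>
    (\<forall>x \<sigma>. tangent_total f G' Gt' x \<sigma>)"
  using assms(2)
proof induction
  case (base g)
  note sg = analytic_fun_smooth[OF base] and sf = analytic_fun_smooth[OF f]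
  interpret bl: bounded_linear "\<lambda>v. iter_deriv g [v] p" for p by (rule iter_deriv_linear[OF sg])
  define gt where "gt z = iter_deriv g [(snd (fst z), 0)] (fst (fst z), snd z)" for z :: "('a \<times> 'a) \<times> 'p"
  have L: "bounded_linear (\<lambda>z::('a \<times> 'a) \<times> 'p. (fst (fst z), snd z))"
    "bounded_linear (\<lambda>z::('a \<times> 'a) \<times> 'p. (snd (fst z), 0::'p))"
    by (auto intro!: bounded_linear_Pair bounded_linear_compose[OF bounded_linear_fst bounded_linear_fst]
        bounded_linear_compose[OF bounded_linear_snd bounded_linear_fst] bounded_linear_snd bounded_linear_zero)
  have gt: "analytic_fun gt"
    unfolding gt_def[abs_def] by (rule analytic_fun_deriv_direction[OF base L(2) L(1)])
  have gt': "iter_deriv gt [((x', \<xi>'), u')] ((x, \<xi>), u) =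
      iter_deriv g [(\<xi>', 0)] (x, u) + iter_deriv g [(\<xi>, 0), (x', u')] (x, u)" for x \<xi> u x' \<xi>' u'
  proof -
    have "(gt has_derivative (\<lambda>v. iter_deriv g [(snd (fst v), 0)] (x, u) + iter_deriv g [(\<xi>, 0), (fst (fst v), snd v)] (x, u))) (at ((x, \<xi>), u))"
      unfolding gt_def
      using has_derivative_iter_deriv_direction[OF sg bounded_linear_imp_has_derivative[OF L(2)]
          bounded_linear_imp_has_derivative[OF L(1)], where x = "((x, \<xi>), u)"] by simp
    from fun_cong[OF has_derivative_unique[OF smooth_fun_has_derivative0[OF analytic_fun_smooth[OF gt]] this],
        of "((x', \<xi>'), u')"]
    show ?thesis unfolding fst_conv snd_conv .
  qed
  have jd: "jet_diff (\<lambda>p \<sigma>. iter_deriv g [(snd p, (\<lambda>_. 0::'p) 0)] (fst p, \<sigma> 0))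
      (\<lambda>p \<sigma> p' \<sigma>'. iter_deriv gt [(p', \<sigma>' 0)] (p, \<sigma> 0))"
    using jet_diff.base[OF gt] by (simp add: gt_def del: iter_deriv.simps)
  show ?case
  proof (rule exI, rule conjI[OF jd], intro allI)
    fix x :: 'a and \<sigma> :: "nat \<Rightarrow> 'p"
    have P: "((\<lambda>y. (y, \<sigma> 0)) has_derivative (\<lambda>\<xi>. (\<xi>, 0))) (at x)"
      by (auto intro!: derivative_eq_intros)
    have A: "((\<lambda>y. (f (y, \<sigma> 0), shift \<sigma> 0)) has_derivative (\<lambda>\<xi>. (iter_deriv f [(\<xi>, 0)] (x, \<sigma> 0), 0))) (at x)"
      by (intro has_derivative_Pair has_derivative_const has_derivative_compose[OF P smooth_fun_has_derivative0[OF sf]])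
    show "((\<lambda>y. iter_deriv g [(f (y, \<sigma> 0), shift \<sigma> 0)] (y, \<sigma> 0)) has_derivative
       (\<lambda>\<xi>. iter_deriv gt [((f (x, \<sigma> 0), iter_deriv f [(\<xi>, 0)] (x, \<sigma> 0)), shift \<sigma> 0)] ((x, \<xi>), \<sigma> 0))) (at x)"
      unfolding gt' iter_deriv_swap[OF sg, of "(_, 0)" "(f (x, \<sigma> 0), shift \<sigma> 0)"]
      by (rule has_derivative_iter_deriv_direction[OF sg A P])
  qed
next
  case (mult G G' i b)
  then obtain Gt' where Gt': "jet_diff (tangent_jet G') Gt'"
    "\<And>x \<sigma>. tangent_total f G' Gt' x \<sigma>" by blast
  have jd: "jet_diff (\<lambda>p \<sigma>. (\<sigma> i \<bullet> b) *\<^sub>R G' (fst p) \<sigma> (snd p) (\<lambda>_. 0) + ((\<lambda>_. 0) i \<bullet> b) *\<^sub>R G (fst p) \<sigma>)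
      (\<lambda>p \<sigma> p' \<sigma>'. (\<sigma> i \<bullet> b) *\<^sub>R Gt' p \<sigma> p' \<sigma>' + (\<sigma>' i \<bullet> b) *\<^sub>R G' (fst p) \<sigma> (snd p) (\<lambda>_. 0))"
    using jet_diff.mult[OF Gt'(1), of i b] by simp
  show ?case
  proof (rule exI, rule conjI[OF jd], intro allI)
    fix x :: 'a and \<sigma> :: "nat \<Rightarrow> 'p"
    have "((\<lambda>y. G y \<sigma>) has_derivative (\<lambda>\<xi>. G' x \<sigma> \<xi> (\<lambda>_. 0))) (at x)"
      by (rule jet_diff_has_derivative[OF mult.hyps has_derivative_ident has_derivative_const])
    then show "((\<lambda>y. (\<sigma> i \<bullet> b) *\<^sub>R G' y \<sigma> (f (y, \<sigma> 0)) (shift \<sigma>) + (shift \<sigma> i \<bullet> b) *\<^sub>R G y \<sigma>) has_derivative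
       (\<lambda>\<xi>. (\<sigma> i \<bullet> b) *\<^sub>R Gt' (x, \<xi>) \<sigma> (f (x, \<sigma> 0), iter_deriv f [(\<xi>, 0)] (x, \<sigma> 0)) (shift \<sigma>) +
         (shift \<sigma> i \<bullet> b) *\<^sub>R G' (fst (x, \<xi>)) \<sigma> (snd (x, \<xi>)) (\<lambda>_. 0))) (at x)"
      unfolding fst_conv snd_conv by (intro has_derivative_add has_derivative_scaleR_right Gt'(2))
  qed
next
  case (add G G' K K')
  then obtain Gt' Kt' where Gt': "jet_diff (tangent_jet G') Gt'"
    "\<And>x \<sigma>. tangent_total f G' Gt' x \<sigma>"
    and Kt': "jet_diff (tangent_jet K') Kt'"
    "\<And>x \<sigma>. tangent_total f K' Kt' x \<sigma>" by blast
  show ?case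
    by (rule exI, rule conjI[OF jet_diff.add[OF Gt'(1) Kt'(1)]]) (intro allI has_derivative_add Gt'(2) Kt'(2))
qed

section \<open>Output jets and their differentials along trajectories\<close>

definition output_jet_deriv ::
  "('a::real_normed_vector \<times> 'b::real_normed_vector \<Rightarrow> 'a) \<Rightarrow> ('a \<Rightarrow> 'c::real_normed_vector) \<Rightarrow>
    nat \<Rightarrow> 'a \<Rightarrow> (nat \<Rightarrow> 'b) \<Rightarrow> 'a \<Rightarrow> 'c" where
  "output_jet_deriv f h k x \<sigma> \<xi> = frechet_derivative (\<lambda>y. output_jet f h k y \<sigma>) (at x) \<xi>"

context
  fixes f :: "'a::euclidean_space \<times> 'p::euclidean_space \<Rightarrow> 'a" and h :: "'a \<Rightarrow> 'c::euclidean_space"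
  assumes f: "analytic_fun f" and h: "analytic_fun h"
begin

lemma output_jet_deriv_eq:
  assumes "jet_diff (output_jet f h k) G'"
  shows "output_jet_deriv f h k x \<sigma> \<xi> = G' x \<sigma> \<xi> (\<lambda>_. 0)"
    "((\<lambda>y. output_jet f h k y \<sigma>) has_derivative output_jet_deriv f h k x \<sigma>) (at x)"
proof -
  have 1: "((\<lambda>y. output_jet f h k y \<sigma>) has_derivative (\<lambda>v. G' x \<sigma> v (\<lambda>_. 0))) (at x)"
    by (rule jet_diff_has_derivative[OF assms has_derivative_ident has_derivative_const])
  then have 2: "frechet_derivative (\<lambda>y. output_jet f h k y \<sigma>) (at x) = (\<lambda>v. G' x \<sigma> v (\<lambda>_. 0))"
    using frechet_derivative_at by metis
  show "output_jet_deriv f h k x \<sigma> \<xi> = G' x \<sigma> \<xi> (\<lambda>_. 0)"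
    unfolding output_jet_deriv_def 2 ..
  show "((\<lambda>y. output_jet f h k y \<sigma>) has_derivative output_jet_deriv f h k x \<sigma>) (at x)"
    using 1 unfolding output_jet_deriv_def 2 .
qed

lemma has_derivative_output_jet:
  "((\<lambda>y. output_jet f h k y \<sigma>) has_derivative output_jet_deriv f h k x \<sigma>) (at x)"
  using output_jet_deriv_eq(2) jet_diff_output_jet[OF f h] by blast

lemma output_jet_tendsto:
  assumes "(X \<longlongrightarrow> x) F" "\<And>i. ((\<lambda>n. S n i) \<longlongrightarrow> \<sigma> i) F"
  shows "((\<lambda>n. output_jet f h k (X n) (S n)) \<longlongrightarrow> output_jet f h k x \<sigma>) F"
  using jet_diff_output_jet[OF f h] jet_diff_tendsto assms by blast

lemma output_jet_deriv_tendsto: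
  assumes "(X \<longlongrightarrow> x) F" "(V \<longlongrightarrow> v) F" "\<And>i. ((\<lambda>n. S n i) \<longlongrightarrow> \<sigma> i) F"
  shows "((\<lambda>n. output_jet_deriv f h k (X n) (S n) (V n)) \<longlongrightarrow> output_jet_deriv f h k x \<sigma> v) F"
proof -
  obtain G' where G': "jet_diff (output_jet f h k) G'" using jet_diff_output_jet[OF f h] by blast
  then obtain Gt' where "jet_diff (tangent_jet G') Gt'"
    using jet_diff_tangent[OF f] by blast
  from jet_diff_tendsto[OF this tendsto_Pair[OF assms(1,2)] assms(3)]
  show ?thesis unfolding output_jet_deriv_eq(1)[OF G'] by simp
qed

lemma output_jet_deriv_0: "output_jet_deriv f h 0 x \<sigma> \<xi> = iter_deriv h [\<xi>] x"
  by (simp add: output_jet_deriv_def)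

lemma output_jet_along_solution:
  assumes X: "(X has_vector_derivative f (X t, U 0 t)) (at t within I)"
    and U: "\<And>i. (U i has_vector_derivative U (Suc i) t) (at t within I)"
  shows "((\<lambda>t. output_jet f h k (X t) (\<lambda>i. U i t)) has_vector_derivative
    output_jet f h (Suc k) (X t) (\<lambda>i. U i t)) (at t within I)"
proof -
  obtain G' where G': "jet_diff (output_jet f h k) G'" using jet_diff_output_jet[OF f h] by blast
  from jet_diff_has_derivative[OF G' X[unfolded has_vector_derivative_def] U[unfolded has_vector_derivative_def]]
  show ?thesis unfolding has_vector_derivative_def output_jet_Suc[OF G'] jet_diff_scale[OF G'] shift_def .
qed

text \<open>The state differentials of the jets are again a tower of time derivatives, now along the
  variational equation; this reduces immersion to the same identity theorem as injectivity.\<close>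

lemma output_jet_deriv_along_solution:
  assumes X: "(X has_vector_derivative f (X t, U 0 t)) (at t within I)"
    and \<Xi>: "(\<Xi> has_vector_derivative iter_deriv f [(\<Xi> t, 0)] (X t, U 0 t)) (at t within I)"
    and U: "\<And>i. (U i has_vector_derivative U (Suc i) t) (at t within I)"
  shows "((\<lambda>t. output_jet_deriv f h k (X t) (\<lambda>i. U i t) (\<Xi> t)) has_vector_derivative
    output_jet_deriv f h (Suc k) (X t) (\<lambda>i. U i t) (\<Xi> t)) (at t within I)"
proof -
  obtain G' where G': "jet_diff (output_jet f h k) G'" using jet_diff_output_jet[OF f h] by blast
  then obtain Gt' where Gt': "jet_diff (tangent_jet G') Gt'"
    "\<And>x \<sigma>. tangent_total f G' Gt' x \<sigma>"
    using jet_diff_tangent[OF f] by blast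
  have 1: "output_jet_deriv f h (Suc k) x \<sigma> \<xi> = Gt' (x, \<xi>) \<sigma> (f (x, \<sigma> 0), iter_deriv f [(\<xi>, 0)] (x, \<sigma> 0)) (shift \<sigma>)" for x \<sigma> \<xi>
    unfolding output_jet_deriv_def output_jet_Suc[OF G'] frechet_derivative_at[OF Gt'(2), symmetric] ..
  have XX: "((\<lambda>t. (X t, \<Xi> t)) has_vector_derivative (f (X t, U 0 t), iter_deriv f [(\<Xi> t, 0)] (X t, U 0 t))) (at t within I)"
    using X \<Xi> by (rule has_vector_derivative_Pair)
  from jet_diff_has_derivative[OF Gt'(1) XX[unfolded has_vector_derivative_def] U[unfolded has_vector_derivative_def]]
  show ?thesis
    unfolding has_vector_derivative_def 1 output_jet_deriv_eq(1)[OF G'] jet_diff_scale[OF Gt'(1)] shift_def fst_conv snd_conv .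
qed

end

section \<open>Short-time solutions\<close>

lemma analytic_fun_Pair:
  assumes "analytic_fun f" "analytic_fun g"
  shows "analytic_fun (\<lambda>z. (f z, g z))"
proof -
  have "analytic_fun (\<lambda>z. (0, g z))"
    by (rule analytic_fun_linear_image[OF assms(2), where L = "\<lambda>b. (0, b)"])
      (auto intro!: bounded_linear_Pair bounded_linear_ident bounded_linear_zero)
  from analytic_fun_add[OF analytic_fun_Pair0[OF assms(1)] this] show ?thesis by simp
qed

lemma bounded_linear_projections:
  "bounded_linear (\<lambda>z::('a::real_normed_vector \<times> 'b::real_normed_vector) \<times> 'c::real_normed_vector. fst (fst z))"
  "bounded_linear (\<lambda>z::('a::real_normed_vector \<times> 'b::real_normed_vector) \<times> 'c::real_normed_vector. snd (fst z))"
  by (intro bounded_linear_compose[OF bounded_linear_fst bounded_linear_fst]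
      bounded_linear_compose[OF bounded_linear_snd bounded_linear_fst])+

definition tangent_field :: "('a::real_normed_vector \<times> 'p::real_normed_vector \<Rightarrow> 'a) \<Rightarrow>
    ('a \<times> 'a) \<times> 'p \<Rightarrow> 'a \<times> 'a" where
  "tangent_field f z = (f (fst (fst z), snd z), iter_deriv f [(snd (fst z), 0)] (fst (fst z), snd z))"

lemma analytic_fun_tangent_field:
  fixes f :: "'a::euclidean_space \<times> 'p::euclidean_space \<Rightarrow> 'a"
  assumes "analytic_fun f"
  shows "analytic_fun (tangent_field f)"
  unfolding tangent_field_def
  by (intro analytic_fun_Pair analytic_fun_deriv_direction assms
      analytic_fun_linear_compose[OF assms, where L = "\<lambda>z. (fst (fst z), snd z)"]
      bounded_linear_Pair bounded_linear_projections bounded_linear_snd bounded_linear_zero)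

text \<open>The input is generated by an additional state, so that the system becomes autonomous.\<close>

definition extended_field ::
  "('s::real_normed_vector \<times> 'p::real_normed_vector \<Rightarrow> 's) \<Rightarrow> (real \<Rightarrow> 'p) \<Rightarrow> ('s \<times> 'p) \<times> real \<Rightarrow> ('s \<times> 'p) \<times> real"
  where "extended_field F w z = ((F (fst z), w (snd z)), 1)"

lemma analytic_fun_extended_field:
  fixes F :: "'s::euclidean_space \<times> 'p::euclidean_space \<Rightarrow> 's"
  assumes "analytic_fun F" "analytic_fun w"
  shows "analytic_fun (extended_field F w)"
  unfolding extended_field_def
  by (intro analytic_fun_Pair analytic_fun_const analytic_fun_linear_compose[OF assms(1)]
      analytic_fun_linear_compose[OF assms(2)] bounded_linear_fst bounded_linear_snd)

lemma extended_field_solution: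
  assumes "(X has_vector_derivative F (X t, u t)) (at t within I)"
    and "(u has_vector_derivative w t) (at t within I)"
  shows "((\<lambda>t. ((X t, u t), t)) has_vector_derivative extended_field F w ((X t, u t), t)) (at t within I)"
  unfolding extended_field_def fst_conv snd_conv
  by (intro has_vector_derivative_Pair assms has_vector_derivative_id)

abbreviation solves_at :: "('s::real_normed_vector \<times> 'p \<Rightarrow> 's) \<Rightarrow> (real \<Rightarrow> 'p) \<Rightarrow> real \<Rightarrow> (real \<Rightarrow> 's) \<Rightarrow> real \<Rightarrow> bool" where
  "solves_at F u s X t \<equiv> (X has_vector_derivative F (X t, u t)) (at t within {0..s})"

text \<open>The autonomous system has state \<open>((X, U 0), t)\<close> and takes
  \<open>U 1\<close> as the velocity of the input, which is why analyticity is asked of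
  \<open>U 1\<close>.\<close>

lemma output_jets_identity:
  fixes f :: "'a::euclidean_space \<times> 'p::euclidean_space \<Rightarrow> 'a" and h :: "'a \<Rightarrow> 'c::euclidean_space"
  assumes f: "analytic_fun f" and h: "analytic_fun h" and U1: "analytic_fun (U 1)"
    and U: "\<And>i t. (U i has_vector_derivative U (Suc i) t) (at t)" and s: "0 < s"
    and X: "\<And>t. t \<in> {0..s} \<Longrightarrow> solves_at f (U 0) s X t"
    and X': "\<And>t. t \<in> {0..s} \<Longrightarrow> solves_at f (U 0) s X' t"
    and eq: "\<And>j. output_jet f h j (X 0) (\<lambda>i. U i 0) = output_jet f h j (X' 0) (\<lambda>i. U i 0)"
    and t: "t \<in> {0..s}"
  shows "output_jet f h j (X t) (\<lambda>i. U i t) = output_jet f h j (X' t) (\<lambda>i. U i t)"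
proof -
  note Uw = has_vector_derivative_at_within[OF U]
  note U01 = Uw[of 0, unfolded One_nat_def[symmetric]]
  have g: "analytic_fun (\<lambda>z::('a \<times> 'p) \<times> real. h (fst (fst z)))"
    by (rule analytic_fun_linear_compose[OF h bounded_linear_projections(1)])
  show ?thesis
    by (rule jets_identity[where W = "\<lambda>j t. output_jet f h j (X t) (\<lambda>i. U i t)"
        and W' = "\<lambda>j t. output_jet f h j (X' t) (\<lambda>i. U i t)",
        OF analytic_fun_extended_field[OF f U1] g s extended_field_solution[where u = "U 0"] _ _
          extended_field_solution[where u = "U 0"] _ _ eq t])
      (use X X' Uw U01 output_jet_along_solution[OF f h] in auto)
qed

text \<open>\<open>Z\<close> is compared with the trajectory that has the same base curve and
  tangent vector zero, whose tower \<open>W'\<close> is zero.\<close>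

lemma output_jet_derivs_identity:
  fixes f :: "'a::euclidean_space \<times> 'p::euclidean_space \<Rightarrow> 'a" and h :: "'a \<Rightarrow> 'c::euclidean_space"
  assumes f: "analytic_fun f" and h: "analytic_fun h" and U1: "analytic_fun (U 1)"
    and U: "\<And>i t. (U i has_vector_derivative U (Suc i) t) (at t)" and s: "0 < s"
    and Z: "\<And>t. t \<in> {0..s} \<Longrightarrow> solves_at (tangent_field f) (U 0) s Z t"
    and eq: "\<And>j. output_jet_deriv f h j (fst (Z 0)) (\<lambda>i. U i 0) (snd (Z 0)) = 0"
    and t: "t \<in> {0..s}"
  shows "output_jet_deriv f h j (fst (Z t)) (\<lambda>i. U i t) (snd (Z t)) = 0"
proof -
  note Uw = has_vector_derivative_at_within[OF U]
  note U01 = Uw[of 0, unfolded One_nat_def[symmetric]]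
  note sf = analytic_fun_smooth[OF f] and sh = analytic_fun_smooth[OF h]
  have g: "analytic_fun (\<lambda>z::(('a \<times> 'a) \<times> 'p) \<times> real. iter_deriv h [snd (fst (fst z))] (fst (fst (fst z))))"
    by (intro analytic_fun_deriv_direction h bounded_linear_compose[OF bounded_linear_fst bounded_linear_projections(1)]
        bounded_linear_compose[OF bounded_linear_snd bounded_linear_projections(1)])
  have X: "((\<lambda>t. fst (Z t)) has_vector_derivative f (fst (Z t), U 0 t)) (at t within {0..s})"
    and \<Xi>: "((\<lambda>t. snd (Z t)) has_vector_derivative iter_deriv f [(snd (Z t), 0)] (fst (Z t), U 0 t)) (at t within {0..s})"
    if "t \<in> {0..s}" for t
    using bounded_linear.has_vector_derivative[OF bounded_linear_fst Z[OF that]]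
      bounded_linear.has_vector_derivative[OF bounded_linear_snd Z[OF that]]
    unfolding tangent_field_def fst_conv snd_conv by blast+
  have z0: "iter_deriv f [(0, 0)] p = 0" "iter_deriv h [0] q = 0" for p q
    using linear_simps(3)[OF iter_deriv_linear[OF sf]] linear_simps(3)[OF iter_deriv_linear[OF sh]]
    by (auto simp: zero_prod_def)
  have Z0: "((\<lambda>t. (fst (Z t), 0)) has_vector_derivative tangent_field f ((fst (Z t), 0), U 0 t)) (at t within {0..s})"
    if "t \<in> {0..s}" for t
    unfolding tangent_field_def fst_conv snd_conv z0
    by (intro has_vector_derivative_Pair has_vector_derivative_const X that)
  have W: "((\<lambda>t. output_jet_deriv f h j (fst (Z t)) (\<lambda>i. U i t) (snd (Z t))) has_vector_derivative
      output_jet_deriv f h (Suc j) (fst (Z t)) (\<lambda>i. U i t) (snd (Z t))) (at t within {0..s})"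
    if "t \<in> {0..s}" for t j
    by (rule output_jet_deriv_along_solution[OF f h X[OF that] \<Xi>[OF that] Uw])
  show ?thesis
    by (rule jets_identity[where W = "\<lambda>j t. output_jet_deriv f h j (fst (Z t)) (\<lambda>i. U i t) (snd (Z t))"
        and W' = "\<lambda>j t. 0",
        OF analytic_fun_extended_field[OF analytic_fun_tangent_field[OF f] U1] g s
          extended_field_solution[where u = "U 0" and X = Z] _ _
          extended_field_solution[where u = "U 0" and X = "\<lambda>t. (fst (Z t), 0)"] _ _ eq t])
      (use Z Z0 W U01 z0 output_jet_deriv_0[OF f h] in \<open>auto simp del: iter_deriv.simps\<close>)
qed

section \<open>Lipschitz bounds and the short-time flow\<close>

lemma analytic_fun_lipschitz_on_compact:
  fixes F :: "'z::euclidean_space \<Rightarrow> 'c::euclidean_space"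
  assumes F: "analytic_fun F" and C: "compact C" "convex C"
  shows "\<exists>L\<ge>0. (\<forall>z\<in>C. norm (F z) \<le> L) \<and> (\<forall>z\<in>C. \<forall>z'\<in>C. norm (F z - F z') \<le> L * norm (z - z'))"
proof -
  note s = analytic_fun_smooth[OF F]
  have cont: "continuous_on C (iter_deriv F vs)" for vs
    using isCont_iter_deriv[OF s] by (simp add: continuous_at_imp_continuous_on)
  have bdd: "\<exists>M\<ge>0. \<forall>z\<in>C. norm (iter_deriv F vs z) \<le> M" for vs
  proof -
    have "bounded (iter_deriv F vs ` C)"
      by (intro compact_imp_bounded compact_continuous_image cont C)
    then show ?thesis unfolding bounded_pos by (auto intro: less_imp_le)
  qed
  then obtain M where M: "\<And>vs. 0 \<le> M vs" "\<And>vs z. z \<in> C \<Longrightarrow> norm (iter_deriv F vs z) \<le> M vs" by metis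
  define L where "L = M [] + (\<Sum>b\<in>Basis. M [b])"
  have L: "0 \<le> (\<Sum>b\<in>Basis. M [b])" using M by (intro sum_nonneg) auto
  have "norm (F z - F z') \<le> (\<Sum>b\<in>Basis. M [b]) * norm (z - z')" if "z \<in> C" "z' \<in> C" for z z'
  proof (rule differentiable_bound[OF C(2) _ _ that(1,2)])
    fix y assume y: "y \<in> C"
    show "(F has_derivative (\<lambda>v. iter_deriv F [v] y)) (at y within C)"
      by (rule has_derivative_at_withinI[OF smooth_fun_has_derivative0[OF s]])
    show "onorm (\<lambda>v. iter_deriv F [v] y) \<le> (\<Sum>b\<in>Basis. M [b])"
    proof (rule onorm_le)
      fix v
      have "norm (iter_deriv F [v] y) \<le> (\<Sum>b\<in>Basis. norm v * M [b])"
        unfolding iter_deriv_Basis[OF s, of v]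
      proof (rule sum_norm_le)
        fix b :: 'z assume b: "b \<in> Basis"
        show "norm ((v \<bullet> b) *\<^sub>R iter_deriv F [b] y) \<le> norm v * M [b]"
          unfolding norm_scaleR
            by (rule mult_mono[OF _ M(2)[OF y]]) (use Basis_le_norm[OF b, of v] in auto)
      qed
      then show "norm (iter_deriv F [v] y) \<le> (\<Sum>b\<in>Basis. M [b]) * norm v"
        by (simp add: sum_distrib_left mult.commute del: iter_deriv.simps)
    qed
  qed
  then have lip: "norm (F z - F z') \<le> L * norm (z - z')" if "z \<in> C" "z' \<in> C" for z z'
    using that M(1)[of "[]"] mult_right_mono[of "\<Sum>b\<in>Basis. M [b]" L "norm (z - z')"]
    by (smt (verit, best) L_def norm_ge_zero)
  have "norm (F z) \<le> L" if "z \<in> C" for z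
    using M(2)[OF that, of "[]"] L by (simp add: L_def)
  moreover have "0 \<le> L" using M(1)[of "[]"] L by (simp add: L_def)
  ultimately show ?thesis using lip by blast
qed

text \<open>Picard iteration on a prescribed interval, whose length works for all initial points and
  inputs within the bounds. \<open>P\<close> retracts onto the ball where the Lipschitz bound holds,
  and \<open>c\<close> clamps time to \<open>{0..s}\<close>, so that the iteration acts on bounded
  continuous functions on the whole line. The displacement bound shows afterwards that
  \<open>P\<close> leaves the fixed point unchanged on \<open>{0..s}\<close>.\<close>

lemma local_solution:
  fixes F :: "'s::euclidean_space \<times> 'p::euclidean_space \<Rightarrow> 's"
  assumes F: "analytic_fun F"
    and L: "0 \<le> L" "\<And>z. z \<in> cball 0 R \<times> cball 0 M \<Longrightarrow> norm (F z) \<le> L"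
      "\<And>z z'. z \<in> cball 0 R \<times> cball 0 M \<Longrightarrow> z' \<in> cball 0 R \<times> cball 0 M \<Longrightarrow> norm (F z - F z') \<le> L * norm (z - z')"
    and R: "0 < R" and s: "0 < s" "s * L \<le> 1 / 2" and x: "norm x + s * L \<le> R"
    and u: "continuous_on {0..s} u" "\<And>t. t \<in> {0..s} \<Longrightarrow> norm (u t) \<le> M"
  shows "\<exists>X. X 0 = x \<and> (\<forall>t\<in>{0..s}. solves_at F u s X t \<and>
    dist (X t) x \<le> s * L)"
proof -
  define P where "P = closest_point (cball (0::'s) R)"
  have cb: "convex (cball (0::'s) R)" "closed (cball (0::'s) R)" "cball (0::'s) R \<noteq> {}"
    using R by auto
  have P: "P y \<in> cball 0 R" "continuous_on UNIV P" "dist (P y) (P y') \<le> dist y y'" for y y'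
    unfolding P_def using closest_point_in_set[OF cb(2,3)] continuous_on_closest_point[OF cb]
      closest_point_lipschitz[OF cb] by auto
  have Fc: "continuous_on UNIV F"
    using isCont_iter_deriv[OF analytic_fun_smooth[OF F], where vs = "[]"] by (simp add: continuous_at_imp_continuous_on)
  define g where "g \<phi> r = F (P (\<phi> r), u r)" for \<phi> and r :: real
  have gc: "continuous_on {0..s} (g \<phi>)" if "continuous_on UNIV \<phi>" for \<phi>
    unfolding g_def
    by (intro continuous_on_compose2[OF Fc] continuous_on_Pair u continuous_on_compose2[OF P(2)]
        continuous_on_subset[OF that]) auto
  have gM: "norm (g \<phi> r) \<le> L" if "r \<in> {0..s}" for \<phi> r
    unfolding g_def using L(2)[of "(P (\<phi> r), u r)"] P(1) u(2)[OF that] by auto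
  define c where "c t = max 0 (min s t)" for t :: real
  have c: "continuous_on UNIV c" "c t \<in> {0..s}" for t
    unfolding c_def using s by (auto intro!: continuous_intros)
  define T where "T \<phi> t = x + integral {0..c t} (g \<phi>)" for \<phi> t
  have Tb: "T \<phi> \<in> bcontfun" if "continuous_on UNIV \<phi>" for \<phi>
  proof -
    have I: "continuous_on {0..s} (\<lambda>t. x + integral {0..t} (g \<phi>))"
      by (intro continuous_intros indefinite_integral_continuous_1 integrable_continuous_interval gc that)
    have e: "T \<phi> = (\<lambda>t. (\<lambda>t. x + integral {0..t} (g \<phi>)) (c t))" by (rule ext) (simp add: T_def)
    have "bounded ((\<lambda>t. x + integral {0..t} (g \<phi>)) ` {0..s})"
      by (intro compact_imp_bounded compact_continuous_image I) auto
    then have "bounded (range (T \<phi>))"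
      unfolding e by (rule bounded_subset) (use c in auto)
    moreover have "continuous_on UNIV (T \<phi>)"
      unfolding e by (rule continuous_on_compose2[OF I c(1)]) (use c in auto)
    ultimately show ?thesis by (simp add: bcontfun_def)
  qed
  have contr: "dist (T \<phi> t) (T \<psi> t) \<le> 1 / 2 * d"
    if \<phi>: "continuous_on UNIV \<phi>" and \<psi>: "continuous_on UNIV \<psi>" and d: "\<And>r. dist (\<phi> r) (\<psi> r) \<le> d" for \<phi> \<psi> t d
  proof -
    have d0: "0 \<le> d" using d[of 0] zero_le_dist order_trans by blast
    have sub: "{0..c t} \<subseteq> {0..s}" using c by auto
    have i: "g \<phi> integrable_on {0..c t}" "g \<psi> integrable_on {0..c t}"
      by (auto intro!: integrable_continuous_interval continuous_on_subset[OF gc sub] \<phi> \<psi>)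
    have "norm (integral {0..c t} (\<lambda>r. g \<phi> r - g \<psi> r)) \<le> (L * d) * (c t - 0)"
    proof (rule integral_bound)
      show "continuous_on {0..c t} (\<lambda>r. g \<phi> r - g \<psi> r)"
        by (intro continuous_on_diff continuous_on_subset[OF gc sub] \<phi> \<psi>)
      show "norm (g \<phi> r - g \<psi> r) \<le> L * d" if "r \<in> {0..c t}" for r
      proof -
        have r: "r \<in> {0..s}" using that sub by auto
        have "norm (g \<phi> r - g \<psi> r) \<le> L * norm ((P (\<phi> r), u r) - (P (\<psi> r), u r))"
          unfolding g_def by (rule L(3)) (use P(1) u(2)[OF r] in auto)
        also have "norm ((P (\<phi> r), u r) - (P (\<psi> r), u r)) = dist (P (\<phi> r)) (P (\<psi> r))"
          by (simp add: dist_norm norm_Pair)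
        also have "L * \<dots> \<le> L * d"
          by (intro mult_left_mono order_trans[OF P(3) d] L)
        finally show ?thesis .
      qed
    qed (use c in auto)
    also have "\<dots> \<le> (L * d) * s" using L d0 c(2)[of t] by (intro mult_left_mono) auto
    also have "\<dots> \<le> 1 / 2 * d" using mult_right_mono[OF s(2) d0] by (simp add: mult_ac)
    finally show ?thesis
      using i by (simp add: T_def dist_norm integral_diff)
  qed
  define TT where "TT \<phi> = Bcontfun (T (apply_bcontfun \<phi>))" for \<phi>
  have TT: "apply_bcontfun (TT \<phi>) = T (apply_bcontfun \<phi>)" for \<phi>
    unfolding TT_def by (rule Bcontfun_inverse[OF Tb]) auto
  have "\<exists>!\<phi>. TT \<phi> = \<phi>"
  proof (rule banach_fix_type)
    show "\<forall>\<phi> \<psi>. dist (TT \<phi>) (TT \<psi>) \<le> 1 / 2 * dist \<phi> \<psi>"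
      by (intro allI dist_bound) (unfold TT, intro contr dist_bounded, auto)
  qed auto
  then obtain \<phi> where "TT \<phi> = \<phi>" by blast
  then have fp: "apply_bcontfun \<phi> t = T (apply_bcontfun \<phi>) t" for t using TT by metis
  define X where "X = apply_bcontfun \<phi>"
  have Xc: "continuous_on UNIV X" unfolding X_def by auto
  have Xe: "X t = x + integral {0..t} (g X)" if "t \<in> {0..s}" for t
    using fp[of t] that unfolding X_def T_def c_def by auto
  have Xd: "dist (X t) x \<le> s * L" if t: "t \<in> {0..s}" for t
  proof -
    have "norm (integral {0..t} (g X)) \<le> L * (t - 0)"
      by (rule integral_bound) (use t gM continuous_on_subset[OF gc[OF Xc]] in auto)
    also have "\<dots> \<le> s * L" using mult_left_mono[of t s L] t L(1) by (simp add: mult.commute)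
    finally show ?thesis unfolding Xe[OF t] by (simp add: dist_norm)
  qed
  have PX: "P (X t) = X t" if t: "t \<in> {0..s}" for t
  proof -
    have "norm (X t) \<le> norm x + dist (X t) x" by (metis dist_norm norm_triangle_sub)
    then show ?thesis unfolding P_def using Xd[OF t] x by (intro closest_point_self) auto
  qed
  show ?thesis
  proof (intro exI[of _ X] conjI ballI)
    show "X 0 = x" using Xe[of 0] s by simp
    fix t assume t: "t \<in> {0..s}"
    show "dist (X t) x \<le> s * L" by (rule Xd[OF t])
    have "((\<lambda>t. x + integral {0..t} (g X)) has_vector_derivative 0 + g X t) (at t within {0..s})"
      by (intro has_vector_derivative_add has_vector_derivative_const integral_has_vector_derivative gc Xc t)
    from has_vector_derivative_transform[OF t Xe this]
    have "(X has_vector_derivative 0 + g X t) (at t within {0..s})" .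
    then show "solves_at F u s X t"
      by (simp add: g_def PX[OF t])
  qed
qed

text \<open>Makes the flow up to time \<open>s\<close> injective. The distance of the two curves
  vanishes at \<open>s\<close>, so its maximum is at most \<open>s * L \<le> 1/2\<close> times
  itself, hence zero.\<close>

lemma solutions_backward_unique:
  fixes F :: "'s::euclidean_space \<times> 'p::euclidean_space \<Rightarrow> 's"
  assumes L: "0 \<le> L"
      "\<And>z z'. z \<in> B \<times> B' \<Longrightarrow> z' \<in> B \<times> B' \<Longrightarrow> norm (F z - F z') \<le> L * norm (z - z')"
    and s: "0 < s" "s * L \<le> 1 / 2"
    and u: "\<And>t. t \<in> {0..s} \<Longrightarrow> u t \<in> B'"
    and X: "\<And>t. t \<in> {0..s} \<Longrightarrow> solves_at F u s X t"
      "\<And>t. t \<in> {0..s} \<Longrightarrow> X t \<in> B"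
    and Y: "\<And>t. t \<in> {0..s} \<Longrightarrow> solves_at F u s Y t"
      "\<And>t. t \<in> {0..s} \<Longrightarrow> Y t \<in> B"
    and eq: "X s = Y s"
  shows "X 0 = Y 0"
proof -
  let ?d = "\<lambda>t. norm (X t - Y t)"
  have der: "((\<lambda>t. X t - Y t) has_vector_derivative F (X t, u t) - F (Y t, u t)) (at t within {0..s})"
    if "t \<in> {0..s}" for t
    by (intro has_vector_derivative_diff X Y that)
  then have "continuous_on {0..s} (\<lambda>t. X t - Y t)"
    by (rule continuous_on_vector_derivative)
  then have "continuous_on {0..s} ?d" by (rule continuous_on_norm)
  then obtain m where m: "m \<in> {0..s}" "\<And>t. t \<in> {0..s} \<Longrightarrow> ?d t \<le> ?d m"
    using continuous_attains_sup[of "{0..s}" ?d] s by auto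
  have "norm ((X m - Y m) - (X s - Y s)) \<le> (L * ?d m) * norm (m - s)"
  proof (rule differentiable_bound[of "{0..s}" "\<lambda>t. X t - Y t" "\<lambda>t h. h *\<^sub>R (F (X t, u t) - F (Y t, u t))"])
    fix t assume t: "t \<in> {0..s}"
    show "((\<lambda>t. X t - Y t) has_derivative (\<lambda>h. h *\<^sub>R (F (X t, u t) - F (Y t, u t)))) (at t within {0..s})"
      using der[OF t] unfolding has_vector_derivative_def .
    have "norm (F (X t, u t) - F (Y t, u t)) \<le> L * norm ((X t, u t) - (Y t, u t))"
      by (rule L(2)) (use X(2) Y(2) u t in auto)
    also have "norm ((X t, u t) - (Y t, u t)) = ?d t" by (simp add: norm_Pair)
    also have "L * \<dots> \<le> L * ?d m" by (intro mult_left_mono m t L)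
    finally show "onorm (\<lambda>h. h *\<^sub>R (F (X t, u t) - F (Y t, u t))) \<le> L * ?d m"
      by (intro onorm_le) (simp add: mult.commute mult_left_mono)
  qed (use m s in auto)
  also have "\<dots> \<le> (L * ?d m) * s" using m L by (intro mult_left_mono) auto
  also have "\<dots> \<le> 1 / 2 * ?d m" using mult_right_mono[OF s(2), of "?d m"] by (simp add: mult_ac)
  finally have "?d m \<le> 0" using eq by simp
  then show ?thesis using m(2)[of 0] s by simp
qed

section \<open>Separation of jets under limits\<close>

text \<open>The set \<open>J\<close> of orders is a parameter so that all orders
  (\<open>UNIV\<close>) and finitely many (\<open>{..q}\<close>) share the limit arguments.\<close>

definition separated_jets ::
  "('a::real_normed_vector \<times> 'b::real_normed_vector \<Rightarrow> 'a) \<Rightarrow> ('a \<Rightarrow> 'c::real_normed_vector) \<Rightarrow>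
    nat set \<Rightarrow> (nat \<Rightarrow> 'b) \<Rightarrow> 'a set \<Rightarrow> bool" where
  "separated_jets f h J \<sigma> K \<longleftrightarrow>
     (\<forall>x\<in>K. \<forall>y\<in>K. x \<noteq> y \<longrightarrow> (\<exists>j\<in>J. output_jet f h j x \<sigma> \<noteq> output_jet f h j y \<sigma>)) \<and>
     (\<forall>x\<in>K. \<forall>v. v \<noteq> 0 \<longrightarrow> (\<exists>j\<in>J. output_jet_deriv f h j x \<sigma> v \<noteq> 0))"

abbreviation near :: "'a::metric_space set \<Rightarrow> real \<Rightarrow> 'a set" where
  "near K e \<equiv> {x. \<exists>p\<in>K. dist x p \<le> e}"

lemma not_eventually_subseq:
  assumes "\<not> eventually P sequentially"
  obtains r :: "nat \<Rightarrow> nat" where "strict_mono r" "\<And>n. \<not> P (r n)"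
proof -
  have "infinite {n. \<not> P n}"
    using assms by (simp add: eventually_cofinite flip: cofinite_eq_sequentially)
  from infinite_enumerate[OF this] show ?thesis using that by auto
qed

lemma tendsto_near_compact:
  fixes x p :: "nat \<Rightarrow> 'a::metric_space"
  assumes "(p \<longlongrightarrow> a) F" "\<And>n. dist (x n) (p n) \<le> e n" "(e \<longlongrightarrow> 0) F"
  shows "(x \<longlongrightarrow> a) F"
proof (rule metric_tendsto_imp_tendsto[where f = "\<lambda>n. e n + dist (p n) a" and a = 0])
  show "((\<lambda>n. e n + dist (p n) a) \<longlongrightarrow> 0) F"
    using tendsto_add[OF assms(3) tendsto_dist[OF assms(1) tendsto_const[of a]]] by simp
  have "dist (x n) a \<le> dist (e n + dist (p n) a) 0" for n
    using assms(2)[of n] dist_triangle[of "x n" a "p n"] zero_le_dist[of "p n" a] zero_le_dist[of "x n" "p n"]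
    by (simp add: dist_real_def)
  then show "\<forall>\<^sub>F n in F. dist (x n) a \<le> dist (e n + dist (p n) a) 0" by simp
qed

lemma subseq_limits:
  fixes x y p q w :: "nat \<Rightarrow> 'a::euclidean_space"
  assumes K: "compact K" and pq: "\<And>n. p n \<in> K" "\<And>n. q n \<in> K" and w: "\<And>n. w n \<in> sphere 0 1"
    and x: "\<And>n. dist (x n) (p n) \<le> e (r n)" and y: "\<And>n. dist (y n) (q n) \<le> e (r n)"
    and r: "strict_mono r" and e: "e \<longlonglongrightarrow> (0::real)"
  obtains r2 :: "nat \<Rightarrow> nat" and a a' b where "a \<in> K" "a' \<in> K" "b \<noteq> 0"
    "filterlim (\<lambda>n. r (r2 n)) sequentially sequentially"
    "(\<lambda>n. x (r2 n)) \<longlonglongrightarrow> a" "(\<lambda>n. y (r2 n)) \<longlonglongrightarrow> a'" "(\<lambda>n. w (r2 n)) \<longlonglongrightarrow> b"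
proof -
  have cp: "compact ((K \<times> K) \<times> sphere (0::'a) 1)" using K by (intro compact_Times) auto
  have pw: "\<forall>n. ((p n, q n), w n) \<in> (K \<times> K) \<times> sphere 0 1" using pq w by auto
  obtain l r2 where l: "l \<in> (K \<times> K) \<times> sphere 0 1" "strict_mono r2"
    "((\<lambda>n. ((p n, q n), w n)) \<circ> r2) \<longlonglongrightarrow> l"
    by (rule seq_compactE[OF compact_imp_seq_compact[OF cp] pw])
  obtain a a' b where ab: "l = ((a, a'), b)" by (metis surj_pair)
  have lim: "(\<lambda>n. p (r2 n)) \<longlonglongrightarrow> a" "(\<lambda>n. q (r2 n)) \<longlonglongrightarrow> a'" "(\<lambda>n. w (r2 n)) \<longlonglongrightarrow> b"
    using tendsto_fst[OF tendsto_fst[OF l(3)]] tendsto_snd[OF tendsto_fst[OF l(3)]] tendsto_snd[OF l(3)]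
    by (auto simp: ab o_def)
  have rr: "filterlim (\<lambda>n. r (r2 n)) sequentially sequentially"
    using filterlim_subseq[OF strict_mono_o[OF r l(2)]] by (simp add: o_def)
  have er: "(\<lambda>n. e (r (r2 n))) \<longlonglongrightarrow> 0" by (rule filterlim_compose[OF e rr])
  have aK: "a \<in> K" "a' \<in> K" "b \<noteq> 0" using l(1) ab by auto
  show thesis
    by (rule that[OF aK rr tendsto_near_compact[OF lim(1) _ er] tendsto_near_compact[OF lim(2) _ er] lim(3)])
      (use x y in auto)
qed

context
  fixes f :: "'a::euclidean_space \<times> 'p::euclidean_space \<Rightarrow> 'a" and h :: "'a \<Rightarrow> 'c::euclidean_space"
  assumes f: "analytic_fun f" and h: "analytic_fun h"
begin

lemma output_jet_deriv_linear: "linear (output_jet_deriv f h j x \<sigma>)"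
  using has_derivative_output_jet[OF f h] has_derivative_linear by blast

text \<open>The mean value theorem holds with equality only for real functions, so \<open>z\<close>
  is found for each vector \<open>c\<close> separately; when \<open>x\<close> and \<open>y\<close>
  have a common limit, all these points tend to it.\<close>

lemma output_jet_mean_value:
  assumes "output_jet f h j x \<sigma> = output_jet f h j y \<sigma>"
  shows "\<exists>z. dist z x \<le> dist y x \<and> output_jet_deriv f h j z \<sigma> (y - x) \<bullet> c = 0"
proof -
  define \<phi> where "\<phi> t = output_jet f h j (x + t *\<^sub>R (y - x)) \<sigma> \<bullet> c" for t :: real
  have "(\<phi> has_real_derivative output_jet_deriv f h j (x + t *\<^sub>R (y - x)) \<sigma> (y - x) \<bullet> c) (at t)" for t
  proof -
    have "((\<lambda>t. x + t *\<^sub>R (y - x)) has_derivative (\<lambda>s. s *\<^sub>R (y - x))) (at t)"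
      by (auto intro!: derivative_eq_intros)
    from bounded_linear.has_derivative[OF bounded_linear_inner_left[of c]
        has_derivative_compose[OF this has_derivative_output_jet[OF f h]]]
    have "(\<phi> has_derivative (\<lambda>s. output_jet_deriv f h j (x + t *\<^sub>R (y - x)) \<sigma> (s *\<^sub>R (y - x)) \<bullet> c)) (at t)"
      unfolding \<phi>_def .
    then show ?thesis
      unfolding linear_scale[OF output_jet_deriv_linear] has_field_derivative_def
      by (simp add: mult.commute[of _ "_ \<bullet> _"])
  qed
  from MVT2[OF zero_less_one this] obtain t where t: "0 < t" "t < 1"
    "\<phi> 1 - \<phi> 0 = (1 - 0) * (output_jet_deriv f h j (x + t *\<^sub>R (y - x)) \<sigma> (y - x) \<bullet> c)" by metis
  then have "output_jet_deriv f h j (x + t *\<^sub>R (y - x)) \<sigma> (y - x) \<bullet> c = 0"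
    using assms by (simp add: \<phi>_def)
  moreover have "dist (x + t *\<^sub>R (y - x)) x \<le> dist y x"
    using t by (simp add: dist_norm mult_left_le_one_le)
  ultimately show ?thesis by blast
qed

text \<open>By compactness: common unit kernel vectors of the differentials at points near
  \<open>K\<close> would accumulate at such a vector over \<open>K\<close>.\<close>

lemma separated_jets_immersion_limit:
  assumes K: "compact K" and sep: "separated_jets f h J \<sigma> K"
    and S: "\<And>i. (\<lambda>n. S n i) \<longlonglongrightarrow> \<sigma> i" and e: "e \<longlonglongrightarrow> 0"
    and Jn: "\<And>j. j \<in> J \<Longrightarrow> \<forall>\<^sub>F n in sequentially. j \<in> Jn n"
  shows "\<forall>\<^sub>F n in sequentially. \<forall>x. (\<exists>p\<in>K. dist x p \<le> e n) \<longrightarrow>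
    (\<forall>v. v \<noteq> 0 \<longrightarrow> (\<exists>j\<in>Jn n. output_jet_deriv f h j x (S n) v \<noteq> 0))"
proof (rule ccontr)
  assume "\<not> ?thesis"
  then obtain r :: "nat \<Rightarrow> nat" where r: "strict_mono r" "\<And>n. \<exists>x v. (\<exists>p\<in>K. dist x p \<le> e (r n)) \<and> v \<noteq> 0 \<and>
      (\<forall>j\<in>Jn (r n). output_jet_deriv f h j x (S (r n)) v = 0)"
    by (rule not_eventually_subseq) blast
  then obtain x v p where *: "\<And>n. p n \<in> K" "\<And>n. dist (x n) (p n) \<le> e (r n)" "\<And>n. v n \<noteq> 0"
    "\<And>n j. j \<in> Jn (r n) \<Longrightarrow> output_jet_deriv f h j (x n) (S (r n)) (v n) = 0" by metis
  define w where "w n = v n /\<^sub>R norm (v n)" for n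
  have w: "w n \<in> sphere 0 1" for n using *(3) by (simp add: w_def)
  have w0: "output_jet_deriv f h j (x n) (S (r n)) (w n) = 0" if "j \<in> Jn (r n)" for n j
    unfolding w_def linear_scale[OF output_jet_deriv_linear] *(4)[OF that] by simp
  obtain r2 a b where aK: "a \<in> K" "b \<noteq> 0" and rr: "filterlim (\<lambda>n. r (r2 n)) sequentially sequentially"
    and lim: "(\<lambda>n. x (r2 n)) \<longlonglongrightarrow> a" "(\<lambda>n. w (r2 n)) \<longlonglongrightarrow> b"
    by (rule subseq_limits[OF K *(1) *(1) w *(2) *(2) r(1) e])
  have "output_jet_deriv f h j a \<sigma> b = 0" if j: "j \<in> J" for j
  proof -
    have 1: "(\<lambda>n. output_jet_deriv f h j (x (r2 n)) (S (r (r2 n))) (w (r2 n))) \<longlonglongrightarrow> output_jet_deriv f h j a \<sigma> b"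
      by (intro output_jet_deriv_tendsto[OF f h] lim filterlim_compose[OF S rr])
    have "\<forall>\<^sub>F n in sequentially. j \<in> Jn (r (r2 n))"
      using rr Jn[OF j] by (rule filterlim_iff[THEN iffD1, rule_format])
    then have "\<forall>\<^sub>F n in sequentially. output_jet_deriv f h j (x (r2 n)) (S (r (r2 n))) (w (r2 n)) = 0"
      by (rule eventually_mono) (use w0 in auto)
    then have "(\<lambda>n. output_jet_deriv f h j (x (r2 n)) (S (r (r2 n))) (w (r2 n))) \<longlonglongrightarrow> 0"
      by (rule tendsto_eventually)
    from LIMSEQ_unique[OF 1 this] show ?thesis .
  qed
  then show False using sep aK unfolding separated_jets_def by blast
qed

text \<open>Pairs with equal jets accumulate at a pair in \<open>K\<close>. If its points differ,
  continuity contradicts the separation; if they coincide, the normalized differences tend to a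
  common kernel vector of the differentials. So injectivity near the diagonal rests on the
  immersion.\<close>

lemma separated_jets_injective_limit:
  assumes K: "compact K" and sep: "separated_jets f h J \<sigma> K"
    and S: "\<And>i. (\<lambda>n. S n i) \<longlonglongrightarrow> \<sigma> i" and e: "e \<longlonglongrightarrow> 0"
    and Jn: "\<And>j. j \<in> J \<Longrightarrow> \<forall>\<^sub>F n in sequentially. j \<in> Jn n"
  shows "\<forall>\<^sub>F n in sequentially. \<forall>x y. (\<exists>p\<in>K. dist x p \<le> e n) \<longrightarrow> (\<exists>p\<in>K. dist y p \<le> e n) \<longrightarrow>
    x \<noteq> y \<longrightarrow> (\<exists>j\<in>Jn n. output_jet f h j x (S n) \<noteq> output_jet f h j y (S n))"
proof (rule ccontr)
  assume "\<not> ?thesis"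
  then obtain r :: "nat \<Rightarrow> nat" where r: "strict_mono r" "\<And>n. \<exists>x y. (\<exists>p\<in>K. dist x p \<le> e (r n)) \<and> (\<exists>p\<in>K. dist y p \<le> e (r n)) \<and>
      x \<noteq> y \<and> (\<forall>j\<in>Jn (r n). output_jet f h j x (S (r n)) = output_jet f h j y (S (r n)))"
    by (rule not_eventually_subseq) blast
  then obtain x y p q where *: "\<And>n. p n \<in> K" "\<And>n. dist (x n) (p n) \<le> e (r n)"
    "\<And>n. q n \<in> K" "\<And>n. dist (y n) (q n) \<le> e (r n)" "\<And>n. x n \<noteq> y n"
    "\<And>n j. j \<in> Jn (r n) \<Longrightarrow> output_jet f h j (x n) (S (r n)) = output_jet f h j (y n) (S (r n))" by metis
  define w where "w n = (y n - x n) /\<^sub>R norm (y n - x n)" for n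
  have w: "w n \<in> sphere 0 1" for n using *(5)[of n] by (simp add: w_def)
  obtain r2 a a' b where aK: "a \<in> K" "a' \<in> K" "b \<noteq> 0" and rr: "filterlim (\<lambda>n. r (r2 n)) sequentially sequentially"
    and xl: "(\<lambda>n. x (r2 n)) \<longlonglongrightarrow> a" and yl: "(\<lambda>n. y (r2 n)) \<longlonglongrightarrow> a'" and wl: "(\<lambda>n. w (r2 n)) \<longlonglongrightarrow> b"
    by (rule subseq_limits[OF K *(1,3) w *(2,4) r(1) e])
  have ev: "\<forall>\<^sub>F n in sequentially. j \<in> Jn (r (r2 n))" if "j \<in> J" for j
    using rr Jn[OF that] by (rule filterlim_iff[THEN iffD1, rule_format])
  show False
  proof (cases "a = a'")
    case False
    then obtain j where j: "j \<in> J" "output_jet f h j a \<sigma> \<noteq> output_jet f h j a' \<sigma>"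
      using sep aK unfolding separated_jets_def by blast
    have 1: "(\<lambda>n. output_jet f h j (x (r2 n)) (S (r (r2 n)))) \<longlonglongrightarrow> output_jet f h j a \<sigma>"
      by (intro output_jet_tendsto[OF f h] xl filterlim_compose[OF S rr])
    have 2: "(\<lambda>n. output_jet f h j (y (r2 n)) (S (r (r2 n)))) \<longlonglongrightarrow> output_jet f h j a' \<sigma>"
      by (intro output_jet_tendsto[OF f h] yl filterlim_compose[OF S rr])
    have "\<forall>\<^sub>F n in sequentially. output_jet f h j (x (r2 n)) (S (r (r2 n))) = output_jet f h j (y (r2 n)) (S (r (r2 n)))"
      by (rule eventually_mono[OF ev[OF j(1)]]) (use *(6) in auto)
    then have "(\<lambda>n. output_jet f h j (x (r2 n)) (S (r (r2 n)))) \<longlonglongrightarrow> output_jet f h j a' \<sigma>"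
      using 2 by (simp only: tendsto_cong)
    with 1 j(2) show False using LIMSEQ_unique by blast
  next
    case True
    have "output_jet_deriv f h j a \<sigma> b = 0" if j: "j \<in> J" for j
    proof (rule euclidean_eqI)
      fix c :: 'c
      have "\<exists>z. dist z (x n) \<le> dist (y n) (x n) \<and> (j \<in> Jn (r n) \<longrightarrow> output_jet_deriv f h j z (S (r n)) (w n) \<bullet> c = 0)" for n
      proof (cases "j \<in> Jn (r n)")
        case True
        from output_jet_mean_value[OF *(6)[OF this], of c] show ?thesis
          unfolding w_def linear_scale[OF output_jet_deriv_linear] by auto
      qed auto
      then obtain z where z: "\<And>n. dist (z n) (x n) \<le> dist (y n) (x n)"
        "\<And>n. j \<in> Jn (r n) \<Longrightarrow> output_jet_deriv f h j (z n) (S (r n)) (w n) \<bullet> c = 0" by metis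
      have "(\<lambda>n. dist (y (r2 n)) (x (r2 n))) \<longlonglongrightarrow> 0"
        using tendsto_dist[OF yl xl] True by simp
      then have zl: "(\<lambda>n. z (r2 n)) \<longlonglongrightarrow> a"
        by (rule tendsto_near_compact[OF xl, rotated]) (use z(1) in auto)
      have 1: "(\<lambda>n. output_jet_deriv f h j (z (r2 n)) (S (r (r2 n))) (w (r2 n)) \<bullet> c) \<longlonglongrightarrow> output_jet_deriv f h j a \<sigma> b \<bullet> c"
        by (intro tendsto_inner output_jet_deriv_tendsto[OF f h] zl wl filterlim_compose[OF S rr] tendsto_const)
      have "\<forall>\<^sub>F n in sequentially. output_jet_deriv f h j (z (r2 n)) (S (r (r2 n))) (w (r2 n)) \<bullet> c = 0"
        by (rule eventually_mono[OF ev[OF j]]) (use z(2) in auto)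
      then have "(\<lambda>n. output_jet_deriv f h j (z (r2 n)) (S (r (r2 n))) (w (r2 n)) \<bullet> c) \<longlonglongrightarrow> 0"
        by (rule tendsto_eventually)
      with 1 show "output_jet_deriv f h j a \<sigma> b \<bullet> c = 0 \<bullet> c" using LIMSEQ_unique by fastforce
    qed
    then show False using sep aK unfolding separated_jets_def by blast
  qed
qed

text \<open>One compactness statement for three uses: truncation to finitely many orders
  (\<open>Jn n = {..n}\<close>), thickening of \<open>K\<close> (\<open>e\<close> tending to zero)
  and perturbation of the jet (\<open>S n\<close> tending to \<open>\<sigma>\<close>).\<close>

lemma separated_jets_limit:
  assumes K: "compact K" and sep: "separated_jets f h J \<sigma> K"
    and S: "\<And>i. (\<lambda>n. S n i) \<longlonglongrightarrow> \<sigma> i" and e: "e \<longlonglongrightarrow> 0"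
    and Jn: "\<And>j. j \<in> J \<Longrightarrow> \<forall>\<^sub>F n in sequentially. j \<in> Jn n"
  shows "\<forall>\<^sub>F n in sequentially. separated_jets f h (Jn n) (S n) (near K (e n))"
  by (rule eventually_mono[OF eventually_conj[OF separated_jets_immersion_limit[OF assms]
        separated_jets_injective_limit[OF assms]]]) (auto simp: separated_jets_def)

text \<open>The bound is \<open>i < q\<close>, not \<open>i \<le> q\<close>, since a jet of order
  \<open>q\<close> involves only \<open>\<sigma> 0\<close> to
  \<open>\<sigma> (q - 1)\<close>.\<close>

lemma separated_jets_cong:
  assumes "\<And>i. i < q \<Longrightarrow> \<sigma> i = \<sigma>' i"
  shows "separated_jets f h {..q} \<sigma> K \<longleftrightarrow> separated_jets f h {..q} \<sigma>' K"
proof -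
  have "output_jet f h j x \<sigma> = output_jet f h j x \<sigma>'" if "j \<le> q" for j x
    using assms that by (intro output_jet_cong) auto
  then show ?thesis unfolding separated_jets_def output_jet_deriv_def by auto
qed

lemma separated_jets_finite:
  assumes "compact K" "separated_jets f h UNIV \<sigma> K"
  shows "\<exists>q. separated_jets f h {..q} \<sigma> K"
proof -
  have "\<forall>\<^sub>F n in sequentially. separated_jets f h {..n} \<sigma> (near K ((\<lambda>_. 0) n))"
    by (rule separated_jets_limit[OF assms]) (auto simp: eventually_ge_at_top)
  then show ?thesis by (auto simp: eventually_sequentially)
qed

lemma separated_jets_neighbourhood:
  assumes K: "compact K" and sep: "separated_jets f h {..q} \<sigma> K"
  shows "\<exists>\<epsilon>>0. separated_jets f h {..q} \<sigma> (near K \<epsilon>)"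
proof -
  have "\<forall>\<^sub>F n in sequentially. separated_jets f h {..q} \<sigma> (near K (inverse (real (Suc n))))"
    by (rule separated_jets_limit[OF assms _ LIMSEQ_inverse_real_of_nat]) auto
  then obtain n where "separated_jets f h {..q} \<sigma> (near K (inverse (real (Suc n))))"
    using eventually_happens' sequentially_bot by blast
  then show ?thesis by (intro exI[of _ "inverse (real (Suc n))"]) auto
qed

end

text \<open>If every \<open>n\<close> failed both as an order and, through
  \<open>1 / (n + 1)\<close>, as a tolerance, the failing matrices would accumulate at some
  \<open>B\<close> in \<open>\<A>\<close>; the separation for \<open>B\<close> with all orders would
  pass to late terms of the sequence.\<close>

lemma separated_jets_uniform:
  fixes f :: "'a::euclidean_space \<times> (real^'p) \<Rightarrow> 'a" and h :: "'a \<Rightarrow> 'c::euclidean_space"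
  assumes f: "analytic_fun f" and h: "analytic_fun h" and K: "compact K"
    and \<A>: "compact (\<A> :: (real^'p^'p) set)"
    and sep: "\<And>A. A \<in> \<A> \<Longrightarrow> separated_jets f h UNIV (\<lambda>i. A *v \<sigma> i) K"
  shows "\<exists>q \<epsilon>. 0 < \<epsilon> \<and> (\<forall>\<sigma>'. (\<forall>i<q. dist (\<sigma>' i) (\<sigma> i) < \<epsilon>) \<longrightarrow>
    (\<forall>A\<in>\<A>. separated_jets f h {..q} (\<lambda>i. A *v \<sigma>' i) K))"
proof (rule ccontr)
  assume neg: "\<not> ?thesis"
  have "\<exists>\<sigma>' A. A \<in> \<A> \<and> (\<forall>i<n. dist (\<sigma>' i) (\<sigma> i) < inverse (real (Suc n))) \<and>
      \<not> separated_jets f h {..n} (\<lambda>i. A *v \<sigma>' i) K" for n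
  proof -
    have "0 < inverse (real (Suc n))" by simp
    with neg show ?thesis by blast
  qed
  then obtain S A where SA: "\<And>n. A n \<in> \<A>" "\<And>n i. i < n \<Longrightarrow> dist (S n i) (\<sigma> i) < inverse (real (Suc n))"
    "\<And>n. \<not> separated_jets f h {..n} (\<lambda>i. A n *v S n i) K" by metis
  obtain B r where B: "B \<in> \<A>" "strict_mono r" "(A \<circ> r) \<longlonglongrightarrow> B"
    by (rule seq_compactE[OF compact_imp_seq_compact[OF \<A>]]) (use SA(1) in auto)
  have rr: "filterlim r sequentially sequentially" by (rule filterlim_subseq[OF B(2)])
  have "(\<lambda>n. S n i) \<longlonglongrightarrow> \<sigma> i" for i
  proof (rule metric_tendsto_imp_tendsto[OF LIMSEQ_inverse_real_of_nat])
    show "\<forall>\<^sub>F n in sequentially. dist (S n i) (\<sigma> i) \<le> dist (inverse (real (Suc n))) 0"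
      using eventually_gt_at_top[of i]
    proof eventually_elim
      case (elim n)
      then show ?case using SA(2)[OF elim] by (simp add: dist_real_def)
    qed
  qed
  then have Sr: "(\<lambda>n. S (r n) i) \<longlonglongrightarrow> \<sigma> i" for i using filterlim_compose[OF _ rr] by blast
  have "(\<lambda>n. A (r n) *v S (r n) i) \<longlonglongrightarrow> B *v \<sigma> i" for i
    unfolding matrix_vector_mult_def using B(3) Sr[of i]
    by (intro vec_tendstoI) (auto intro!: tendsto_intros simp: o_def)
  from separated_jets_limit[OF f h K sep[OF B(1)] this tendsto_const[of 0], where Jn = "\<lambda>n. {..r n}"]
  have "\<forall>\<^sub>F n in sequentially. separated_jets f h {..r n} (\<lambda>i. A (r n) *v S (r n) i) (near K 0)"
    using filterlim_at_top[THEN iffD1, OF rr] by auto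
  then show False
    using SA(3) by (auto simp: eventually_sequentially)
qed

section \<open>Extending a jet of the input\<close>

text \<open>The factor \<open>(1 - (t / T) ^ (q + 1)) ^ N\<close> does not change the \<open>q\<close>-jet at \<open>0\<close> and has a zero
  of order \<open>N\<close> at \<open>T\<close>.\<close>

definition jet_poly :: "(nat \<Rightarrow> real) \<Rightarrow> nat \<Rightarrow> real \<Rightarrow> nat \<Rightarrow> real poly" where
  "jet_poly a q T N =
     (\<Sum>i\<le>q. smult (a i / fact i) (monom 1 i * (1 - monom (1 / T ^ Suc q) (Suc q)) ^ N))"

lemma poly_jet_poly:
  "poly (jet_poly a q T N) t = (\<Sum>i\<le>q. a i / fact i * (t ^ i * (1 - (t / T) ^ Suc q) ^ N))"
  by (simp add: jet_poly_def poly_sum poly_monom power_divide)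

lemma one_minus_monom_power:
  "\<exists>r. (1 - monom (c::real) n) ^ N = 1 + monom 1 n * r"
proof (induction N)
  case 0
  show ?case by (intro exI[of _ 0]) simp
next
  case (Suc N)
  then obtain r where r: "(1 - monom c n) ^ N = 1 + monom 1 n * r" by blast
  have "monom c n = monom 1 n * [:c:]" by (simp add: smult_monom)
  then have "(1 - monom c n) ^ Suc N = 1 + monom 1 n * (r - [:c:] * (1 + monom 1 n * r))"
    unfolding power_Suc r by (simp only: ring_distribs)
  then show ?case by blast
qed

lemma coeff_jet_poly:
  assumes "j \<le> q" shows "coeff (jet_poly a q T N) j = a j / fact j"
proof -
  obtain r where r: "(1 - monom (1 / T ^ Suc q) (Suc q)) ^ N = 1 + monom 1 (Suc q) * r"
    using one_minus_monom_power by blast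
  have c: "coeff (monom 1 i * (1 + monom 1 (Suc q) * r)) j = (if i = j then 1 else 0)" for i
  proof -
    have "monom 1 i * (1 + monom 1 (Suc q) * r) = monom 1 i + monom 1 (Suc q) * (monom 1 i * r)"
      by (simp only: ring_distribs mult_1_right mult.left_commute)
    then show ?thesis using assms by (simp add: coeff_monom_mult)
  qed
  show ?thesis
    unfolding jet_poly_def r coeff_sum coeff_smult c using assms by (simp add: if_distrib cong: if_cong)
qed

lemma coeff_higher_pderiv:
  fixes p :: "real poly"
  shows "coeff ((pderiv ^^ j) p) n = fact (n + j) / fact n * coeff p (n + j)"
proof (induction j arbitrary: n)
  case (Suc j)
  have "coeff ((pderiv ^^ Suc j) p) n = real (Suc n) * (fact (Suc n + j) / fact (Suc n) * coeff p (Suc n + j))"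
    by (simp only: funpow.simps o_apply coeff_pderiv Suc)
  also have "real (Suc n) * (fact (Suc n + j) / fact (Suc n) * coeff p (Suc n + j)) = fact (n + Suc j) / fact n * coeff p (n + Suc j)"
    by (simp del: of_nat_Suc add: fact_Suc[of n])
  finally show ?case .
qed simp

lemma poly_higher_pderiv_0: "poly ((pderiv ^^ j) p) 0 = fact j * coeff (p :: real poly) j"
  by (simp add: poly_0_coeff_0 coeff_higher_pderiv)

lemma higher_pderiv_jet_poly_0:
  "j \<le> q \<Longrightarrow> poly ((pderiv ^^ j) (jet_poly a q T N)) 0 = a j"
  by (simp add: poly_higher_pderiv_0 coeff_jet_poly)

lemma power_dvd_pderiv:
  fixes p :: "real poly"
  assumes "[:-a, 1:] ^ Suc n dvd p"
  shows "[:-a, 1:] ^ n dvd pderiv p"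
proof -
  obtain r where "p = [:-a, 1:] ^ Suc n * r" using assms by (elim dvdE)
  then have "pderiv p = [:-a, 1:] ^ n * ([:-a, 1:] * pderiv r + smult (real (Suc n)) (r * pderiv [:-a, 1:]))"
    by (simp only: pderiv_mult pderiv_power_Suc) (simp add: algebra_simps)
  then show ?thesis by simp
qed

lemma higher_pderiv_root:
  fixes p :: "real poly"
  assumes "[:-a, 1:] ^ N dvd p" "i < N"
  shows "poly ((pderiv ^^ i) p) a = 0"
proof -
  have "[:-a, 1:] ^ (N - i) dvd (pderiv ^^ i) p"
    using assms(2)
  proof (induction i)
    case (Suc i)
    then have "[:-a, 1:] ^ Suc (N - Suc i) dvd (pderiv ^^ i) p" by (simp add: Suc_diff_Suc)
    from power_dvd_pderiv[OF this] show ?case by simp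
  qed (use assms in simp)
  then have "[:-a, 1:] dvd (pderiv ^^ i) p"
    using assms(2) by (meson dvd_power dvd_trans zero_less_diff)
  then show ?thesis by (simp add: poly_eq_0_iff_dvd)
qed

lemma higher_pderiv_jet_poly_end:
  assumes "0 < T" "i < N"
  shows "poly ((pderiv ^^ i) (jet_poly a q T N)) T = 0"
proof (rule higher_pderiv_root[OF _ assms(2)])
  have "poly (1 - monom (1 / T ^ Suc q) (Suc q)) T = 0"
    using assms by (simp add: poly_monom del: power_Suc)
  then have "[:-T, 1:] dvd 1 - monom (1 / T ^ Suc q) (Suc q)" by (simp only: poly_eq_0_iff_dvd)
  then have "[:-T, 1:] ^ N dvd (1 - monom (1 / T ^ Suc q) (Suc q)) ^ N" by (rule dvd_power_same)
  then show "[:-T, 1:] ^ N dvd jet_poly a q T N"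
    unfolding jet_poly_def by (intro dvd_sum dvd_smult dvd_mult)
qed

text \<open>The bound involves neither \<open>T\<close> nor \<open>N\<close>, so that the interval
  can be chosen after it; \<open>T \<le> 1\<close> removes the powers of \<open>t\<close>.\<close>

lemma abs_jet_poly_le:
  assumes "0 < T" "T \<le> 1" "t \<in> {0..T}"
  shows "\<bar>poly (jet_poly a q T N) t\<bar> \<le> (\<Sum>i\<le>q. \<bar>a i\<bar>)"
  unfolding poly_jet_poly
proof (rule order_trans[OF sum_abs sum_mono])
  fix i
  have q: "(t / T) ^ Suc q \<le> 1" "0 \<le> (t / T) ^ Suc q" using assms by (auto intro!: power_le_one simp del: power_Suc)
  have 1: "\<bar>t ^ i * (1 - (t / T) ^ Suc q) ^ N\<bar> \<le> 1 * 1"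
    unfolding abs_mult using assms q
    by (intro mult_mono) (auto simp: power_abs power_le_one simp del: power_Suc)
  have "\<bar>a i / fact i\<bar> = \<bar>a i\<bar> / fact i" by simp
  also have "\<dots> \<le> \<bar>a i\<bar> / 1" by (intro divide_left_mono) auto
  finally have "\<bar>a i / fact i\<bar> \<le> \<bar>a i\<bar> / 1" .
  from mult_mono[OF this 1] show "\<bar>a i / fact i * (t ^ i * (1 - (t / T) ^ Suc q) ^ N)\<bar> \<le> \<bar>a i\<bar>"
    by (simp add: abs_mult)
qed

text \<open>The order \<open>j\<close> of the derivative is built in, so that
  \<open>vec_poly V\<close> is directly the tower of derivatives of one input.\<close>

definition vec_poly :: "('b::euclidean_space \<Rightarrow> real poly) \<Rightarrow> nat \<Rightarrow> real \<Rightarrow> 'b" where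
  "vec_poly V j t = (\<Sum>b\<in>Basis. poly ((pderiv ^^ j) (V b)) t *\<^sub>R b)"

lemma has_vector_derivative_vec_poly:
  "(vec_poly V j has_vector_derivative vec_poly V (Suc j) t) (at t)"
  unfolding vec_poly_def
  by (intro has_vector_derivative_sum)
    (auto intro!: has_vector_derivative_scaleR[THEN has_vector_derivative_eq_rhs] poly_DERIV)

lemma analytic_fun_poly: "analytic_fun (poly (p :: real poly))"
proof (induction p)
  case 0
  have "poly (0 :: real poly) = (\<lambda>_. 0)" by auto
  then show ?case by simp
next
  case (pCons a p)
  have "poly (pCons a p) = (\<lambda>x. a + x *\<^sub>R poly p x)" by auto
  then show ?case
    using analytic_fun_add[OF analytic_fun_const analytic_fun_scaleR[OF analytic_fun_bounded_linear[OF bounded_linear_ident] pCons.IH]]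
    by simp
qed

lemma analytic_fun_vec_poly: "analytic_fun (vec_poly V j)"
  unfolding vec_poly_def[abs_def]
  by (intro analytic_fun_sum analytic_fun_scaleR analytic_fun_poly analytic_fun_const)

lemma vec_poly_inner: "b \<in> Basis \<Longrightarrow> vec_poly V j t \<bullet> b = poly ((pderiv ^^ j) (V b)) t"
  unfolding vec_poly_def by (rule inner_sum_left_Basis)

lemma vec_poly_eqI:
  assumes "\<And>b. b \<in> Basis \<Longrightarrow> poly ((pderiv ^^ j) (V b)) t = x \<bullet> b"
  shows "vec_poly V j t = x"
  by (rule euclidean_eqI) (simp add: vec_poly_inner assms)

lemma tangent_field_zero:
  assumes "smooth_fun f" shows "tangent_field f ((x, 0), u) = (f (x, u), 0)"
  using linear_simps(3)[OF iter_deriv_linear[OF assms]]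
  by (simp add: tangent_field_def zero_prod_def del: iter_deriv.simps)

text \<open>An input with the prescribed \<open>m\<close>-jet at time \<open>0\<close> and vanishing jet at a small time \<open>s\<close>
  transports the separation of the jets of order \<open>k\<close> for the null input back from \<open>s\<close> to \<open>0\<close>.\<close>

lemma separating_jet_extension:
  fixes f :: "'a::euclidean_space \<times> 'p::euclidean_space \<Rightarrow> 'a" and h :: "'a \<Rightarrow> 'c::euclidean_space"
    and \<sigma>0 :: "nat \<Rightarrow> 'p"
  assumes f: "analytic_fun f" and h: "analytic_fun h" and K: "compact K"
    and sep: "separated_jets f h {..k} (\<lambda>_. 0) K"
  shows "\<exists>\<sigma>. (\<forall>i\<le>m. \<sigma> i = \<sigma>0 i) \<and>
    (\<forall>A. linear A \<longrightarrow> (\<forall>v. norm (A v) \<le> norm v) \<longrightarrow> separated_jets f h UNIV (\<lambda>i. A (\<sigma> i)) K)"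
proof -
  obtain \<epsilon> where \<epsilon>: "0 < \<epsilon>" "separated_jets f h {..k} (\<lambda>_. 0) (near K \<epsilon>)"
    using separated_jets_neighbourhood[OF f h K sep] by blast
  obtain R1 where R1: "0 < R1" "\<And>x. x \<in> K \<Longrightarrow> norm x \<le> R1"
    using compact_imp_bounded[OF K] unfolding bounded_pos by blast
  \<comment> \<open>Base points contribute \<open>R1\<close>, the unit tangent vector at most 1, and
    the displacement up to time \<open>s\<close> at most \<open>s * L \<le> 1/2\<close>.\<close>
  define R where "R = R1 + 2"
  \<comment> \<open>Bounds the input for every \<open>s \<le> 1\<close>, so that \<open>M\<close>,
    and with it the Lipschitz constants, can be fixed before \<open>s\<close>.\<close>
  define M where "M = (\<Sum>b\<in>(Basis::'p set). \<Sum>i\<le>m. \<bar>\<sigma>0 i \<bullet> b\<bar>)"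
  note ft = analytic_fun_tangent_field[OF f]
  obtain L1 where L1: "0 \<le> L1" "\<And>z. z \<in> cball 0 R \<times> cball 0 M \<Longrightarrow> norm (f z) \<le> L1"
      "\<And>z z'. z \<in> cball 0 R \<times> cball 0 M \<Longrightarrow> z' \<in> cball 0 R \<times> cball 0 M \<Longrightarrow> norm (f z - f z') \<le> L1 * norm (z - z')"
    using analytic_fun_lipschitz_on_compact[OF f compact_Times[OF compact_cball compact_cball]
        convex_Times[OF convex_cball convex_cball]] by metis
  obtain L2 where L2: "0 \<le> L2" "\<And>z. z \<in> cball 0 R \<times> cball 0 M \<Longrightarrow> norm (tangent_field f z) \<le> L2"
      "\<And>z z'. z \<in> cball 0 R \<times> cball 0 M \<Longrightarrow> z' \<in> cball 0 R \<times> cball 0 M \<Longrightarrow>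
        norm (tangent_field f z - tangent_field f z') \<le> L2 * norm (z - z')"
    using analytic_fun_lipschitz_on_compact[OF ft compact_Times[OF compact_cball compact_cball]
        convex_Times[OF convex_cball convex_cball]] by metis
  define L where "L = L1 + L2 + 1"
  \<comment> \<open>Three demands: \<open>s \<le> 1\<close> for the bound \<open>M\<close>,
    \<open>s * L \<le> 1/2\<close> for existence and injectivity of the flow, and
    \<open>s * L \<le> \<epsilon>\<close> to stay where the null jets separate.\<close>
  define s where "s = min 1 (min (1/2) \<epsilon> / L)"
  have Lpos: "1 \<le> L" "L1 \<le> L" "L2 \<le> L" using L1(1) L2(1) by (auto simp: L_def)
  have s: "0 < s" "s \<le> 1" using \<epsilon> Lpos by (auto simp: s_def)
  have sL: "s * L \<le> 1/2" "s * L \<le> \<epsilon>"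
  proof -
    have "s * L \<le> min (1/2) \<epsilon> / L * L" using Lpos by (intro mult_right_mono) (auto simp: s_def)
    then show "s * L \<le> 1/2" "s * L \<le> \<epsilon>" using Lpos by auto
  qed
  have sLi: "s * L1 \<le> s * L" "s * L2 \<le> s * L" using s Lpos by (auto intro!: mult_left_mono)
  \<comment> \<open>\<open>Suc k\<close> gives a zero of order \<open>k + 1\<close> at
    \<open>s\<close>, which kills the derivatives of orders \<open>0\<close> to
    \<open>k\<close>.\<close>
  define V where "V b = jet_poly (\<lambda>i. \<sigma>0 i \<bullet> b) m s (Suc k)" for b :: 'p
  define \<sigma> where "\<sigma> i = vec_poly V i 0" for i
  have \<sigma>0: "\<sigma> i = \<sigma>0 i" if "i \<le> m" for i
    unfolding \<sigma>_def by (rule vec_poly_eqI) (simp add: V_def higher_pderiv_jet_poly_0 that)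
  have Vs: "vec_poly V i s = 0" if "i \<le> k" for i
    by (rule vec_poly_eqI) (use that s in \<open>simp add: V_def higher_pderiv_jet_poly_end\<close>)
  have VM: "norm (vec_poly V 0 t) \<le> M" if "t \<in> {0..s}" for t
  proof -
    have "norm (vec_poly V 0 t) \<le> (\<Sum>b\<in>Basis. \<bar>vec_poly V 0 t \<bullet> b\<bar>)" by (rule norm_le_l1)
    also have "\<dots> \<le> M" unfolding M_def
      by (rule sum_mono) (use abs_jet_poly_le[OF s that] in \<open>simp add: vec_poly_inner V_def\<close>)
    finally show ?thesis .
  qed
  have "separated_jets f h UNIV (\<lambda>i. A (\<sigma> i)) K" if A: "linear A" "\<And>v. norm (A v) \<le> norm v" for A :: "'p \<Rightarrow> 'p"
  proof -
    have bA: "bounded_linear A" using A(1) by (simp add: linear_conv_bounded_linear)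
    define U where "U i t = A (vec_poly V i t)" for i t
    have U: "(U i has_vector_derivative U (Suc i) t) (at t)" for i t
      unfolding U_def by (rule bounded_linear.has_vector_derivative[OF bA has_vector_derivative_vec_poly])
    have U1: "analytic_fun (U 1)"
      unfolding U_def[abs_def] by (rule analytic_fun_linear_image[OF analytic_fun_vec_poly bA])
    have U0: "(\<lambda>i. U i 0) = (\<lambda>i. A (\<sigma> i))" by (simp add: U_def \<sigma>_def)
    have UM: "norm (U 0 t) \<le> M" if "t \<in> {0..s}" for t
      using order_trans[OF A(2) VM[OF that]] by (simp add: U_def)
    have Uc: "continuous_on {0..s} (U 0)"
      using has_vector_derivative_at_within[OF U[of 0]] by (rule continuous_on_vector_derivative)
    have Us: "separated_jets f h {..k} (\<lambda>i. U i s) (near K \<epsilon>)"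
      using \<epsilon>(2) separated_jets_cong[OF f h, of k "\<lambda>i. U i s" "\<lambda>_. 0"] linear_0[OF A(1)]
      by (simp add: U_def Vs)
    show ?thesis
      unfolding separated_jets_def
    proof (intro conjI ballI allI impI)
      fix x y assume xy: "x \<in> K" "y \<in> K" "x \<noteq> y"
      have ex: "\<exists>X. X 0 = x \<and> (\<forall>t\<in>{0..s}. solves_at f (U 0) s X t \<and>
          dist (X t) x \<le> s * L1)" if "x \<in> K" for x
        by (rule local_solution[OF f L1 _ s(1) _ _ Uc UM]) (use R1 sL sLi that R_def in \<open>force+\<close>)
      obtain X where X: "X 0 = x" "\<And>t. t \<in> {0..s} \<Longrightarrow> solves_at f (U 0) s X t"
        "\<And>t. t \<in> {0..s} \<Longrightarrow> dist (X t) x \<le> s * L1" using ex[OF xy(1)] by blast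
      obtain Y where Y: "Y 0 = y" "\<And>t. t \<in> {0..s} \<Longrightarrow> solves_at f (U 0) s Y t"
        "\<And>t. t \<in> {0..s} \<Longrightarrow> dist (Y t) y \<le> s * L1" using ex[OF xy(2)] by blast
      have inR: "z \<in> cball 0 R" if "x \<in> K" "dist z x \<le> s * L1" for x z
        using R1(2)[OF that(1)] that(2) sL sLi norm_triangle_sub[of z x] by (simp add: dist_norm R_def)
      have "X s \<noteq> Y s"
      proof
        assume "X s = Y s"
        then have "X 0 = Y 0"
          by (intro solutions_backward_unique[OF L1(1,3) s(1) _ _ X(2) _ Y(2), of "cball 0 R" "cball 0 M"])
            (use sL sLi UM X(3) Y(3) inR xy in auto)
        then show False using xy X(1) Y(1) by simp
      qed
      moreover have "s \<in> {0..s}" using s by simp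
      from X(3)[OF this] Y(3)[OF this] have "dist (X s) x \<le> \<epsilon>" "dist (Y s) y \<le> \<epsilon>"
        using sL(2) sLi(1) by linarith+
      then have "X s \<in> (near K \<epsilon>)" "Y s \<in> (near K \<epsilon>)"
        using xy by blast+
      ultimately obtain j where j: "output_jet f h j (X s) (\<lambda>i. U i s) \<noteq> output_jet f h j (Y s) (\<lambda>i. U i s)"
        using Us unfolding separated_jets_def by blast
      show "\<exists>j\<in>UNIV. output_jet f h j x (\<lambda>i. A (\<sigma> i)) \<noteq> output_jet f h j y (\<lambda>i. A (\<sigma> i))"
      proof (rule ccontr)
        assume "\<not> ?thesis"
        then have "output_jet f h j (X 0) (\<lambda>i. U i 0) = output_jet f h j (Y 0) (\<lambda>i. U i 0)" for j
          unfolding X(1) Y(1) U0 by simp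
        from output_jets_identity[where U = U, OF f h U1 U s(1) X(2) Y(2) this, of s] j s show False by simp
      qed
    next
      fix x and v :: 'a assume x: "x \<in> K" and v: "v \<noteq> 0"
      \<comment> \<open>Normalization keeps \<open>(x, w)\<close> in the ball for which
        \<open>s\<close> was chosen; by linearity, vanishing in direction \<open>v\<close> is the
        same as in direction \<open>w\<close>.\<close>
      define w where "w = v /\<^sub>R norm v"
      have w: "norm w = 1" using v by (simp add: w_def)
      have xw: "norm (x, w) \<le> R1 + 1"
        using norm_Pair_le[of x w] R1(2)[OF x] w by linarith
      obtain Z where Z: "Z 0 = (x, w)"
        "\<And>t. t \<in> {0..s} \<Longrightarrow> solves_at (tangent_field f) (U 0) s Z t"
        "\<And>t. t \<in> {0..s} \<Longrightarrow> dist (Z t) (x, w) \<le> s * L2"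
      proof -
        have "\<exists>X. X 0 = (x, w) \<and> (\<forall>t\<in>{0..s}. solves_at (tangent_field f) (U 0) s X t \<and>
          dist (X t) (x, w) \<le> s * L2)"
          by (rule local_solution[OF ft L2 _ s(1) _ _ Uc UM]) (use R1 sL sLi xw R_def in \<open>force+\<close>)
        then show ?thesis using that by blast
      qed
      have inR: "Z t \<in> cball 0 R" if "t \<in> {0..s}" for t
        using xw Z(3)[OF that] sL sLi norm_triangle_sub[of "Z t" "(x, w)"] by (simp add: dist_norm R_def)
      \<comment> \<open>The variational equation is linear in the tangent vector, so zero solves it;
        backward uniqueness against this solution keeps the tangent vector of \<open>Z\<close>
        nonzero at \<open>s\<close>.\<close>
      define Z' where "Z' t = (fst (Z t), 0 :: 'a)" for t
      have Z'R: "Z' t \<in> cball 0 R" if "t \<in> {0..s}" for t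
        using inR[OF that] norm_fst_le[of "Z t"] unfolding Z'_def by (simp add: norm_Pair) (metis fst_conv norm_fst_le order_trans surj_pair)
      have Z': "solves_at (tangent_field f) (U 0) s Z' t" if "t \<in> {0..s}" for t
        unfolding Z'_def tangent_field_zero[OF analytic_fun_smooth[OF f]]
        using bounded_linear.has_vector_derivative[OF bounded_linear_fst Z(2)[OF that]]
        by (intro has_vector_derivative_Pair has_vector_derivative_const) (simp add: tangent_field_def)
      have "snd (Z s) \<noteq> 0"
      proof
        assume "snd (Z s) = 0"
        then have "Z s = Z' s" by (simp add: Z'_def prod_eq_iff)
        then have "Z 0 = Z' 0"
          by (intro solutions_backward_unique[OF L2(1,3) s(1) _ _ Z(2) _ Z', of "cball 0 R" "cball 0 M"])
            (use sL sLi UM inR Z'R in auto)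
        then show False using w Z(1) by (auto simp: Z'_def)
      qed
      moreover have "s \<in> {0..s}" using s by simp
      from Z(3)[OF this] have "dist (fst (Z s)) x \<le> \<epsilon>"
        using sL(2) sLi(2) dist_fst_le[of "Z s" "(x, w)"] by (simp only: fst_conv)
      then have "fst (Z s) \<in> (near K \<epsilon>)" using x by blast
      ultimately obtain j where j: "output_jet_deriv f h j (fst (Z s)) (\<lambda>i. U i s) (snd (Z s)) \<noteq> 0"
        using Us unfolding separated_jets_def by blast
      show "\<exists>j\<in>UNIV. output_jet_deriv f h j x (\<lambda>i. A (\<sigma> i)) v \<noteq> 0"
      proof (rule ccontr)
        assume "\<not> ?thesis"
        then have "output_jet_deriv f h j (fst (Z 0)) (\<lambda>i. U i 0) (snd (Z 0)) = 0" for j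
          unfolding Z(1) U0 fst_conv snd_conv w_def linear_scale[OF output_jet_deriv_linear[OF f h]] by simp
        from output_jet_derivs_identity[where U = U, OF f h U1 U s(1) Z(2) this, of s] j s show False by simp
      qed
    qed
  qed
  then show ?thesis using \<sigma>0 by blast
qed

section \<open>Polynomial approximation of inputs\<close>

text \<open>Split at a small \<open>\<eta>\<close>: below it \<open>t ^ i \<le> t\<close> is small
  because \<open>i \<ge> 1\<close>; above it the base of the power is at most
  \<open>\<rho> < 1\<close>, and a large \<open>N\<close> wins. For \<open>i = 0\<close> the product
  is 1 at \<open>t = 0\<close>, so that order must be handled apart.\<close>

lemma jet_factor_small:
  assumes T: "0 < T" and \<delta>: "0 < (\<delta>::real)"
  shows "\<exists>N. \<forall>i\<in>{1..q}. \<forall>t\<in>{0..T}. t ^ i * (1 - (t / T) ^ Suc q) ^ N \<le> \<delta>"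
proof -
  define \<eta> where "\<eta> = min 1 (min \<delta> T)"
  have \<eta>: "0 < \<eta>" "\<eta> \<le> 1" "\<eta> \<le> \<delta>" "\<eta> \<le> T" using T \<delta> by (auto simp: \<eta>_def)
  define \<rho> where "\<rho> = 1 - (\<eta> / T) ^ Suc q"
  have e01: "0 < \<eta> / T" "\<eta> / T \<le> 1" using \<eta> T by auto
  have \<rho>: "0 \<le> \<rho>" "\<rho> < 1"
    unfolding \<rho>_def using e01 power_le_one[of "\<eta> / T" "Suc q"] zero_less_power[of "\<eta> / T" "Suc q"] by auto
  have "(\<lambda>N. (1 + T) ^ q * \<rho> ^ N) \<longlonglongrightarrow> (1 + T) ^ q * 0"
    by (intro tendsto_mult_left LIMSEQ_power_zero) (use \<rho> in auto)
  then have "\<forall>\<^sub>F N in sequentially. (1 + T) ^ q * \<rho> ^ N < \<delta>"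
    using \<delta> by (intro order_tendstoD(2)) auto
  then obtain N where N: "(1 + T) ^ q * \<rho> ^ N < \<delta>"
    using eventually_happens' sequentially_bot by blast
  have "t ^ i * (1 - (t / T) ^ Suc q) ^ N \<le> \<delta>" if i: "i \<in> {1..q}" and t: "t \<in> {0..T}" for i t
  proof -
    have tT: "0 \<le> t / T" "t / T \<le> 1" using t T by auto
    have f: "0 \<le> 1 - (t / T) ^ Suc q" "1 - (t / T) ^ Suc q \<le> 1"
      using power_le_one[OF tT, of "Suc q"] zero_le_power[OF tT(1), of "Suc q"] by linarith+
    show ?thesis
    proof (cases "t \<le> \<eta>")
      case True
      have "t ^ i \<le> t ^ 1" using True t \<eta> i by (intro power_decreasing) auto
      then have "t ^ i * (1 - (t / T) ^ Suc q) ^ N \<le> t ^ 1 * 1"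
        using t f by (intro mult_mono power_le_one) auto
      then show ?thesis using True \<eta> by simp
    next
      case False
      have "(\<eta> / T) ^ Suc q \<le> (t / T) ^ Suc q"
        using False T \<eta> by (intro power_mono divide_right_mono) auto
      then have "(1 - (t / T) ^ Suc q) ^ N \<le> \<rho> ^ N" using f by (intro power_mono) (auto simp: \<rho>_def)
      moreover have "t ^ i \<le> (1 + T) ^ i" using t by (intro power_mono) auto
      then have "t ^ i \<le> (1 + T) ^ q"
        by (rule order_trans) (use i T in \<open>auto intro: power_increasing\<close>)
      ultimately have "t ^ i * (1 - (t / T) ^ Suc q) ^ N \<le> (1 + T) ^ q * \<rho> ^ N"
        using t T f by (intro mult_mono) auto
      then show ?thesis using N by simp
    qed
  qed
  then show ?thesis by blast
qed

lemma poly_antiderivative: "\<exists>P. pderiv P = (p :: real poly) \<and> poly P 0 = c"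
proof (intro exI conjI)
  let ?P = "[:c:] + (\<Sum>i\<le>degree p. monom (coeff p i / real (Suc i)) (Suc i))"
  show "pderiv ?P = p"
    by (rule poly_eqI)
      (auto simp: coeff_pderiv coeff_sum coeff_eq_0 not_le simp del: of_nat_Suc cong: if_cong)
  show "poly ?P 0 = c" by (simp add: poly_sum poly_monom)
qed

text \<open>A Weierstrass polynomial is corrected by \<open>jet_poly\<close> to have the prescribed
  jet. The correction of the value at \<open>0\<close> is small because
  \<open>d 0 = \<Phi> 0\<close>; those of higher order, however large, are made small on the whole
  interval by \<open>N\<close>.\<close>

lemma polynomial_approx_jet_continuous:
  fixes \<Phi> :: "real \<Rightarrow> real"
  assumes T: "0 < T" and cont: "continuous_on {0..T} \<Phi>" and d: "d 0 = \<Phi> 0" and \<epsilon>: "0 < \<epsilon>"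
  shows "\<exists>p::real poly. (\<forall>t\<in>{0..T}. \<bar>poly p t - \<Phi> t\<bar> < \<epsilon>) \<and> (\<forall>j\<le>q. poly ((pderiv ^^ j) p) 0 = d j)"
proof -
  obtain g where g: "real_polynomial_function g" "\<And>t. t \<in> {0..T} \<Longrightarrow> \<bar>\<Phi> t - g t\<bar> < \<epsilon> / 3"
    using Stone_Weierstrass_real_polynomial_function[OF compact_Icc cont, of "\<epsilon> / 3"] \<epsilon> by auto
  obtain c n where cn: "g = (\<lambda>x. \<Sum>i\<le>n. c i * x ^ i)" using g(1) real_polynomial_function_iff_sum by blast
  define r where "r = (\<Sum>i\<le>n. monom (c i) i)"
  have r: "poly r t = g t" for t by (simp add: r_def cn poly_sum poly_monom)
  define a where "a j = d j - poly ((pderiv ^^ j) r) 0" for j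
  have a0: "\<bar>a 0\<bar> < \<epsilon> / 3" using g(2)[of 0] T by (simp add: a_def d r)
  \<comment> \<open>The summand 1 keeps the divisor in \<open>\<epsilon> / (3 * S)\<close> positive;
    the thirds of \<open>\<epsilon>\<close> go to the approximation, the value at \<open>0\<close>
    and the higher orders.\<close>
  define S where "S = 1 + (\<Sum>i\<le>q. \<bar>a i\<bar>)"
  have S: "1 \<le> S" by (simp add: S_def sum_nonneg)
  obtain N where N: "\<And>i t. i \<in> {1..q} \<Longrightarrow> t \<in> {0..T} \<Longrightarrow> t ^ i * (1 - (t / T) ^ Suc q) ^ N \<le> \<epsilon> / (3 * S)"
  proof -
    have "0 < \<epsilon> / (3 * S)" using S \<epsilon> by simp
    from jet_factor_small[OF T this, of q] show ?thesis using that by blast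
  qed
  define p where "p = r + jet_poly a q T N"
  have "\<bar>poly p t - \<Phi> t\<bar> < \<epsilon>" if t: "t \<in> {0..T}" for t
  proof -
    let ?m = "\<lambda>i. t ^ i * (1 - (t / T) ^ Suc q) ^ N"
    have tT: "0 \<le> t / T" "t / T \<le> 1" using t T by auto
    have f: "0 \<le> 1 - (t / T) ^ Suc q" "1 - (t / T) ^ Suc q \<le> 1"
      using power_le_one[OF tT, of "Suc q"] zero_le_power[OF tT(1), of "Suc q"] by linarith+
    have m0: "0 \<le> ?m i" for i using t f by auto
    have 1: "\<bar>a i / fact i * ?m i\<bar> \<le> \<bar>a i\<bar> * (\<epsilon> / (3 * S))" if "i \<in> {1..q}" for i
    proof -
      have "\<bar>a i / fact i\<bar> = \<bar>a i\<bar> / fact i" by simp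
      also have "\<dots> \<le> \<bar>a i\<bar> / 1" by (intro divide_left_mono) auto
      finally show ?thesis unfolding abs_mult[of "a i / fact i"] using N[OF that t] m0[of i]
        by (intro mult_mono) auto
    qed
    have "{..q} = insert 0 {1..q}" by auto
    then have "poly (jet_poly a q T N) t = a 0 * ?m 0 + (\<Sum>i\<in>{1..q}. a i / fact i * ?m i)"
      unfolding poly_jet_poly by simp
    then have "\<bar>poly (jet_poly a q T N) t\<bar> \<le> \<bar>a 0 * ?m 0\<bar> + \<bar>\<Sum>i\<in>{1..q}. a i / fact i * ?m i\<bar>"
      by (simp only: abs_triangle_ineq)
    also have "\<bar>\<Sum>i\<in>{1..q}. a i / fact i * ?m i\<bar> \<le> (\<Sum>i\<in>{1..q}. \<bar>a i / fact i * ?m i\<bar>)"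
      by (rule sum_abs)
    also have "\<bar>a 0 * ?m 0\<bar> \<le> \<bar>a 0\<bar>"
      using power_le_one[OF f, of N] m0[of 0] by (simp add: abs_mult mult_left_le del: power_Suc)
    also have "(\<Sum>i\<in>{1..q}. \<bar>a i / fact i * ?m i\<bar>) \<le> (\<Sum>i\<in>{1..q}. \<bar>a i\<bar>) * (\<epsilon> / (3 * S))"
      unfolding sum_distrib_right by (rule sum_mono) (rule 1)
    also have "(\<Sum>i\<in>{1..q}. \<bar>a i\<bar>) * (\<epsilon> / (3 * S)) \<le> S * (\<epsilon> / (3 * S))"
    proof (rule mult_right_mono)
      have "(\<Sum>i\<in>{1..q}. \<bar>a i\<bar>) \<le> (\<Sum>i\<le>q. \<bar>a i\<bar>)" by (rule sum_mono2) auto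
      then show "(\<Sum>i\<in>{1..q}. \<bar>a i\<bar>) \<le> S" by (simp add: S_def)
    qed (use S \<epsilon> in auto)
    also have "S * (\<epsilon> / (3 * S)) = \<epsilon> / 3" using S by simp
    finally have "\<bar>poly (jet_poly a q T N) t\<bar> < 2 * \<epsilon> / 3" using a0 by simp
    then show ?thesis using g(2)[OF t] unfolding p_def poly_add r by linarith
  qed
  moreover have "poly ((pderiv ^^ j) p) 0 = d j" if "j \<le> q" for j
    using that by (simp add: p_def poly_higher_pderiv_0 coeff_jet_poly a_def distrib_left)
  ultimately show ?thesis by blast
qed

text \<open>Induction on the number of controlled derivatives: approximate the derivative and
  integrate. Only the entries of \<open>d\<close> up to \<open>k\<close> are tied to
  \<open>\<Phi>\<close>; those beyond are free.\<close>

lemma polynomial_approx_jet: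
  fixes \<Phi> :: "nat \<Rightarrow> real \<Rightarrow> real"
  assumes T: "0 < T"
    and "\<And>j t. j < k \<Longrightarrow> t \<in> {0..T} \<Longrightarrow> (\<Phi> j has_real_derivative \<Phi> (Suc j) t) (at t within {0..T})"
    and "continuous_on {0..T} (\<Phi> k)" and "\<And>j. j \<le> k \<Longrightarrow> d j = \<Phi> j 0" and "0 < \<epsilon>"
  shows "\<exists>p::real poly. (\<forall>j\<le>k. \<forall>t\<in>{0..T}. \<bar>poly ((pderiv ^^ j) p) t - \<Phi> j t\<bar> < \<epsilon>) \<and>
    (\<forall>j\<le>q. poly ((pderiv ^^ j) p) 0 = d j)"
  using assms(2-)
proof (induction k arbitrary: \<Phi> d \<epsilon>)
  case 0
  then show ?case using polynomial_approx_jet_continuous[OF T, of "\<Phi> 0" d \<epsilon> q] by auto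
next
  case (Suc k)
  \<comment> \<open>Integration over \<open>{0..T}\<close> multiplies the error by at most
    \<open>T\<close>; the 1 in the denominator keeps the derivatives themselves within
    \<open>\<epsilon>\<close>.\<close>
  define \<epsilon>' where "\<epsilon>' = \<epsilon> / (1 + T)"
  have \<epsilon>': "0 < \<epsilon>'" "\<epsilon>' \<le> \<epsilon>" "\<epsilon>' * T < \<epsilon>"
    using Suc.prems(4) T by (auto simp: \<epsilon>'_def field_simps)
  have "\<exists>p::real poly. (\<forall>j\<le>k. \<forall>t\<in>{0..T}. \<bar>poly ((pderiv ^^ j) p) t - \<Phi> (Suc j) t\<bar> < \<epsilon>') \<and>
    (\<forall>j\<le>q. poly ((pderiv ^^ j) p) 0 = d (Suc j))"
    by (rule Suc.IH) (use Suc.prems \<epsilon>' in auto)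
  then obtain p where p: "\<And>j t. j \<le> k \<Longrightarrow> t \<in> {0..T} \<Longrightarrow> \<bar>poly ((pderiv ^^ j) p) t - \<Phi> (Suc j) t\<bar> < \<epsilon>'"
    "\<And>j. j \<le> q \<Longrightarrow> poly ((pderiv ^^ j) p) 0 = d (Suc j)" by blast
  obtain P where P: "pderiv P = p" "poly P 0 = d 0" using poly_antiderivative by blast
  have PS: "(pderiv ^^ Suc j) P = (pderiv ^^ j) p" for j
    unfolding funpow_Suc_right o_apply P(1) ..
  have "\<bar>poly ((pderiv ^^ j) P) t - \<Phi> j t\<bar> < \<epsilon>" if j: "j \<le> Suc k" and t: "t \<in> {0..T}" for j t
  proof (cases j)
    case 0
    have "norm ((poly P t - \<Phi> 0 t) - (poly P 0 - \<Phi> 0 0)) \<le> \<epsilon>' * norm (t - 0)"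
    proof (rule field_differentiable_bound[of "{0..T}"])
      show "((\<lambda>t. poly P t - \<Phi> 0 t) has_real_derivative poly p u - \<Phi> (Suc 0) u) (at u within {0..T})" if "u \<in> {0..T}" for u
        using poly_DERIV[of P u] P(1) Suc.prems(1)[of 0 u] that
        by (intro DERIV_diff) (auto intro: has_field_derivative_at_within)
      show "norm (poly p u - \<Phi> (Suc 0) u) \<le> \<epsilon>'" if "u \<in> {0..T}" for u
        using p(1)[of 0 u] that by simp
    qed (use t in auto)
    also have "\<dots> \<le> \<epsilon>' * T" using t \<epsilon>' by (intro mult_left_mono) auto
    finally show ?thesis using \<epsilon>'(3) P(2) Suc.prems(3)[of 0] 0 by simp
  next
    case (Suc i)
    then show ?thesis using p(1)[of i t] j t \<epsilon>'(2) unfolding Suc PS by fastforce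
  qed
  moreover have "poly ((pderiv ^^ j) P) 0 = d j" if "j \<le> q" for j
    using that p(2) P(2) PS by (cases j) (auto simp del: funpow.simps simp: funpow_0)
  ultimately show ?case by blast
qed

section \<open>Derivatives of inputs, and polynomial inputs near a given one\<close>

lemma nderiv_0 [simp]: "nderiv I 0 u = u"
  by (simp add: nderiv_def)

lemma nderiv_Suc: "nderiv I (Suc j) u t = vector_derivative (nderiv I j u) (at t within I)"
  by (simp add: nderiv_def)

text \<open>Derivatives within \<open>I\<close> are determined only at limit points of
  \<open>I\<close>, hence the assumption on \<open>at t within I\<close>.\<close>

lemma nderiv_eqI:
  assumes I: "\<And>t. t \<in> I \<Longrightarrow> at t within I \<noteq> bot" and u0: "\<And>t. t \<in> I \<Longrightarrow> u t = Y 0 t"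
    and Y: "\<And>j t. t \<in> I \<Longrightarrow> (Y j has_vector_derivative Y (Suc j) t) (at t within I)"
    and t: "t \<in> I"
  shows "nderiv I j u t = Y j t"
    and "(nderiv I j u has_vector_derivative Y (Suc j) t) (at t within I)"
proof -
  have "\<forall>t\<in>I. nderiv I j u t = Y j t \<and> (nderiv I j u has_vector_derivative Y (Suc j) t) (at t within I)"
  proof (induction j)
    case 0
    show ?case
    proof
      fix t assume t: "t \<in> I"
      show "nderiv I 0 u t = Y 0 t \<and> (nderiv I 0 u has_vector_derivative Y (Suc 0) t) (at t within I)"
        unfolding nderiv_0 using u0[OF t] has_vector_derivative_transform[OF t u0 Y[OF t]] by blast
    qed
  next
    case (Suc j)
    then have 1: "nderiv I (Suc j) u t = Y (Suc j) t" if "t \<in> I" for t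
      unfolding nderiv_Suc using vector_derivative_within[OF I] that by blast
    show ?case
    proof
      fix t assume t: "t \<in> I"
      show "nderiv I (Suc j) u t = Y (Suc j) t \<and>
          (nderiv I (Suc j) u has_vector_derivative Y (Suc (Suc j)) t) (at t within I)"
        using 1[OF t] has_vector_derivative_transform[OF t 1 Y[OF t]] by blast
    qed
  qed
  with t show "nderiv I j u t = Y j t" "(nderiv I j u has_vector_derivative Y (Suc j) t) (at t within I)"
    by auto
qed

lemma Cinf_has_vector_derivative:
  assumes "u \<in> Cinf T" "t \<in> {0..T}"
  shows "(nderiv {0..T} j u has_vector_derivative nderiv {0..T} (Suc j) u t) (at t within {0..T})"
  using assms unfolding nderiv_Suc Cinf_def by (auto simp: vector_derivative_works)

lemma Cinf_continuous_on: "u \<in> Cinf T \<Longrightarrow> continuous_on {0..T} (nderiv {0..T} j u)"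
  by (rule continuous_on_vector_derivative) (rule Cinf_has_vector_derivative)

lemma restrict_vec_poly:
  assumes T: "0 < T"
  shows "restrict (vec_poly V 0) {0..T} \<in> Cinf T"
    and "\<And>t. t \<in> {0..T} \<Longrightarrow> nderiv {0..T} j (restrict (vec_poly V 0) {0..T}) t = vec_poly V j t"
proof -
  have 1: "nderiv {0..T} j (restrict (vec_poly V 0) {0..T}) t = vec_poly V j t"
    "(nderiv {0..T} j (restrict (vec_poly V 0) {0..T}) has_vector_derivative vec_poly V (Suc j) t) (at t within {0..T})"
    if "t \<in> {0..T}" for t j
    using that at_within_Icc_not_bot[OF T] has_vector_derivative_at_within[OF has_vector_derivative_vec_poly]
    by (auto intro!: nderiv_eqI[where Y = "vec_poly V"])
  show "restrict (vec_poly V 0) {0..T} \<in> Cinf T"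
    unfolding Cinf_def using differentiableI_vector[OF 1(2)] by blast
  show "\<And>t. t \<in> {0..T} \<Longrightarrow> nderiv {0..T} j (restrict (vec_poly V 0) {0..T}) t = vec_poly V j t"
    by (rule 1)
qed

lemma vec_poly_real_analytic: "vec_poly V 0 real_analytic_on S"
  unfolding real_analytic_on_def
proof (intro ballI exI[of _ "1::real"] conjI)
  fix x :: real
  define P where "P b = pcompose (V b) [:x, 1:]" for b
  define d where "d = (\<Sum>b\<in>Basis. degree (P b))"
  define a where "a n = (\<Sum>b\<in>Basis. coeff (P b) n *\<^sub>R b)" for n
  have d: "degree (P b) \<le> d" if "b \<in> Basis" for b
    unfolding d_def by (rule member_le_sum) (use that in auto)
  have exp: "vec_poly V 0 y = (\<Sum>n\<le>d. (y - x) ^ n *\<^sub>R a n)" for y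
  proof -
    have "poly (V b) y = (\<Sum>n\<le>d. coeff (P b) n * (y - x) ^ n)" if "b \<in> Basis" for b
    proof -
      have "poly (V b) y = poly (P b) (y - x)" by (simp add: P_def poly_pcompose)
      also have "\<dots> = (\<Sum>n\<le>d. coeff (P b) n * (y - x) ^ n)"
        unfolding poly_altdef by (rule sum.mono_neutral_left) (use d[OF that] in \<open>auto simp: coeff_eq_0\<close>)
      finally show ?thesis .
    qed
    then have "vec_poly V 0 y = (\<Sum>b\<in>Basis. (\<Sum>n\<le>d. coeff (P b) n * (y - x) ^ n) *\<^sub>R b)"
      by (simp add: vec_poly_def)
    also have "\<dots> = (\<Sum>n\<le>d. (y - x) ^ n *\<^sub>R a n)"
      unfolding a_def scaleR_sum_left scaleR_sum_right by (subst sum.swap) (simp add: mult.commute)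
    finally show ?thesis .
  qed
  \<comment> \<open>\<open>Basis\<close> of \<open>real\<close> is \<open>{1}\<close>, so
    multi-indices correspond to exponents, and the expansion in powers of \<open>y - x\<close> is
    the required series.\<close>
  have bij: "bij_betw (\<lambda>n. \<lambda>b\<in>Basis. n) UNIV (Basis \<rightarrow>\<^sub>E UNIV :: (real \<Rightarrow> nat) set)"
    by (rule bij_betw_byWitness[where f' = "\<lambda>\<alpha>. \<alpha> 1"]) (auto simp: fun_eq_iff PiE_def extensional_def)
  show "\<exists>c. \<forall>y\<in>ball x 1. ((\<lambda>\<alpha>. (\<Prod>b\<in>Basis. ((y - x) \<bullet> b) ^ \<alpha> b) *\<^sub>R c \<alpha>) has_sum vec_poly V 0 y) (Basis \<rightarrow>\<^sub>E UNIV)"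
  proof (intro exI ballI)
    fix y
    have "((\<lambda>n. (y - x) ^ n *\<^sub>R (if n \<le> d then a n else 0)) has_sum vec_poly V 0 y) UNIV"
      unfolding exp by (rule has_sum_finite_neutralI[of "{..d}"]) auto
    then show "((\<lambda>\<alpha>. (\<Prod>b\<in>Basis. ((y - x) \<bullet> b) ^ \<alpha> b) *\<^sub>R (if \<alpha> 1 \<le> d then a (\<alpha> 1) else 0)) has_sum vec_poly V 0 y) (Basis \<rightarrow>\<^sub>E UNIV)"
      by (subst has_sum_reindex_bij_betw[OF bij, symmetric]) (simp add: Basis_real_def cong: if_cong)
  qed
qed simp

lemma restrict_vec_poly_Comega:
  assumes "0 < T" shows "restrict (vec_poly V 0) {0..T} \<in> Comega T"
  unfolding Comega_def mem_Collect_eq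
  by (rule conjI, simp, rule exI[of _ "-1"], rule exI[of _ "T + 1"], rule exI[of _ "vec_poly V 0"])
    (simp add: vec_poly_real_analytic)

lemma Cinf_nhd_norm_less:
  assumes T: "0 \<le> T" and u: "u \<in> Cinf T" and w: "w \<in> Cinf_nhd T u k \<epsilon>" and j: "j \<le> k" and t: "t \<in> {0..T}"
  shows "norm (nderiv {0..T} j w t - nderiv {0..T} j u t) < \<epsilon> j"
proof -
  have "w \<in> Cinf T" using w by (simp add: Cinf_nhd_def)
  then have "bdd_above ((\<lambda>t. norm (nderiv {0..T} j w t - nderiv {0..T} j u t)) ` {0..T})"
    by (intro bounded_imp_bdd_above compact_imp_bounded compact_continuous_image
        continuous_on_norm continuous_on_diff Cinf_continuous_on u compact_Icc)
  from cSUP_upper[OF t this] show ?thesis using w j by (force simp: Cinf_nhd_def)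
qed

text \<open>The topology controls only finitely many derivatives, so jet entries beyond order
  \<open>k\<close> can be prescribed freely within the neighborhood. Density of the good inputs
  comes from this.\<close>

lemma polynomial_in_nhd:
  fixes u :: "real \<Rightarrow> 'b::euclidean_space"
  assumes T: "0 < T" and u: "u \<in> Cinf T" and \<epsilon>: "\<forall>j\<le>k. 0 < \<epsilon> j"
    and \<sigma>: "\<And>i. i \<le> k \<Longrightarrow> \<sigma> i = nderiv {0..T} i u 0"
  shows "\<exists>w \<in> Cinf_nhd T u k \<epsilon> \<inter> Comega T. \<forall>i\<le>q. nderiv {0..T} i w 0 = \<sigma> i"
proof -
  define e where "e = Min (\<epsilon> ` {..k})"
  have e: "0 < e" "\<And>j. j \<le> k \<Longrightarrow> e \<le> \<epsilon> j" using \<epsilon> by (auto simp: e_def)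
  define e' where "e' = e / (2 * DIM('b))"
  have e': "0 < e'" using e by (simp add: e'_def)
  have "\<exists>p::real poly. (\<forall>j\<le>k. \<forall>t\<in>{0..T}. \<bar>poly ((pderiv ^^ j) p) t - nderiv {0..T} j u t \<bullet> b\<bar> < e') \<and>
    (\<forall>j\<le>q. poly ((pderiv ^^ j) p) 0 = \<sigma> j \<bullet> b)" for b
  proof (rule polynomial_approx_jet[OF T _ _ _ e'])
    show "((\<lambda>t. nderiv {0..T} j u t \<bullet> b) has_real_derivative nderiv {0..T} (Suc j) u t \<bullet> b) (at t within {0..T})"
      if "t \<in> {0..T}" for j t
      unfolding has_real_derivative_iff_has_vector_derivative
      by (rule bounded_linear.has_vector_derivative[OF bounded_linear_inner_left Cinf_has_vector_derivative[OF u that]])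
    show "continuous_on {0..T} (\<lambda>t. nderiv {0..T} k u t \<bullet> b)"
      by (intro continuous_intros Cinf_continuous_on u)
  qed (use \<sigma> in auto)
  then obtain V where V: "\<And>b j t. j \<le> k \<Longrightarrow> t \<in> {0..T} \<Longrightarrow> \<bar>poly ((pderiv ^^ j) (V b)) t - nderiv {0..T} j u t \<bullet> b\<bar> < e'"
    "\<And>b j. j \<le> q \<Longrightarrow> poly ((pderiv ^^ j) (V b)) 0 = \<sigma> j \<bullet> b" by metis
  let ?w = "restrict (vec_poly V 0) {0..T}"
  \<comment> \<open>\<open>e / 2\<close> instead of \<open>e\<close>, since the supremum in
    \<open>Cinf_nhd\<close> has to stay strictly below \<open>\<epsilon> j\<close>.\<close>
  have "norm (nderiv {0..T} j ?w t - nderiv {0..T} j u t) \<le> e / 2" if j: "j \<le> k" and t: "t \<in> {0..T}" for j t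
  proof -
    have "norm (vec_poly V j t - nderiv {0..T} j u t) \<le> (\<Sum>b\<in>Basis. \<bar>(vec_poly V j t - nderiv {0..T} j u t) \<bullet> b\<bar>)"
      by (rule norm_le_l1)
    also have "\<dots> \<le> (\<Sum>b\<in>(Basis::'b set). e')"
      by (rule sum_mono) (use V(1)[OF j t] in \<open>force simp: inner_diff_left vec_poly_inner intro: less_imp_le\<close>)
    also have "\<dots> = e / 2" by (simp add: e'_def)
    finally show ?thesis by (simp add: restrict_vec_poly(2)[OF T t])
  qed
  then have "(SUP t\<in>{0..T}. norm (nderiv {0..T} j ?w t - nderiv {0..T} j u t)) < \<epsilon> j" if "j \<le> k" for j
    using cSUP_least[of "{0..T}" "\<lambda>t. norm (nderiv {0..T} j ?w t - nderiv {0..T} j u t)" "e / 2"] T that e(2)[OF that] e(1)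
    by fastforce
  then have "?w \<in> Cinf_nhd T u k \<epsilon>"
    unfolding Cinf_nhd_def using restrict_vec_poly(1)[OF T] by blast
  moreover have "nderiv {0..T} i ?w 0 = \<sigma> i" if "i \<le> q" for i
    using restrict_vec_poly(2)[OF T, where V = V and t = 0 and j = i] T vec_poly_eqI[of i V 0 "\<sigma> i"] V(2)[OF that] by simp
  ultimately show ?thesis using restrict_vec_poly_Comega[OF T] by blast
qed

section \<open>Genericity of the good inputs\<close>

lemma injective_differential_imp:
  assumes "injective_differential k (\<lambda>y. jet_vector f h I k y t u) x" "v \<noteq> 0"
  shows "\<exists>j\<le>k. output_jet_deriv f h j x (\<lambda>i. nderiv I i u t) v \<noteq> 0"
proof -
  obtain D where D: "\<And>j. j \<le> k \<Longrightarrow> ((\<lambda>y. jet_vector f h I k y t u j) has_derivative D j) (at x)"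
    and inj: "inj (\<lambda>v. \<lambda>j\<in>{..k}. D j v)"
    using assms(1) unfolding injective_differential_def by blast
  have eq: "output_jet_deriv f h j x (\<lambda>i. nderiv I i u t) = D j" if "j \<le> k" for j
    using frechet_derivative_at[OF D[OF that]] that
    by (simp add: output_jet_deriv_def[abs_def] jet_vector_def)
  show ?thesis
  proof (rule ccontr)
    assume "\<not> ?thesis"
    then have "D j v = D j 0" if "j \<le> k" for j
      using that fun_cong[OF eq[OF that], of v] linear_0[OF has_derivative_linear[OF D[OF that]]] by auto
    then have "(\<lambda>j\<in>{..k}. D j v) = (\<lambda>j\<in>{..k}. D j 0)" by (intro restrict_ext) auto
    from injD[OF inj this] show False using assms(2) by simp
  qed
qed

lemma separated_jets_imp_injective_immersion:
  fixes f :: "'a::euclidean_space \<times> 'p::euclidean_space \<Rightarrow> 'a" and h :: "'a \<Rightarrow> 'c::euclidean_space"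
  assumes f: "analytic_fun f" and h: "analytic_fun h"
    and sep: "separated_jets f h {..q} (\<lambda>i. nderiv I i u t) K"
  shows "injective_immersion_over q (\<lambda>x. jet_vector f h I q x t u) K"
  unfolding injective_immersion_over_def
proof (intro conjI ballI inj_onI)
  let ?\<sigma> = "\<lambda>i. nderiv I i u t"
  have jv: "jet_vector f h I q x t u j = output_jet f h j x ?\<sigma>" if "j \<le> q" for x j
    using that by (simp add: jet_vector_def)
  fix x y assume "x \<in> K" "y \<in> K" "jet_vector f h I q x t u = jet_vector f h I q y t u"
  then show "x = y" using sep jv unfolding separated_jets_def by (metis atMost_iff)
next
  let ?\<sigma> = "\<lambda>i. nderiv I i u t" and ?D = "\<lambda>x j. output_jet_deriv f h j x (\<lambda>i. nderiv I i u t)"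
  fix x assume x: "x \<in> K"
  have hd: "((\<lambda>y. jet_vector f h I q y t u j) has_derivative ?D x j) (at x)" if "j \<le> q" for j
    using has_derivative_output_jet[OF f h] that by (simp add: jet_vector_def)
  have inj: "inj (\<lambda>v. \<lambda>j\<in>{..q}. ?D x j v)"
  proof (rule injI)
    fix v w assume eq: "(\<lambda>j\<in>{..q}. ?D x j v) = (\<lambda>j\<in>{..q}. ?D x j w)"
    have "?D x j (v - w) = 0" if "j \<le> q" for j
      using fun_cong[OF eq, of j] that linear_diff[OF output_jet_deriv_linear[OF f h]] by simp
    then show "v = w" using sep x unfolding separated_jets_def by (metis atMost_iff eq_iff_diff_eq_0)
  qed
  show "injective_differential q (\<lambda>x. jet_vector f h I q x t u) x"
    unfolding injective_differential_def
    by (rule exI[of _ "?D x"], rule conjI, intro allI impI, erule hd, rule inj)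
qed

lemma nderiv_zero_input:
  "t \<in> {0..} \<Longrightarrow> nderiv {0..} i (\<lambda>_. 0 :: 'b::real_normed_vector) t = 0"
proof (rule nderiv_eqI(1)[where Y = "\<lambda>_ _. 0"])
  show "at t within {0..} \<noteq> bot" if "t \<in> {0..}" for t :: real
  proof -
    have "at t within {t..t + 1} \<le> at t within {0..}" using that by (intro at_le) auto
    moreover have "at t within {t..t + 1} \<noteq> bot" by (simp add: trivial_limit_within islimpt_Icc)
    ultimately show ?thesis by (metis bot_unique)
  qed
qed auto

text \<open>Equal jets at \<open>0\<close> would propagate by the identity theorem for the null
  input and force equal outputs at \<open>t\<close>. The case \<open>t = 0\<close> is apart because
  that theorem needs an interval of positive length.\<close>

lemma observable_imp_jets_differ:
  fixes f :: "'a::euclidean_space \<times> 'p::euclidean_space \<Rightarrow> 'a" and h :: "'a \<Rightarrow> 'c::euclidean_space"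
  assumes f: "analytic_fun f" and h: "analytic_fun h"
    and obs: "observable f h {0..} (\<lambda>_. 0) X \<tau>" and x: "x \<in> X" "x' \<in> X" "x \<noteq> x'"
  shows "\<exists>j. output_jet f h j x (\<lambda>_. 0) \<noteq> output_jet f h j x' (\<lambda>_. 0)"
proof (rule ccontr)
  assume eq: "\<nexists>j. output_jet f h j x (\<lambda>_. 0) \<noteq> output_jet f h j x' (\<lambda>_. 0)"
  obtain t J \<phi> J' \<phi>' where t: "0 \<le> t" and sol: "is_solution f {0..} (\<lambda>_. 0) x J \<phi>" "is_solution f {0..} (\<lambda>_. 0) x' J' \<phi>'"
    and J: "{0..t} \<subseteq> J" "{0..t} \<subseteq> J'" and ne: "h (\<phi> t) \<noteq> h (\<phi>' t)"
    using obs x unfolding observable_def is_maximal_solution_def by (metis atLeastAtMost_iff)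
  have i: "\<phi> 0 = x" "\<phi>' 0 = x'" using sol by (auto simp: is_solution_def)
  have d: "(\<phi> has_vector_derivative f (\<phi> r, 0)) (at r within {0..t})"
    "(\<phi>' has_vector_derivative f (\<phi>' r, 0)) (at r within {0..t})" if "r \<in> {0..t}" for r
  proof -
    have "(\<phi> has_vector_derivative f (\<phi> r, 0)) (at r within J)"
      "(\<phi>' has_vector_derivative f (\<phi>' r, 0)) (at r within J')"
      using sol J that unfolding is_solution_def by blast+
    then show "(\<phi> has_vector_derivative f (\<phi> r, 0)) (at r within {0..t})"
      "(\<phi>' has_vector_derivative f (\<phi>' r, 0)) (at r within {0..t})"
      using J has_vector_derivative_within_subset by blast+
  qed
  have "output_jet f h 0 (\<phi> t) (\<lambda>_. 0) = output_jet f h 0 (\<phi>' t) (\<lambda>_. 0)"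
  proof (cases "t = 0")
    case True
    then show ?thesis using i eq by blast
  next
    case False
    show ?thesis
      by (rule output_jets_identity[where U = "\<lambda>_ _. 0" and s = t, OF f h])
        (use False t d i eq in auto)
  qed
  with ne show False by simp
qed

text \<open>The matrices of operator norm at most 1: a compact set that contains every
  \<open>\<mu> *\<^sub>R R\<close> and keeps inputs within the bound on which the short-time flow
  depends.\<close>

definition contractive_matrices :: "(real^'p^'p) set" where
  "contractive_matrices = {A. \<forall>v. norm (A *v v) \<le> norm v}"

lemma compact_contractive_matrices: "compact (contractive_matrices :: (real^'p^'p) set)"
  unfolding compact_eq_bounded_closed
proof
  have c: "continuous_on UNIV (\<lambda>A :: real^'p^'p. A *v v)" for v
    unfolding matrix_vector_mult_def by (intro continuous_on_vec_lambda continuous_intros)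
  have "closed {A :: real^'p^'p. norm (A *v v) \<le> norm v}" for v
    by (intro closed_Collect_le continuous_on_norm c continuous_on_const)
  then have "closed (\<Inter>v. {A :: real^'p^'p. norm (A *v v) \<le> norm v})" by auto
  moreover have "(\<Inter>v. {A :: real^'p^'p. norm (A *v v) \<le> norm v}) = contractive_matrices"
    by (auto simp: contractive_matrices_def)
  ultimately show "closed (contractive_matrices :: (real^'p^'p) set)" by simp
  show "bounded (contractive_matrices :: (real^'p^'p) set)"
    unfolding bounded_iff
  proof (intro exI ballI)
    fix A :: "real^'p^'p" assume A: "A \<in> contractive_matrices"
    have "\<bar>A $ i $ j\<bar> \<le> 1" for i j
    proof -
      have "A $ i $ j = (A *v axis j 1) $ i" by (simp add: matrix_vector_mul_component column_def matrix_vector_mult_basis)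
      then have "\<bar>A $ i $ j\<bar> \<le> norm (A *v axis j 1)" using component_le_norm_cart by metis
      also have "\<dots> \<le> norm (axis j (1::real))" using A unfolding contractive_matrices_def by blast
      finally show ?thesis by simp
    qed
    then have "norm (A $ i) \<le> CARD('p)" for i
      using norm_le_l1_cart[of "A $ i"] sum_bounded_above[of UNIV "\<lambda>j. \<bar>A $ i $ j\<bar>" 1] by simp
    then have "(\<Sum>i\<in>UNIV. norm (A $ i)) \<le> CARD('p) * CARD('p)"
      using sum_bounded_above[of UNIV "\<lambda>i. norm (A $ i)" "CARD('p)"] by simp
    moreover have "norm A \<le> (\<Sum>i\<in>UNIV. norm (A $ i))"
      unfolding norm_vec_def by (rule L2_set_le_sum) simp
    ultimately show "norm A \<le> CARD('p) * CARD('p)" by linarith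
  qed
qed

lemma scaled_orthogonal_contractive:
  assumes "orthogonal_matrix (R :: real^'p^'p)" "\<mu> \<in> {0..1}"
  shows "\<mu> *\<^sub>R R \<in> contractive_matrices"
proof -
  have "norm (R *v v) = norm v" for v
    using assms(1) orthogonal_transformation_matrix[of "(*v) R"] orthogonal_transformation_norm by auto
  then show ?thesis
    using assms(2) by (simp add: contractive_matrices_def scaleR_matrix_vector_assoc[symmetric] mult_left_le_one_le)
qed

lemma nderiv_linear_image:
  assumes v: "v \<in> Cinf T" and T: "0 < T" and L: "bounded_linear L" and t: "t \<in> {0..T}"
  shows "nderiv {0..T} i (\<lambda>s. L (v s)) t = L (nderiv {0..T} i v t)"
  by (rule nderiv_eqI(1)[where Y = "\<lambda>i t. L (nderiv {0..T} i v t)", OF at_within_Icc_not_bot[OF T] _ _ t])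
    (auto intro: bounded_linear.has_vector_derivative[OF L Cinf_has_vector_derivative[OF v]])

theorem theorem7:
  fixes f :: "(real^'n) \<times> (real^'p) \<Rightarrow> real^'n"
    and h :: "real^'n \<Rightarrow> real^'m"
    and X K :: "(real^'n) set"
    and Tbar :: real
  assumes f: "f real_analytic_on UNIV"
    and h: "h real_analytic_on UNIV"
    and X: "open X"
    and A1: "\<exists>\<tau>>0. observable f h {0..} (\<lambda>_. 0) X \<tau>"
    and A2: "\<forall>x\<in>X. \<exists>k. injective_differential k (\<lambda>y. jet_vector f h {0..} k y 0 (\<lambda>_. 0)) x"
    and K: "compact K" "K \<subseteq> X"
    and Tbar: "0 < Tbar"
  shows "(\<exists>G :: nat \<Rightarrow> (real \<Rightarrow> real^'p) set.
            (\<forall>i. openin (Cinf_topology Tbar) (G i) \<and>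
                 Cinf_topology Tbar closure_of G i = Cinf Tbar) \<and>
            (\<Inter>i. G i) \<subseteq> good_inputs f h Tbar K) \<and>
         Cinf_topology Tbar closure_of (good_inputs f h Tbar K \<inter> Comega Tbar) = Cinf Tbar"
proof -
  note fa = real_analytic_imp_analytic_fun[OF f] and ha = real_analytic_imp_analytic_fun[OF h]
  let ?I = "{0..Tbar}"
  have "separated_jets f h UNIV (\<lambda>_. 0) K"
    unfolding separated_jets_def
  proof (intro conjI ballI allI impI)
    fix x y assume "x \<in> K" "y \<in> K" "x \<noteq> y"
    then show "\<exists>j\<in>UNIV. output_jet f h j x (\<lambda>_. 0) \<noteq> output_jet f h j y (\<lambda>_. 0)"
      using A1 observable_imp_jets_differ[OF fa ha] K(2) by blast
  next
    fix x and v :: "real^'n" assume "x \<in> K" "v \<noteq> 0"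
    moreover obtain k where "injective_differential k (\<lambda>y. jet_vector f h {0..} k y 0 (\<lambda>_. 0)) x"
      using A2 K(2) \<open>x \<in> K\<close> by blast
    ultimately show "\<exists>j\<in>UNIV. output_jet_deriv f h j x (\<lambda>_. 0) v \<noteq> 0"
      using injective_differential_imp[of k f h "{0..}" 0 "\<lambda>_. 0" x v] by (auto simp: nderiv_zero_input)
  qed
  then obtain k where k: "separated_jets f h {..k} (\<lambda>_. 0) K"
    using separated_jets_finite[OF fa ha K(1)] by blast
  \<comment> \<open>Openness is built in: separation is demanded of all jets
    \<open>\<epsilon>\<close>-close in the first \<open>q\<close> entries. This serves both nearby
    inputs at time \<open>0\<close> and the same input at small positive times.\<close>
  define stable where "stable \<sigma> q \<epsilon> \<longleftrightarrow> (\<forall>\<sigma>'. (\<forall>i<q. dist (\<sigma>' i) (\<sigma> i) < \<epsilon>) \<longrightarrow>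
      (\<forall>A\<in>contractive_matrices. separated_jets f h {..q} (\<lambda>i. A *v \<sigma>' i) K))" for \<sigma> q and \<epsilon> :: real
  define G where "G = {v \<in> Cinf Tbar. \<exists>q \<epsilon>. 0 < \<epsilon> \<and> stable (\<lambda>i. nderiv ?I i v 0) q \<epsilon>}"
  have 0: "0 \<in> ?I" using Tbar by simp
  have extend: "\<exists>\<sigma> q \<epsilon>. (\<forall>i\<le>m. \<sigma> i = \<sigma>0 i) \<and> 0 < \<epsilon> \<and> stable \<sigma> q \<epsilon>" for m and \<sigma>0 :: "nat \<Rightarrow> real^'p"
  proof -
    obtain \<sigma> where \<sigma>: "\<forall>i\<le>m. \<sigma> i = \<sigma>0 i" "\<And>A. linear A \<Longrightarrow> (\<And>v. norm (A v) \<le> norm v) \<Longrightarrow> separated_jets f h UNIV (\<lambda>i. A (\<sigma> i)) K"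
      using separating_jet_extension[OF fa ha K(1) k] by blast
    have "separated_jets f h UNIV (\<lambda>i. A *v \<sigma> i) K" if "A \<in> contractive_matrices" for A
      by (rule \<sigma>(2)) (use that in \<open>auto simp: contractive_matrices_def\<close>)
    from separated_jets_uniform[OF fa ha K(1) compact_contractive_matrices this]
    show ?thesis using \<sigma>(1) unfolding stable_def by blast
  qed
  have openG: "openin (Cinf_topology Tbar) G"
    unfolding openin_Cinf_topology
  proof (intro conjI ballI)
    show "G \<subseteq> Cinf Tbar" by (auto simp: G_def)
    fix v assume "v \<in> G"
    then obtain q \<epsilon> where v: "v \<in> Cinf Tbar" "0 < \<epsilon>" "stable (\<lambda>i. nderiv ?I i v 0) q \<epsilon>"
      by (auto simp: G_def)
    have "w \<in> G" if w: "w \<in> Cinf_nhd Tbar v q (\<lambda>_. \<epsilon> / 2)" for w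
    proof -
      have "stable (\<lambda>i. nderiv ?I i w 0) q (\<epsilon> / 2)"
        unfolding stable_def
      proof (intro allI impI)
        fix \<sigma>' assume \<sigma>': "\<forall>i<q. dist (\<sigma>' i) (nderiv ?I i w 0) < \<epsilon> / 2"
        have "dist (\<sigma>' i) (nderiv ?I i v 0) < \<epsilon>" if "i < q" for i
          using dist_triangle_half_l[of "\<sigma>' i" "nderiv ?I i w 0" \<epsilon> "nderiv ?I i v 0"] \<sigma>' that
            Cinf_nhd_norm_less[OF _ v(1) w _ 0, of i] Tbar by (auto simp: dist_norm norm_minus_commute)
        then show "\<forall>A\<in>contractive_matrices. separated_jets f h {..q} (\<lambda>i. A *v \<sigma>' i) K"
          using v(3) unfolding stable_def by blast
      qed
      moreover have "w \<in> Cinf Tbar" using w by (simp add: Cinf_nhd_def)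
      ultimately show ?thesis using v(2) half_gt_zero unfolding G_def by blast
    qed
    then show "\<exists>k \<epsilon>. (\<forall>j\<le>k. 0 < \<epsilon> j) \<and> Cinf_nhd Tbar v k \<epsilon> \<subseteq> G"
      using v(2) by (intro exI[of _ q] exI[of _ "\<lambda>_. \<epsilon> / 2"]) auto
  qed
  have good: "G \<subseteq> good_inputs f h Tbar K"
  proof
    fix v assume "v \<in> G"
    then obtain q \<epsilon> where v: "v \<in> Cinf Tbar" and \<epsilon>: "0 < \<epsilon>" and st: "stable (\<lambda>i. nderiv ?I i v 0) q \<epsilon>"
      by (auto simp: G_def)
    have "\<exists>d>0. \<forall>t\<in>?I. dist t 0 < d \<longrightarrow> dist (nderiv ?I i v t) (nderiv ?I i v 0) < \<epsilon>" for i
      using Cinf_continuous_on[OF v, of i] 0 \<epsilon> unfolding continuous_on_iff by blast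
    then obtain d where d: "\<And>i. 0 < d i" "\<And>i t. t \<in> ?I \<Longrightarrow> dist t 0 < d i \<Longrightarrow> dist (nderiv ?I i v t) (nderiv ?I i v 0) < \<epsilon>"
      by metis
    \<comment> \<open>\<open>Tbar\<close> keeps the set nonempty when \<open>q = 0\<close>; halving
      makes \<open>T < d i\<close> strict.\<close>
    define T where "T = Min (insert Tbar (d ` {..<q})) / 2"
    have T: "0 < T" "T \<le> Tbar" "\<And>i. i < q \<Longrightarrow> T < d i"
    proof -
      have m: "0 < Min (insert Tbar (d ` {..<q}))" using d(1) Tbar by (subst Min_gr_iff) auto
      then show "0 < T" by (simp add: T_def)
      have le: "Min (insert Tbar (d ` {..<q})) \<le> c" if "c \<in> insert Tbar (d ` {..<q})" for c
        using that by (intro Min_le) auto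
      have "Min (insert Tbar (d ` {..<q})) \<le> Tbar" by (rule le) simp
      with m show "T \<le> Tbar" unfolding T_def by linarith
      show "T < d i" if "i < q" for i
      proof -
        have "Min (insert Tbar (d ` {..<q})) \<le> d i" by (rule le) (use that in simp)
        with m show ?thesis unfolding T_def by linarith
      qed
    qed
    have "injective_immersion_over q (\<lambda>x. jet_vector f h ?I q x t (\<lambda>s. \<mu> *\<^sub>R (R *v v s))) K"
      if t: "t \<in> {0..T}" and \<mu>: "\<mu> \<in> {0..1}" and R: "orthogonal_matrix R" for t \<mu> R
    proof (rule separated_jets_imp_injective_immersion[OF fa ha])
      have tI: "t \<in> ?I" using t T by auto
      have "bounded_linear (\<lambda>u. \<mu> *\<^sub>R (R *v u))"
        by (intro bounded_linear_compose[OF bounded_linear_scaleR_right] matrix_vector_mul_bounded_linear)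
      from nderiv_linear_image[OF v Tbar this tI]
      have "(\<lambda>i. nderiv ?I i (\<lambda>s. \<mu> *\<^sub>R (R *v v s)) t) = (\<lambda>i. (\<mu> *\<^sub>R R) *v nderiv ?I i v t)"
        by (simp add: scaleR_matrix_vector_assoc)
      moreover have "\<forall>i<q. dist (nderiv ?I i v t) (nderiv ?I i v 0) < \<epsilon>"
        using d(2)[OF tI] T(3) t by (auto simp: dist_real_def intro: le_less_trans)
      ultimately show "separated_jets f h {..q} (\<lambda>i. nderiv ?I i (\<lambda>s. \<mu> *\<^sub>R (R *v v s)) t) K"
        using st scaled_orthogonal_contractive[OF R \<mu>] unfolding stable_def by simp
    qed
    then show "v \<in> good_inputs f h Tbar K"
      unfolding good_inputs_def using v T by blast
  qed
  \<comment> \<open>Both density claims follow from one fact: the analytic inputs in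
    \<open>G\<close> meet every nonempty open set.\<close>
  have meets: "(G \<inter> Comega Tbar) \<inter> U \<noteq> {}" if U: "openin (Cinf_topology Tbar) U" "U \<noteq> {}" for U
  proof -
    obtain u where u: "u \<in> U" using U(2) by blast
    then obtain m \<epsilon> where \<epsilon>: "u \<in> Cinf Tbar" "\<forall>j\<le>m. 0 < \<epsilon> j" "Cinf_nhd Tbar u m \<epsilon> \<subseteq> U"
      using U(1) unfolding openin_Cinf_topology by blast
    obtain \<sigma> q \<delta> where \<sigma>: "\<And>i. i \<le> m \<Longrightarrow> \<sigma> i = nderiv ?I i u 0" "0 < \<delta>" "stable \<sigma> q \<delta>"
      using extend[of m "\<lambda>i. nderiv ?I i u 0"] by blast
    obtain w where w: "w \<in> Cinf_nhd Tbar u m \<epsilon>" "w \<in> Comega Tbar" "\<And>i. i \<le> q \<Longrightarrow> nderiv ?I i w 0 = \<sigma> i"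
      using polynomial_in_nhd[OF Tbar \<epsilon>(1,2) \<sigma>(1), of q] by blast
    \<comment> \<open>\<open>stable\<close> looks only at entries below \<open>q\<close>, all of
      which \<open>w\<close> shares with \<open>\<sigma>\<close>.\<close>
    have "stable (\<lambda>i. nderiv ?I i w 0) q \<delta>" using \<sigma>(3) w(3) unfolding stable_def by simp
    then have "w \<in> G" using w(1) \<sigma>(2) unfolding G_def Cinf_nhd_def by blast
    then show ?thesis using w \<epsilon>(3) by blast
  qed
  have dense: "Cinf_topology Tbar closure_of S = Cinf Tbar" if "G \<inter> Comega Tbar \<subseteq> S" for S
  proof -
    have "S \<inter> U \<noteq> {}" if "openin (Cinf_topology Tbar) U \<and> U \<noteq> {}" for U
      using meets[of U] that \<open>G \<inter> Comega Tbar \<subseteq> S\<close> by blast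
    then have "Cinf_topology Tbar closure_of S = topspace (Cinf_topology Tbar)"
      unfolding dense_intersects_open by blast
    then show ?thesis by simp
  qed
  \<comment> \<open>\<open>G\<close> itself is open and dense, so a constant sequence serves for the
    countable intersection.\<close>
  show ?thesis
  proof (intro conjI exI[of _ "\<lambda>_. G"] allI)
    show "openin (Cinf_topology Tbar) G" by (rule openG)
    show "Cinf_topology Tbar closure_of G = Cinf Tbar" by (rule dense) auto
    show "(\<Inter>i::nat. G) \<subseteq> good_inputs f h Tbar K" using good by simp
    show "Cinf_topology Tbar closure_of (good_inputs f h Tbar K \<inter> Comega Tbar) = Cinf Tbar"
      by (rule dense) (use good in auto)
  qed
qed

end
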